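(* Let $\mathcal M(\mathfrak s)$ be an $\mathfrak m$-critical closed RW spacetime of Class II and negative type, with cosmological constant $\Lambda$, and angular parameter $\vartheta>0$. (In this case, the internal parameter $\mathcal H$ is necessarily positive.) Let $(\widetilde{\mathcal M}_{\mathcal H,\vartheta},\ell_{\mathcal H,\vartheta})$ denote its conformal model. Put $$\widehat h_1(\vartheta,\mathcal H)=\frac1{3\mathcal H^2}(1-2\cosh\vartheta)^2,$$ $$\widehat h_2(\vartheta,\mathcal H)=\frac1{18\mathcal H^2}(3-2\cosh\vartheta)(1-2\cosh\vartheta)^2,$$ $$\widehat h_3(\vartheta,\mathcal H)=-\frac1{6\mathcal H^2}(1+2\cosh\vartheta)(1-2\cosh\vartheta)^2.$$ Then $$\Lambda\le\widehat h_1(\vartheta,\mathcal H),\qquad \widetilde{\mathcal M}_{\mathcal H,\vartheta}=\mathbb R\times\mathbb S^3,$$ and $\ell_{\mathcal H,\vartheta}$ is the cyclic quadratic form $$\ell_{\mathcal H,\vartheta}=\frac{9\mathcal H^2}{(12\widehat\wp_{\vartheta,-1}-1)^2}\,(-d\tau^2+g).$$ The form $\ell_{\mathcal H,\vartheta}$ vanishes along the totally umbilical spacelike hypersurfaces $$\mathbb S^3_h=\{(\tau,p)\in\widetilde{\mathcal M}_{\mathcal H,\vartheta}\mid\tau=2h\omega_{\vartheta,-1}\},\qquad h\in\mathbb Z,$$ and is nondegenerate and of Lorentz type on the complement of $\bigcup_{h\in\mathbb Z}\mathbb S^3_h$. The weak energy condition is automatically satisfied. The dominant energy condition is satisfied if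 and only if $\Lambda\le\widehat h_2(\vartheta,\mathcal H)$. The strong energy condition is satisfied if and only if $\widehat h_3(\vartheta,\mathcal H)\le\Lambda\le\widehat h_2(\vartheta,\mathcal H)$.
   Context: RW spacetimes. Let $g$ be the standard Riemannian metric of the unit sphere $\mathbb S^3\subset\mathbb R^4$. A closed RW spacetime is $\mathcal M(\mathfrak s)=\mathrm I_{\mathfrak s}\times\mathbb S^3$, with $\mathrm I_{\mathfrak s}\subset\mathbb R$ an open interval, $\mathfrak s$ a nonnegative scale function (smooth where positive), the (possibly degenerate) Lorentz metric $\ell_{\mathfrak s}=-dt^2+\mathfrak s^2(t)g$, a cosmological constant $\Lambda\in\mathbb R$ and perfect fluid stress-energy tensor $\mathrm T=\mathfrak m\,dt^2+\mathfrak p\,\mathfrak s^2g$, satisfying the Einstein equation, equivalent to $$\mathfrak m=\frac{3}{8\pi}\left(\frac{\dot{\mathfrak s}^2}{\mathfrak s^2}+\frac1{\mathfrak s^2}-\frac{\Lambda}{3}\right),\qquad \mathfrak p=-\frac1{4\pi\mathfrak s}\left(\ddot{\mathfrak s}+\frac1{2\mathfrak s}(\dot{\mathfrak s}^2+1)-\frac\Lambda2\mathfrak s\right)$$ (dot $=d/dt$; equations are understood where $\mathfrak s>0$). Part of the definition is that the energy density is nonnegative: $\mathfrak m$ takes values in $[0,+\infty)\cup\{+\infty\}$, while the pressure $\mathfrak p$ takes values in $\mathbb R\cup\{\pm\infty\}$. Conformal model. $\mathfrak s$ may vanish at some points, but the conformal time $\tau_{\mathfrak s}(t)=\int_{t_0}^t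 du/\mathfrak s(u)$ is assumed continuous and strictly increasing, with differentiable inverse on the open interval $\mathrm J_{\mathfrak s}=\tau_{\mathfrak s}(\mathrm I_{\mathfrak s})$. The conformal scale function is $\mathrm S=\mathfrak s\circ\tau_{\mathfrak s}^{-1}:\mathrm J_{\mathfrak s}\to\mathbb R$, a nonnegative differentiable function. Domains are maximal: $\mathrm J_{\mathfrak s}$ is the maximal domain of definition of $\mathrm S$ as a nonnegative differentiable function. The conformal model is $\widetilde{\mathcal M}=\mathrm J_{\mathfrak s}\times\mathbb S^3$ with the quadratic form $\mathrm S^2(-d\tau^2+g)$; it is cyclic if $\mathrm J_{\mathfrak s}=\mathbb R$ and $\mathrm S$ is periodic. The origin of $\tau$ is arbitrary, and the additive constant of integration in $\tau$ is normalized to zero (formulas are up to a translation of $\tau$). At poles of $\widehat\wp_{\vartheta,-1}$ the conformal factor is read as $0$. The terms "totally umbilical" and "spacelike" for hypersurfaces on which the form vanishes refer to the background Lorentz metric $-d\tau^2+g$. Critical spacetimes. $\mathcal M(\mathfrak s)$ is $\mathfrak m$-critical if $\mathfrak s$ is a critical point of $\int_{[t_0,t_1]\times\mathbb S^3}\mathfrak m\,dV_{\ell_{\mathfrak s}}$ with respect to variations preserving the volume (keeping $\int_{t_0}^{t_1}\mathfrak s^3dt$ constant). It is assumed throughout that $\mathfrak s$ is nonconstant; criticality is then expressed by $\mathfrak s\left(\dot{\mathfrak s}^2+\frac{\mathfrak a}{3}\mathfrak s^2-1\right)=\mathcal H$ with constants $\mathfrak a,\mathcal H$ (the internal parameters),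 or in conformal time by $\mathrm S'^2+\frac{\mathfrak a}{3}\mathrm S^4-\mathrm S^2-\mathcal H\mathrm S=0$; it is also assumed that $\mathcal H\ne0$. Energy conditions (required at all points where $\mathfrak m,\mathfrak p$ are finite): weak: $-\mathfrak m\le\mathfrak p$; dominant: $-\mathfrak m\le\mathfrak p\le\mathfrak m$; strong: $-\mathfrak m/3\le\mathfrak p\le\mathfrak m$. Class II. Put $g_2=\frac1{12}$, $g_3=\frac1{48}(\mathfrak a\mathcal H^2-\frac29)$ and $\Delta=16(g_2^3-27g_3^2)=\frac1{48}\mathfrak a\mathcal H^2(4-9\mathfrak a\mathcal H^2)$. The spacetime is of Class II if $\Delta<0$. Then $4x^3-g_2x-g_3$ has roots $e_1\pm ie_2$ ($e_2>0$) and $-2e_1$, where $e_1=\frac{\varepsilon}{12}\cosh\vartheta$, $e_2=\frac1{4\sqrt3}\sinh\vartheta$ with $\vartheta>0$ (the angular parameter) and $\varepsilon=\pm1$; the spacetime is of positive type if $\varepsilon=1$ and of negative type if $\varepsilon=-1$. One has $g_3=-\frac{\varepsilon\cosh3\vartheta}{216}$ and $\mathfrak a=\frac2{9\mathcal H^2}(1-\varepsilon\cosh3\vartheta)$. Let $\wp_{\vartheta,\varepsilon}$ be the Weierstrass $\wp$-function with invariants $g_2=\frac1{12}$ and $g_3=-\frac{\varepsilon\cosh3\vartheta}{216}$, $\omega_{\vartheta,\varepsilon}>0$ its real half-period (so $2\omega_{\vartheta,\varepsilon}$ is the minimal positive real period), and $\widehat\wp_{\vartheta,\varepsilon}(\tau)=\wp_{\vartheta,\varepsilon}(\tau)$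 for $\tau\in\mathbb R$. *)

theory Defs
  imports "HOL-Analysis.Analysis"
begin

text \<open>\<^bold>\<open>Smooth maps.\<close> All sets used below as domains of smoothness are open.\<close>

primrec Ck_on :: "nat \<Rightarrow> 'a::euclidean_space set \<Rightarrow> ('a \<Rightarrow> 'b::real_normed_vector) \<Rightarrow> bool" where
  "Ck_on 0 U f \<longleftrightarrow> continuous_on U f"
| "Ck_on (Suc k) U f \<longleftrightarrow>
     (\<exists>f'. (\<forall>x\<in>U. (f has_derivative f' x) (at x)) \<and> (\<forall>v. Ck_on k U (\<lambda>x. f' x v)))"

definition smooth_on :: "'a::euclidean_space set \<Rightarrow> ('a \<Rightarrow> 'b::real_normed_vector) \<Rightarrow> bool" where
  "smooth_on U f \<longleftrightarrow> (\<forall>k. Ck_on k U f)"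

definition open_interval :: "real set \<Rightarrow> bool" where
  "open_interval J \<longleftrightarrow> open J \<and> is_interval J \<and> J \<noteq> {}"


text \<open>\<^bold>\<open>Closed RW spacetimes.\<close> A scale function is a total function of which only the values on
  the open interval \<open>I\<close> are relevant. Density and pressure are meaningful where the scale
  function is positive; they are infinite elsewhere.\<close>

definition energy_density :: "real \<Rightarrow> (real \<Rightarrow> real) \<Rightarrow> real \<Rightarrow> real" where
  "energy_density \<Lambda> s t =
     3 / (8 * pi) * ((deriv s t)\<^sup>2 / (s t)\<^sup>2 + 1 / (s t)\<^sup>2 - \<Lambda> / 3)"

definition pressure :: "real \<Rightarrow> (real \<Rightarrow> real) \<Rightarrow> real \<Rightarrow> real" where
  "pressure \<Lambda> s t =
     - (1 / (4 * pi * s t)) *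
       (deriv (deriv s) t + 1 / (2 * s t) * ((deriv s t)\<^sup>2 + 1) - \<Lambda> / 2 * s t)"

definition conformal_time :: "(real \<Rightarrow> real) \<Rightarrow> real \<Rightarrow> real \<Rightarrow> real" where
  "conformal_time s t\<^sub>0 t = (LBINT u=t\<^sub>0..t. 1 / s u)"

definition conformal_domain :: "real set \<Rightarrow> (real \<Rightarrow> real) \<Rightarrow> real \<Rightarrow> real set" where
  "conformal_domain I s t\<^sub>0 = conformal_time s t\<^sub>0 ` I"

definition conformal_scale :: "real set \<Rightarrow> (real \<Rightarrow> real) \<Rightarrow> real \<Rightarrow> real \<Rightarrow> real" where
  "conformal_scale I s t\<^sub>0 \<tau> = s (the_inv_into I (conformal_time s t\<^sub>0) \<tau>)"

text \<open>The zero set is required to be a null set because \<open>1 / 0 = 0\<close> in HOL: a set of zeros of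
  positive measure makes the conformal time infinite on paper, but would be ignored by the formal
  integral.\<close>

definition admits_conformal_time :: "real set \<Rightarrow> (real \<Rightarrow> real) \<Rightarrow> real \<Rightarrow> bool" where
  "admits_conformal_time I s t\<^sub>0 \<longleftrightarrow>
     {t \<in> I. s t = 0} \<in> null_sets lborel \<and>
     (\<forall>t\<in>I. interval_lebesgue_integrable lborel t\<^sub>0 t (\<lambda>u. 1 / s u)) \<and>
     continuous_on I (conformal_time s t\<^sub>0) \<and>
     strict_mono_on I (conformal_time s t\<^sub>0) \<and>
     open_interval (conformal_domain I s t\<^sub>0) \<and>
     the_inv_into I (conformal_time s t\<^sub>0) differentiable_on conformal_domain I s t\<^sub>0 \<and>
     conformal_scale I s t\<^sub>0 differentiable_on conformal_domain I s t\<^sub>0"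

definition closed_RW_spacetime :: "real \<Rightarrow> real set \<Rightarrow> (real \<Rightarrow> real) \<Rightarrow> bool" where
  "closed_RW_spacetime \<Lambda> I s \<longleftrightarrow>
     open_interval I \<and>
     (\<forall>t\<in>I. 0 \<le> s t) \<and>
     smooth_on {t \<in> I. 0 < s t} s \<and>
     (\<forall>t\<^sub>0\<in>I. admits_conformal_time I s t\<^sub>0) \<and>
     (\<forall>t\<in>I. 0 < s t \<longrightarrow> 0 \<le> energy_density \<Lambda> s t)"

definition weak_energy_condition :: "real \<Rightarrow> real set \<Rightarrow> (real \<Rightarrow> real) \<Rightarrow> bool" where
  "weak_energy_condition \<Lambda> I s \<longleftrightarrow>
     (\<forall>t\<in>I. 0 < s t \<longrightarrow> - energy_density \<Lambda> s t \<le> pressure \<Lambda> s t)"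

definition dominant_energy_condition :: "real \<Rightarrow> real set \<Rightarrow> (real \<Rightarrow> real) \<Rightarrow> bool" where
  "dominant_energy_condition \<Lambda> I s \<longleftrightarrow>
     (\<forall>t\<in>I. 0 < s t \<longrightarrow>
        - energy_density \<Lambda> s t \<le> pressure \<Lambda> s t \<and> pressure \<Lambda> s t \<le> energy_density \<Lambda> s t)"

definition strong_energy_condition :: "real \<Rightarrow> real set \<Rightarrow> (real \<Rightarrow> real) \<Rightarrow> bool" where
  "strong_energy_condition \<Lambda> I s \<longleftrightarrow>
     (\<forall>t\<in>I. 0 < s t \<longrightarrow>
        - energy_density \<Lambda> s t / 3 \<le> pressure \<Lambda> s t \<and> pressure \<Lambda> s t \<le> energy_density \<Lambda> s t)"


text \<open>\<^bold>\<open>Critical spacetimes.\<close> The volume element is \<open>s\<^sup>3 dt dV\<^sub>g\<close> and the unit 3-sphere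
  has volume \<open>2\<pi>\<^sup>2\<close>. A variation is a function of \<open>(\<epsilon>, t)\<close>; it modifies \<open>s\<close> only inside a compact
  subset of the open interval on which \<open>s\<close> is positive.\<close>

definition total_energy :: "real \<Rightarrow> real \<Rightarrow> real \<Rightarrow> (real \<Rightarrow> real) \<Rightarrow> real" where
  "total_energy \<Lambda> t\<^sub>0 t\<^sub>1 s = 2 * pi\<^sup>2 * (LBINT t=t\<^sub>0..t\<^sub>1. energy_density \<Lambda> s t * s t ^ 3)"

definition volume_preserving_variation ::
  "real set \<Rightarrow> (real \<Rightarrow> real) \<Rightarrow> real \<Rightarrow> real \<Rightarrow> real \<Rightarrow> (real \<times> real \<Rightarrow> real) \<Rightarrow> bool" where
  "volume_preserving_variation I s t\<^sub>0 t\<^sub>1 \<delta> F \<longleftrightarrow>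
     0 < \<delta> \<and>
     (\<forall>t\<in>I. F (0, t) = s t) \<and>
     smooth_on ({- \<delta> <..< \<delta>} \<times> {t \<in> I. 0 < s t}) F \<and>
     (\<exists>K. compact K \<and> K \<subseteq> {t \<in> {t\<^sub>0 <..< t\<^sub>1}. 0 < s t} \<and>
        (\<forall>\<epsilon>\<in>{- \<delta> <..< \<delta>}. (\<forall>t\<in>I - K. F (\<epsilon>, t) = s t) \<and> (\<forall>t\<in>K. 0 < F (\<epsilon>, t)))) \<and>
     (\<forall>\<epsilon>\<in>{- \<delta> <..< \<delta>}. (LBINT t=t\<^sub>0..t\<^sub>1. F (\<epsilon>, t) ^ 3) = (LBINT t=t\<^sub>0..t\<^sub>1. s t ^ 3))"

definition m_critical :: "real \<Rightarrow> real set \<Rightarrow> (real \<Rightarrow> real) \<Rightarrow> bool" where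
  "m_critical \<Lambda> I s \<longleftrightarrow>
     (\<forall>t\<^sub>0 t\<^sub>1 \<delta> F. t\<^sub>0 < t\<^sub>1 \<and> {t\<^sub>0..t\<^sub>1} \<subseteq> I \<and> volume_preserving_variation I s t\<^sub>0 t\<^sub>1 \<delta> F \<longrightarrow>
        ((\<lambda>\<epsilon>. total_energy \<Lambda> t\<^sub>0 t\<^sub>1 (\<lambda>t. F (\<epsilon>, t))) has_real_derivative 0) (at 0))"

text \<open>The first integral of the Euler-Lagrange equation, with global constants: a Lagrange
  multiplier \<open>\<aa>\<close> and an energy constant \<open>H\<close>, in proper time and in conformal time.\<close>

definition internal_parameters :: "real set \<Rightarrow> (real \<Rightarrow> real) \<Rightarrow> real \<Rightarrow> real \<Rightarrow> bool" where
  "internal_parameters I s \<aa> H \<longleftrightarrow>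
     (\<forall>t\<in>I. 0 < s t \<longrightarrow> s t * ((deriv s t)\<^sup>2 + \<aa> / 3 * (s t)\<^sup>2 - 1) = H)"

definition critical_conformal_scale :: "real \<Rightarrow> real \<Rightarrow> real set \<Rightarrow> (real \<Rightarrow> real) \<Rightarrow> bool" where
  "critical_conformal_scale \<aa> H J S \<longleftrightarrow>
     open_interval J \<and>
     (\<forall>\<tau>\<in>J. 0 \<le> S \<tau> \<and> S differentiable (at \<tau>) \<and>
        (deriv S \<tau>)\<^sup>2 + \<aa> / 3 * S \<tau> ^ 4 - (S \<tau>)\<^sup>2 - H * S \<tau> = 0)"

text \<open>Maximality of the domain in conformal time. Only extensions that still solve the conformal
  critical equation are taken into account. As a hypothesis this is weaker than the absence of any
  nonnegative differentiable extension whatsoever.\<close>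

definition maximal_domain :: "real set \<Rightarrow> (real \<Rightarrow> real) \<Rightarrow> real \<Rightarrow> real \<Rightarrow> bool" where
  "maximal_domain I s \<aa> H \<longleftrightarrow>
     (\<forall>t\<^sub>0\<in>I. \<forall>J' S'.
        critical_conformal_scale \<aa> H J' S' \<and> conformal_domain I s t\<^sub>0 \<subseteq> J' \<and>
        (\<forall>\<tau>\<in>conformal_domain I s t\<^sub>0. S' \<tau> = conformal_scale I s t\<^sub>0 \<tau>) \<longrightarrow>
        J' = conformal_domain I s t\<^sub>0)"


text \<open>\<^bold>\<open>Class II and the angular parameter.\<close>\<close>

definition invariant_g2 :: real where
  "invariant_g2 = 1 / 12"

definition invariant_g3 :: "real \<Rightarrow> real \<Rightarrow> real" where
  "invariant_g3 \<aa> H = 1 / 48 * (\<aa> * H\<^sup>2 - 2 / 9)"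

definition class_II :: "real \<Rightarrow> real \<Rightarrow> bool" where
  "class_II \<aa> H \<longleftrightarrow> 16 * (invariant_g2 ^ 3 - 27 * (invariant_g3 \<aa> H)\<^sup>2) < 0"

text \<open>The roots of \<open>4x\<^sup>3 - g\<^sub>2 x - g\<^sub>3\<close> are \<open>e\<^sub>1 \<plusminus> i e\<^sub>2\<close> and \<open>-2e\<^sub>1\<close>. The type is the
  sign \<open>\<epsilon>\<close>.\<close>

definition type_and_angular_parameter :: "real \<Rightarrow> real \<Rightarrow> real \<Rightarrow> real \<Rightarrow> bool" where
  "type_and_angular_parameter \<aa> H \<epsilon> \<theta> \<longleftrightarrow>
     \<epsilon> \<in> {-1, 1} \<and> 0 < \<theta> \<and>
     (let e\<^sub>1 = \<epsilon> / 12 * cosh \<theta>; e\<^sub>2 = sinh \<theta> / (4 * sqrt 3) in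
      \<forall>x::complex. 4 * x ^ 3 - of_real invariant_g2 * x - of_real (invariant_g3 \<aa> H) =
        4 * (x - Complex e\<^sub>1 e\<^sub>2) * (x - Complex e\<^sub>1 (- e\<^sub>2)) * (x - of_real (- 2 * e\<^sub>1)))"


text \<open>\<^bold>\<open>Weierstrass functions.\<close>\<close>

definition period_lattice :: "complex set \<Rightarrow> bool" where
  "period_lattice L \<longleftrightarrow>
     (\<exists>w\<^sub>1 w\<^sub>2. w\<^sub>1 \<noteq> 0 \<and> Im (w\<^sub>2 / w\<^sub>1) \<noteq> 0 \<and> L = {of_int m * w\<^sub>1 + of_int n * w\<^sub>2 | m n. True})"

definition lattice_g2 :: "complex set \<Rightarrow> complex" where
  "lattice_g2 L = 60 * (\<Sum>\<^sub>\<infinity>w\<in>L - {0}. 1 / w ^ 4)"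

definition lattice_g3 :: "complex set \<Rightarrow> complex" where
  "lattice_g3 L = 140 * (\<Sum>\<^sub>\<infinity>w\<in>L - {0}. 1 / w ^ 6)"

definition weierstrass_wp :: "complex set \<Rightarrow> complex \<Rightarrow> complex" where
  "weierstrass_wp L z = 1 / z\<^sup>2 + (\<Sum>\<^sub>\<infinity>w\<in>L - {0}. 1 / (z - w)\<^sup>2 - 1 / w\<^sup>2)"

definition weierstrass_lattice :: "real \<Rightarrow> real \<Rightarrow> complex set \<Rightarrow> bool" where
  "weierstrass_lattice \<theta> \<epsilon> L \<longleftrightarrow>
     period_lattice L \<and>
     lattice_g2 L = of_real (1 / 12) \<and>
     lattice_g3 L = of_real (- \<epsilon> * cosh (3 * \<theta>) / 216)"

text \<open>The poles of the Weierstrass function are the points of the lattice; there the formal value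
  is meaningless and is never used.\<close>

definition period_of_wp :: "complex set \<Rightarrow> complex \<Rightarrow> bool" where
  "period_of_wp L c \<longleftrightarrow>
     (\<forall>z. (z + c \<in> L \<longleftrightarrow> z \<in> L) \<and> (z \<notin> L \<longrightarrow> weierstrass_wp L (z + c) = weierstrass_wp L z))"

definition real_half_period :: "complex set \<Rightarrow> real \<Rightarrow> bool" where
  "real_half_period L \<omega> \<longleftrightarrow>
     0 < \<omega> \<and> period_of_wp L (of_real (2 * \<omega>)) \<and>
     (\<forall>c. 0 < c \<and> c < 2 * \<omega> \<longrightarrow> \<not> period_of_wp L (of_real c))"

text \<open>When the invariants are real, the lattice is stable under conjugation, and the Weierstrass
  function is real on the real axis.\<close>

definition real_wp :: "complex set \<Rightarrow> real \<Rightarrow> real" where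
  "real_wp L \<tau> = Re (weierstrass_wp L (of_real \<tau>))"

definition conformal_factor :: "complex set \<Rightarrow> real \<Rightarrow> real \<Rightarrow> real" where
  "conformal_factor L H \<tau> =
     (if complex_of_real \<tau> \<in> L then 0 else 9 * H\<^sup>2 / (12 * real_wp L \<tau> - 1)\<^sup>2)"


text \<open>\<^bold>\<open>Geometry of the conformal model.\<close> The cylinder over the unit sphere lies in
  5-dimensional Minkowski space, and the Minkowski form restricts to \<open>-d\<tau>\<^sup>2 + g\<close> on its tangent
  spaces.\<close>

type_synonym point = "real \<times> (real ^ 4)"

definition minkowski :: "point \<Rightarrow> point \<Rightarrow> real" where
  "minkowski X Y = - (fst X * fst Y) + snd X \<bullet> snd Y"

definition tangent_space :: "point set \<Rightarrow> point \<Rightarrow> point set" where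
  "tangent_space N x =
     {v. \<exists>\<gamma>. \<gamma> 0 = x \<and> (\<forall>\<^sub>F t in nhds 0. \<gamma> t \<in> N) \<and> (\<gamma> has_vector_derivative v) (at 0)}"

definition conformal_model :: "real set \<Rightarrow> (real \<Rightarrow> real) \<Rightarrow> real \<Rightarrow> point set" where
  "conformal_model I s t\<^sub>0 = conformal_domain I s t\<^sub>0 \<times> sphere 0 1"

definition conformal_form ::
  "real set \<Rightarrow> (real \<Rightarrow> real) \<Rightarrow> real \<Rightarrow> point \<Rightarrow> point \<Rightarrow> point \<Rightarrow> real" where
  "conformal_form I s t\<^sub>0 x X Y = (conformal_scale I s t\<^sub>0 (fst x))\<^sup>2 * minkowski X Y"

definition cyclic :: "real set \<Rightarrow> (real \<Rightarrow> real) \<Rightarrow> real \<Rightarrow> bool" where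
  "cyclic I s t\<^sub>0 \<longleftrightarrow>
     conformal_domain I s t\<^sub>0 = UNIV \<and>
     (\<exists>T>0. \<forall>\<tau>. conformal_scale I s t\<^sub>0 (\<tau> + T) = conformal_scale I s t\<^sub>0 \<tau>)"

definition nondegenerate_on :: "point set \<Rightarrow> (point \<Rightarrow> point \<Rightarrow> real) \<Rightarrow> bool" where
  "nondegenerate_on V B \<longleftrightarrow> (\<forall>X\<in>V. (\<forall>Y\<in>V. B X Y = 0) \<longrightarrow> X = 0)"

definition lorentz_type_on :: "point set \<Rightarrow> (point \<Rightarrow> point \<Rightarrow> real) \<Rightarrow> bool" where
  "lorentz_type_on V B \<longleftrightarrow>
     (\<exists>e :: nat \<Rightarrow> point. span (e ` {..<dim V}) = V \<and>
        (\<forall>i<dim V. \<forall>j<dim V. B (e i) (e j) = (if i \<noteq> j then 0 else if i = 0 then -1 else 1)))"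

definition hypersurface_in :: "point set \<Rightarrow> point set \<Rightarrow> bool" where
  "hypersurface_in M N \<longleftrightarrow>
     N \<subseteq> M \<and>
     (\<forall>x\<in>N. \<exists>U f. open U \<and> x \<in> U \<and> smooth_on U (f :: point \<Rightarrow> real) \<and>
        N \<inter> U = {y \<in> M \<inter> U. f y = 0} \<and>
        (\<forall>y\<in>N \<inter> U. \<exists>X\<in>tangent_space M y. frechet_derivative f (at y) X \<noteq> 0))"

definition spacelike :: "point set \<Rightarrow> bool" where
  "spacelike N \<longleftrightarrow> (\<forall>x\<in>N. \<forall>X\<in>tangent_space N x. X \<noteq> 0 \<longrightarrow> 0 < minkowski X X)"

text \<open>The second fundamental form of \<open>N\<close> in \<open>M\<close>, with respect to a local unit normal field \<open>\<nu>\<close>,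
  is proportional to the induced metric. The Levi-Civita connection of \<open>M\<close> is the tangential part
  of the flat derivative of Minkowski space, and the part normal to \<open>M\<close> drops out after pairing
  with vectors \<open>Y\<close> tangent to \<open>N\<close>.\<close>

definition totally_umbilical_in :: "point set \<Rightarrow> point set \<Rightarrow> bool" where
  "totally_umbilical_in M N \<longleftrightarrow>
     (\<forall>x\<in>N. \<exists>U \<nu>. open U \<and> x \<in> U \<and> smooth_on U (\<nu> :: point \<Rightarrow> point) \<and>
        (\<forall>y\<in>N \<inter> U.
           \<nu> y \<in> tangent_space M y \<and>
           \<bar>minkowski (\<nu> y) (\<nu> y)\<bar> = 1 \<and>
           (\<forall>Y\<in>tangent_space N y. minkowski (\<nu> y) Y = 0) \<and>
           (\<exists>\<rho>. \<forall>X\<in>tangent_space N y. \<forall>Y\<in>tangent_space N y.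
              minkowski (frechet_derivative \<nu> (at y) X) Y = \<rho> * minkowski X Y)))"

definition slice :: "real set \<Rightarrow> (real \<Rightarrow> real) \<Rightarrow> real \<Rightarrow> real \<Rightarrow> int \<Rightarrow> point set" where
  "slice I s t\<^sub>0 \<omega> h = {x \<in> conformal_model I s t\<^sub>0. fst x = 2 * of_int h * \<omega>}"


definition h\<^sub>1 :: "real \<Rightarrow> real \<Rightarrow> real" where
  "h\<^sub>1 \<theta> H = 1 / (3 * H\<^sup>2) * (1 - 2 * cosh \<theta>)\<^sup>2"

definition h\<^sub>2 :: "real \<Rightarrow> real \<Rightarrow> real" where
  "h\<^sub>2 \<theta> H = 1 / (18 * H\<^sup>2) * (3 - 2 * cosh \<theta>) * (1 - 2 * cosh \<theta>)\<^sup>2"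

definition h\<^sub>3 :: "real \<Rightarrow> real \<Rightarrow> real" where
  "h\<^sub>3 \<theta> H = - (1 / (6 * H\<^sup>2)) * (1 + 2 * cosh \<theta>) * (1 - 2 * cosh \<theta>)\<^sup>2"

end

theory Submission
  imports Defs "HOL-Complex_Analysis.Complex_Analysis"
begin

text \<open>In conformal time the equation reads \<open>S'\<^sup>2 = Q(S)\<close> with a quartic \<open>Q\<close>. At
  positive arguments \<open>Q\<close> is nonnegative only if \<open>H > 0\<close>, and then only up to its one positive zero. Such an equation of first
  order admits solutions that pause at the two zeros of \<open>Q\<close>. Here this is impossible: the zeros of
  \<open>s\<close> form a null set, and \<open>s\<close> is twice continuously differentiable where it is positive. So \<open>S\<close>
  satisfies the Lipschitz equation \<open>S'' = Q'(S) / 2\<close> everywhere, and it is a translate of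
  \<open>3H / (12wp - 1)\<close>, which solves the same equation by the differential equation of \<open>wp\<close>. This function
  lives on the whole line, hence so does \<open>S\<close> by maximality, and the origin can be moved to a zero of
  \<open>s\<close>. Density and pressure are polynomials in \<open>1 / s\<close>, and each energy inequality is monotone in
  \<open>1 / s\<close>, so it has to be tested only where \<open>s\<close> is maximal.\<close>

subsection \<open>Lattices\<close>

text \<open>The substitution y = 3H/x links the quartic to elliptic functions: Q(x) equals x^4/(27
  H^2) times y^3 + 3y^2 - 9\<aa>H^2, and with y = 12p - 1 this cubic is 432 times the Weierstrass
  cubic in p. For negative type its only real zero is y = 2c - 1 > 1, where c is the hyperbolic
  cosine of the angular parameter. So 12wp - 1 stays positive on the real axis, the model solution
  has no poles, and its zeros are exactly the real lattice points. That wp is real on the real axis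
  is therefore extracted from its differential equations near the pole and then continued
  analytically. One Gronwall estimate serves this purpose and the uniqueness of S. The three
  thresholds for \<Lambda> come from the value u = (2c - 1)/(3H), the least value of 1/s.\<close>

lemma real_coordinates_bound:
  assumes "w1 \<noteq> (0::complex)" "Im (w2 / w1) \<noteq> 0"
  obtains c where "0 < c" "\<And>x y::real. c * max \<bar>x\<bar> \<bar>y\<bar> \<le> cmod (of_real x * w1 + of_real y * w2)"
proof -
  define q where "q = w2 / w1"
  have q: "Im q \<noteq> 0" "w2 = q * w1"
    using assms by (auto simp: q_def)
  \<comment> \<open>Im(x + yq) = y Im q bounds |y| by N/|Im q|, and then |x| \<le> N + |y||q|.
    \<open>C\<close> dominates both resulting constants.\<close>
  define C where "C = 1 + (1 + cmod q) / \<bar>Im q\<bar>"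
  have C: "C > 0"
    by (auto simp: C_def intro!: add_pos_nonneg)
  have "max \<bar>x\<bar> \<bar>y\<bar> \<le> C * cmod (of_real x + of_real y * q)" for x y :: real
  proof -
    define N where "N = cmod (of_real x + of_real y * q)"
    have "\<bar>y\<bar> * \<bar>Im q\<bar> \<le> N"
      using abs_Im_le_cmod[of "of_real x + of_real y * q"] by (simp add: abs_mult N_def)
    then have y: "\<bar>y\<bar> \<le> N / \<bar>Im q\<bar>"
      using q by (simp add: field_simps)
    have "\<bar>x\<bar> \<le> N + \<bar>y\<bar> * cmod q"
      using norm_triangle_ineq4[of "of_real x + of_real y * q" "of_real y * q"]
      by (simp add: N_def norm_mult)
    also have "\<dots> \<le> N + N / \<bar>Im q\<bar> * cmod q"
      by (intro add_left_mono mult_right_mono y) auto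
    finally have x: "\<bar>x\<bar> \<le> N * (1 + cmod q / \<bar>Im q\<bar>)"
      by (simp add: field_simps)
    have N: "0 \<le> N"
      by (simp add: N_def)
    have "N * (1 + cmod q / \<bar>Im q\<bar>) \<le> N * C" "N * (1 / \<bar>Im q\<bar>) \<le> N * C"
      by (intro mult_left_mono N; simp add: C_def add_divide_distrib)+
    then show ?thesis
      using x y by (simp add: N_def mult.commute)
  qed
  moreover have "cmod (of_real x * w1 + of_real y * w2) = cmod w1 * cmod (of_real x + of_real y * q)"
    for x y :: real
    by (simp add: q(2) norm_mult[symmetric] algebra_simps)
  moreover have "max \<bar>x\<bar> \<bar>y\<bar> / C \<le> cmod (of_real x + of_real y * q)" for x y :: real
    using calculation(1)[of x y] C by (simp add: pos_divide_le_eq mult.commute)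
  ultimately have "cmod w1 / C * max \<bar>x\<bar> \<bar>y\<bar> \<le> cmod (of_real x * w1 + of_real y * w2)" for x y :: real
    using mult_left_mono[of "max \<bar>x\<bar> \<bar>y\<bar> / C" "cmod (of_real x + of_real y * q)" "cmod w1"] by simp
  moreover have "cmod w1 / C > 0"
    using assms C by simp
  ultimately show ?thesis
    using that by blast
qed

text \<open>The exponent 3/2 exceeds 1, and two such factors give total exponent 3:
  max(|m|,|n|)^(-3) is at most the product of the terms for m and n. The \<open>max 1\<close> gives
  the index 0 the value 1, so that the product still dominates when one coordinate vanishes.\<close>

lemma summable_on_int_powr:
  "(\<lambda>m::int. (max 1 \<bar>of_int m\<bar>) powr (-(3/2)) :: real) summable_on UNIV"
proof -
  have "summable (\<lambda>n::nat. max 1 (real n) powr (-(3/2)))"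
  proof (rule summable_cong[THEN iffD2])
    show "\<forall>\<^sub>F n in sequentially. max 1 (real n) powr (-(3/2)) = real n powr (-(3/2))"
      using eventually_ge_at_top[of 1] by eventually_elim (simp add: max_def)
    show "summable (\<lambda>n. real n powr (-(3/2)))"
      by (simp add: summable_real_powr_iff)
  qed
  then have nat: "(\<lambda>n::nat. max 1 (real n) powr (-(3/2))) summable_on UNIV"
    by (intro norm_summable_imp_summable_on) simp
  have "(\<lambda>m::int. (max 1 \<bar>of_int m\<bar>) powr (-(3/2)) :: real) summable_on range int"
    "(\<lambda>m::int. (max 1 \<bar>of_int m\<bar>) powr (-(3/2)) :: real) summable_on range (\<lambda>n. - int n)"
    using nat by (subst summable_on_reindex; simp add: inj_on_def o_def)+
  then have "(\<lambda>m::int. (max 1 \<bar>of_int m\<bar>) powr (-(3/2)) :: real) summable_on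
      (range int \<union> range (\<lambda>n. - int n))"
    by (rule summable_on_union)
  moreover have "range int \<union> range (\<lambda>n. - int n) = UNIV"
  proof -
    have "m \<in> range int \<union> range (\<lambda>n. - int n)" for m
      by (cases m rule: int_cases2) auto
    then show ?thesis
      by blast
  qed
  ultimately show ?thesis
    by simp
qed

locale lattice =
  fixes L :: "complex set"
  assumes period_lattice: "period_lattice L"
begin

lemma zero_mem: "0 \<in> L"
proof -
  obtain w1 w2 where "L = {of_int m * w1 + of_int n * w2 | m n. True}"
    using period_lattice by (auto simp: period_lattice_def)
  then show ?thesis
    by (auto intro!: exI[of _ 0])
qed

lemma minus_mem: "w \<in> L \<Longrightarrow> - w \<in> L"
proof -
  assume "w \<in> L"
  obtain w1 w2 where L: "L = {of_int m * w1 + of_int n * w2 | m n. True}"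
    using period_lattice by (auto simp: period_lattice_def)
  with \<open>w \<in> L\<close> obtain m n where "w = of_int m * w1 + of_int n * w2"
    by auto
  then have "- w = of_int (-m) * w1 + of_int (-n) * w2"
    by simp
  then show ?thesis
    unfolding L by blast
qed

lemma add_mem: "v \<in> L \<Longrightarrow> w \<in> L \<Longrightarrow> v + w \<in> L"
proof -
  assume "v \<in> L" "w \<in> L"
  obtain w1 w2 where L: "L = {of_int m * w1 + of_int n * w2 | m n. True}"
    using period_lattice by (auto simp: period_lattice_def)
  with \<open>v \<in> L\<close> \<open>w \<in> L\<close> obtain m n m' n' where "v = of_int m * w1 + of_int n * w2"
    "w = of_int m' * w1 + of_int n' * w2"
    by auto
  then have "v + w = of_int (m + m') * w1 + of_int (n + n') * w2"
    by (simp add: algebra_simps)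
  then show ?thesis
    unfolding L by blast
qed

lemma diff_mem: "v \<in> L \<Longrightarrow> w \<in> L \<Longrightarrow> v - w \<in> L"
  using add_mem[of v "-w"] minus_mem by simp

lemma add_mem_iff: "w \<in> L \<Longrightarrow> z + w \<in> L \<longleftrightarrow> z \<in> L"
  using add_mem[of z w] diff_mem[of "z + w" w] by auto

lemma minus_mem_iff: "- z \<in> L \<longleftrightarrow> z \<in> L"
  using minus_mem[of z] minus_mem[of "- z"] by auto

text \<open>A nonzero integer pair has maximum norm at least 1. The uniform gap makes every subset
  of \<open>L\<close> closed and isolates the poles.\<close>

lemma norm_lower_bound:
  obtains c where "0 < c" "\<And>w. w \<in> L - {0} \<Longrightarrow> c \<le> cmod w"
proof -
  obtain w1 w2 where w: "w1 \<noteq> 0" "Im (w2 / w1) \<noteq> 0"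
    and L: "L = {of_int m * w1 + of_int n * w2 | m n. True}"
    using period_lattice by (auto simp: period_lattice_def)
  obtain c where c: "0 < c" "\<And>x y::real. c * max \<bar>x\<bar> \<bar>y\<bar> \<le> cmod (of_real x * w1 + of_real y * w2)"
    using real_coordinates_bound[OF w] by blast
  have "c \<le> cmod w" if mem: "w \<in> L - {0}" for w
  proof -
    obtain m n where mn: "w = of_int m * w1 + of_int n * w2"
      using mem unfolding L by blast
    with mem have "m \<noteq> 0 \<or> n \<noteq> 0"
      by auto
    then have "1 \<le> max \<bar>real_of_int m\<bar> \<bar>real_of_int n\<bar>"
      by linarith
    then have "c * 1 \<le> c * max \<bar>real_of_int m\<bar> \<bar>real_of_int n\<bar>"
      using c(1) by (intro mult_left_mono) auto
    also have "\<dots> \<le> cmod w"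
      using c(2)[of "of_int m" "of_int n"] by (simp add: mn)
    finally show ?thesis
      by simp
  qed
  with c(1) show ?thesis
    using that by blast
qed

lemma closed_subset: "A \<subseteq> L \<Longrightarrow> closed A"
proof -
  assume A: "A \<subseteq> L"
  obtain c where c: "0 < c" "\<And>w. w \<in> L - {0} \<Longrightarrow> c \<le> cmod w"
    using norm_lower_bound by blast
  have "y = x" if "x \<in> A" "y \<in> A" "dist y x < c" for x y
    using c(2)[of "y - x"] that A diff_mem[of y x] by (force simp: dist_norm)
  then show ?thesis
    using discrete_imp_closed[OF c(1)] by blast
qed

lemma countable: "countable L"
proof -
  obtain w1 w2 where "L = {of_int m * w1 + of_int n * w2 | m n. True}"
    using period_lattice by (auto simp: period_lattice_def)
  then have "L = (\<lambda>(m, n). of_int m * w1 + of_int n * w2) ` (UNIV :: (int \<times> int) set)"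
    by auto
  then show ?thesis
    by simp
qed

text \<open>The bound |m w1 + n w2| \<ge> c max(|m|,|n|) reduces the sum to a product of two
  one-dimensional sums. This cubic decay is the common majorant for the series of wp and of all its
  derivatives.\<close>

lemma summable_norm_cube: "(\<lambda>w. 1 / cmod w ^ 3) summable_on L - {0}"
proof -
  obtain w1 w2 where w: "w1 \<noteq> 0" "Im (w2 / w1) \<noteq> 0"
    and L: "L = {of_int m * w1 + of_int n * w2 | m n. True}"
    using period_lattice by (auto simp: period_lattice_def)
  obtain c where c: "0 < c" "\<And>x y::real. c * max \<bar>x\<bar> \<bar>y\<bar> \<le> cmod (of_real x * w1 + of_real y * w2)"
    using real_coordinates_bound[OF w] by blast
  define h :: "int \<times> int \<Rightarrow> complex" where "h = (\<lambda>(m, n). of_int m * w1 + of_int n * w2)"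
  define p :: "int \<Rightarrow> real" where "p m = max 1 \<bar>of_int m\<bar> powr (-(3/2))" for m
  have h0: "h x = 0 \<longleftrightarrow> x = 0" for x
  proof -
    obtain m n where x: "x = (m, n)"
      by fastforce
    have "max \<bar>real_of_int m\<bar> \<bar>real_of_int n\<bar> \<le> 0" if "h x = 0"
    proof -
      have "c * max \<bar>real_of_int m\<bar> \<bar>real_of_int n\<bar> \<le> 0"
        using c(2)[of "of_int m" "of_int n"] that by (simp add: x h_def)
      then show ?thesis
        using c(1) by (simp add: mult_le_0_iff)
    qed
    then show ?thesis
      by (auto simp: x h_def zero_prod_def)
  qed
  have "inj h"
  proof
    fix x y assume "h x = h y"
    then have "h (x - y) = 0"
      by (cases x; cases y) (simp add: h_def algebra_simps)
    then show "x = y"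
      by (simp add: h0)
  qed
  have image: "L - {0} = h ` (UNIV - {0})"
  proof -
    have "L = range h"
      by (auto simp: L h_def)
    then show ?thesis
      by (auto simp: h0)
  qed
  have "(\<lambda>x. p (fst x) * p (snd x)) summable_on UNIV \<times> UNIV"
  proof (rule summable_on_SigmaI)
    show "((\<lambda>n. p (fst (m, n)) * p (snd (m, n))) has_sum p m * infsum p UNIV) UNIV" for m
      using has_sum_cmult_right[OF has_sum_infsum[OF summable_on_int_powr], of "p m"]
      by (simp add: p_def[abs_def])
    show "(\<lambda>m. p m * infsum p UNIV) summable_on UNIV"
      using summable_on_int_powr by (intro summable_on_cmult_left) (simp add: p_def[abs_def])
  qed (simp add: p_def)
  then have "(\<lambda>x. p (fst x) * p (snd x)) summable_on UNIV - {0}"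
    by (rule summable_on_subset_banach) auto
  then have "(\<lambda>x. 1 / c ^ 3 * (p (fst x) * p (snd x))) summable_on UNIV - {0}"
    by (rule summable_on_cmult_right)
  then have "(\<lambda>x. 1 / cmod (h x) ^ 3) summable_on UNIV - {0}"
  proof (rule summable_on_comparison_test)
    fix x :: "int \<times> int" assume "x \<in> UNIV - {0}"
    obtain m n where x: "x = (m, n)"
      by fastforce
    define M where "M = max \<bar>real_of_int m\<bar> \<bar>real_of_int n\<bar>"
    have "m \<noteq> 0 \<or> n \<noteq> 0"
      using \<open>x \<in> UNIV - {0}\<close> by (auto simp: x zero_prod_def)
    then have M: "1 \<le> M"
      by (auto simp: M_def)
    have le: "c * M \<le> cmod (h x)"
      using c(2)[of "of_int m" "of_int n"] by (simp add: x h_def M_def)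
    have "(c * M) ^ 3 \<le> cmod (h x) ^ 3"
      by (intro power_mono le) (use c M in auto)
    then have "1 / cmod (h x) ^ 3 \<le> 1 / (c * M) ^ 3"
      by (intro divide_left_mono) (use c M h0[of x] \<open>x \<in> UNIV - {0}\<close> in \<open>auto intro!: mult_pos_pos zero_less_power\<close>)
    also have "\<dots> = 1 / c ^ 3 * (M powr (-(3/2)) * M powr (-(3/2)))"
    proof -
      have "M powr (-(3/2)) * M powr (-(3/2)) = M powr (- 3)"
        by (simp add: powr_add[symmetric])
      also have "\<dots> = 1 / M ^ 3"
        using M by (simp add: powr_minus powr_numeral inverse_eq_divide)
      finally show ?thesis
        by (simp add: power_mult_distrib)
    qed
    also have "\<dots> \<le> 1 / c ^ 3 * (p m * p n)"
    proof (intro mult_left_mono mult_mono)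
      have "max 1 \<bar>of_int m\<bar> \<le> M" "max 1 \<bar>of_int n\<bar> \<le> M"
        using M by (auto simp: M_def)
      then show "M powr (-(3/2)) \<le> p m" "M powr (-(3/2)) \<le> p n"
        by (auto simp: p_def intro!: powr_mono2')
    qed (use c in \<open>auto simp: p_def\<close>)
    finally show "1 / cmod (h x) ^ 3 \<le> 1 / c ^ 3 * (p (fst x) * p (snd x))"
      by (simp add: x)
  qed auto
  then show ?thesis
    unfolding image using \<open>inj h\<close> by (subst summable_on_reindex) (auto simp: o_def inj_on_def)
qed

end

subsection \<open>The Weierstrass function of a lattice\<close>

context lattice
begin

text \<open>\<open>wp_deriv n\<close> is the \<open>n\<close>-th derivative of the Weierstrass function, and \<open>wp_reg n\<close> that of its
  regular part at 0.\<close>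

definition wp_term :: "nat \<Rightarrow> complex \<Rightarrow> complex \<Rightarrow> complex" where
  "wp_term n w z = (-1) ^ n * fact (n + 1) / (z - w) ^ (n + 2) - (if n = 0 then 1 / w ^ 2 else 0)"

definition wp_reg :: "nat \<Rightarrow> complex \<Rightarrow> complex" where
  "wp_reg n z = (\<Sum>\<^sub>\<infinity>w\<in>L - {0}. wp_term n w z)"

definition wp_deriv :: "nat \<Rightarrow> complex \<Rightarrow> complex" where
  "wp_deriv n z = (-1) ^ n * fact (n + 1) / z ^ (n + 2) + wp_reg n z"

lemma wp_deriv_0: "wp_deriv 0 z = weierstrass_wp L z"
  by (simp add: wp_deriv_def wp_reg_def wp_term_def weierstrass_wp_def power2_eq_square)

text \<open>On a compact set that avoids the nonzero lattice points, |z - w| is at least a fixed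
  multiple of |w|. For n > 0 the power n + 2 is at least 3 and the surplus powers of |w| are bounded
  below. For n = 0 the subtraction of 1/w^2 cancels the leading term and leaves z(2w - z)/(w^2 (z -
  w)^2), again of order |w|^(-3). The set \<open>K\<close> may contain 0.\<close>

lemma norm_wp_term_le:
  assumes "compact K" "K \<inter> (L - {0}) = {}"
  obtains M where "\<And>w z. w \<in> L - {0} \<Longrightarrow> z \<in> K \<Longrightarrow> cmod (wp_term n w z) \<le> M * (1 / cmod w ^ 3)"
proof -
  obtain d where d: "0 < d" "\<And>z w. z \<in> K \<Longrightarrow> w \<in> L - {0} \<Longrightarrow> d \<le> dist z w"
    using separate_compact_closed[OF assms(1) closed_subset[of "L - {0}"] assms(2)] by auto
  obtain R where R: "0 < R" "\<And>z. z \<in> K \<Longrightarrow> cmod z \<le> R"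
    using compact_imp_bounded[OF assms(1)] unfolding bounded_pos by blast
  obtain c where c: "0 < c" "\<And>w. w \<in> L - {0} \<Longrightarrow> c \<le> cmod w"
    using norm_lower_bound by blast
  \<comment> \<open>From |w| \<le> |z| + |z - w| and |z| \<le> R \<le> (R/d)|z - w|.\<close>
  define k where "k = 1 / (1 + R / d)"
  have k: "0 < k"
    using R d by (simp add: k_def add_pos_pos)
  have near: "k * cmod w \<le> cmod (z - w)" if "w \<in> L - {0}" "z \<in> K" for w z
  proof -
    have "cmod w \<le> cmod z + cmod (z - w)"
      using norm_triangle_ineq4[of z "z - w"] by simp
    also have "cmod z \<le> R / d * cmod (z - w)"
    proof -
      have "R / d * d \<le> R / d * cmod (z - w)"
        using d(2)[OF that(2,1)] R d by (intro mult_left_mono) (auto simp: dist_norm)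
      with R(2)[OF that(2)] d show ?thesis
        by simp
    qed
    finally have "cmod w \<le> (1 + R / d) * cmod (z - w)"
      by (simp add: algebra_simps)
    then show ?thesis
      using R d by (simp add: k_def field_simps add_pos_pos)
  qed
  show ?thesis
  proof (cases "n = 0")
    case False
    then obtain m where n: "n = Suc m"
      by (cases n) auto
    have "cmod (wp_term n w z) \<le> fact (n + 1) / (k ^ (n + 2) * c ^ m) * (1 / cmod w ^ 3)"
      if w: "w \<in> L - {0}" and z: "z \<in> K" for w z
    proof -
      have pos: "0 < k ^ (n + 2) * c ^ m * cmod w ^ 3"
        using k c w by simp
      have "k ^ (n + 2) * c ^ m * cmod w ^ 3 \<le> k ^ (n + 2) * cmod w ^ m * cmod w ^ 3"
        using c w k by (intro mult_right_mono mult_left_mono power_mono) auto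
      also have "\<dots> = (k * cmod w) ^ (n + 2)"
        by (simp add: n power_mult_distrib power_add[symmetric] numeral_3_eq_3)
      also have "\<dots> \<le> cmod (z - w) ^ (n + 2)"
        using near[OF w z] k by (intro power_mono) auto
      finally have le: "k ^ (n + 2) * c ^ m * cmod w ^ 3 \<le> cmod (z - w) ^ (n + 2)" .
      have "cmod (wp_term n w z) = fact (n + 1) / cmod (z - w) ^ (n + 2)"
        using False by (simp add: wp_term_def norm_divide norm_mult norm_power del: fact_Suc)
      also have "\<dots> \<le> fact (n + 1) / (k ^ (n + 2) * c ^ m * cmod w ^ 3)"
        using le order_less_le_trans[OF pos le] pos
        by (intro divide_left_mono mult_pos_pos[OF pos] order_less_le_trans[OF pos le]) auto
      finally show ?thesis
        by simp
    qed
    then show ?thesis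
      using that by blast
  next
    case True
    have "cmod (wp_term n w z) \<le> R * (2 + R / c) / k ^ 2 * (1 / cmod w ^ 3)"
      if w: "w \<in> L - {0}" and z: "z \<in> K" for w z
    proof -
      have "z \<noteq> w" "w \<noteq> 0"
        using d w z by force+
      then have "1 / (z - w) ^ 2 - 1 / w ^ 2 = (1 * w ^ 2 - 1 * (z - w) ^ 2) / ((z - w) ^ 2 * w ^ 2)"
        by (intro diff_frac_eq) auto
      also have "1 * w ^ 2 - 1 * (z - w) ^ 2 = z * (2 * w - z)"
        by (simp add: power2_eq_square algebra_simps)
      finally have "wp_term n w z = z * (2 * w - z) / (w ^ 2 * (z - w) ^ 2)"
        by (simp add: True wp_term_def power2_eq_square mult_ac)
      then have "cmod (wp_term n w z) = cmod z * cmod (2 * w - z) / (cmod w ^ 2 * cmod (z - w) ^ 2)"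
        by (simp add: norm_divide norm_mult norm_power)
      also have "\<dots> \<le> R * ((2 + R / c) * cmod w) / (cmod w ^ 2 * (k * cmod w) ^ 2)"
      proof (intro frac_le mult_mono power_mono near[OF w z])
        have "R / c * c \<le> R / c * cmod w"
          using c w R by (intro mult_left_mono) auto
        then have "cmod z \<le> R / c * cmod w"
          using R(2)[OF z] c by simp
        then show "cmod (2 * w - z) \<le> (2 + R / c) * cmod w"
          using norm_triangle_ineq4[of "2 * w" z] by (simp add: norm_mult algebra_simps)
      qed (use R k c \<open>w \<noteq> 0\<close> z in auto)
      also have "\<dots> = R * (2 + R / c) / k ^ 2 * (1 / cmod w ^ 3)"
        using \<open>w \<noteq> 0\<close> by (simp add: power2_eq_square power3_eq_cube)
      finally show ?thesis .
    qed
    then show ?thesis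
      using that by blast
  qed
qed

lemma wp_term_summable:
  assumes "z \<notin> L - {0}"
  shows "(\<lambda>w. wp_term n w z) summable_on L - {0}"
proof -
  obtain M where M: "\<And>w. w \<in> L - {0} \<Longrightarrow> cmod (wp_term n w z) \<le> M * (1 / cmod w ^ 3)"
    using norm_wp_term_le[of "{z}" n] assms by (metis Int_insert_left_if0 compact_sing inf_bot_left insertI1)
  show ?thesis
    by (rule abs_summable_summable[OF summable_on_comparison_test[OF
          summable_on_cmult_right[OF summable_norm_cube]]]) (use M in auto)
qed

lemma has_field_derivative_wp_term:
  assumes "z \<noteq> w"
  shows "(wp_term n w has_field_derivative wp_term (Suc n) w z) (at z)"
proof -
  have "((\<lambda>z. (z - w) ^ (n + 2)) has_field_derivative of_nat (n + 2) * (1 * (z - w) ^ (n + 2 - Suc 0))) (at z)"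
    by (intro DERIV_power) (auto intro!: derivative_eq_intros)
  from DERIV_cmult[OF DERIV_inverse_fun[OF this], of "(-1) ^ n * fact (n + 1)"]
  have "((\<lambda>z. (-1) ^ n * fact (n + 1) * inverse ((z - w) ^ (n + 2))) has_field_derivative
      (-1) ^ n * fact (n + 1) * - (of_nat (n + 2) * (z - w) ^ (n + 1) * inverse (((z - w) ^ (n + 2)) ^ 2))) (at z)"
    using assms by (simp add: numeral_2_eq_2)
  also have "(z - w) ^ (n + 1) * inverse (((z - w) ^ (n + 2)) ^ 2) = 1 / (z - w) ^ (n + 3)"
  proof -
    have "((z - w) ^ (n + 2)) ^ 2 = (z - w) ^ (n + 1 + (n + 3))"
      unfolding power_mult[symmetric] by (rule arg_cong[of _ _ "power (z - w)"]) simp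
    also have "\<dots> = (z - w) ^ (n + 1) * (z - w) ^ (n + 3)"
      by (rule power_add)
    finally have eq: "((z - w) ^ (n + 2)) ^ 2 = (z - w) ^ (n + 1) * (z - w) ^ (n + 3)" .
    have "a * inverse (a * b) = 1 / b" if "a \<noteq> 0" for a b :: complex
      using that by (simp add: divide_inverse)
    then show ?thesis
      unfolding eq using assms by (metis power_not_zero right_minus_eq)
  qed
  then have "(-1) ^ n * fact (n + 1) * - (of_nat (n + 2) * (z - w) ^ (n + 1) * inverse (((z - w) ^ (n + 2)) ^ 2))
      = wp_term (Suc n) w z"
    by (simp add: wp_term_def numeral_3_eq_3 mult.assoc)
  finally have "((\<lambda>z. (-1) ^ n * fact (n + 1) * inverse ((z - w) ^ (n + 2)) - (if n = 0 then 1 / w ^ 2 else 0))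
      has_field_derivative wp_term (Suc n) w z - 0) (at z)"
    by (intro DERIV_diff DERIV_const)
  then show ?thesis
    by (simp add: wp_term_def[abs_def] divide_inverse)
qed

text \<open>The M-test gives uniform convergence of the finite partial sums on a closed disc, and a
  uniform limit of holomorphic functions may be differentiated termwise inside it.\<close>

lemma has_field_derivative_wp_reg:
  assumes "z \<notin> L - {0}"
  shows "(wp_reg n has_field_derivative wp_reg (Suc n) z) (at z)"
proof -
  have "open (- (L - {0}))"
    using closed_subset[of "L - {0}"] by (simp add: closed_def)
  then obtain r where r: "0 < r" "cball z r \<subseteq> - (L - {0})"
    using assms open_contains_cball by (metis ComplI)
  obtain M where M: "\<And>w y. w \<in> L - {0} \<Longrightarrow> y \<in> cball z r \<Longrightarrow>
      cmod (wp_term n w y) \<le> M * (1 / cmod w ^ 3)"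
    using norm_wp_term_le[of "cball z r" n] r by auto
  have der: "((\<lambda>y. \<Sum>w\<in>X. wp_term n w y) has_field_derivative (\<Sum>w\<in>X. wp_term (Suc n) w y)) (at y)"
    if "X \<subseteq> L - {0}" "y \<in> cball z r" for X y
    by (intro DERIV_sum has_field_derivative_wp_term) (use that r in auto)
  obtain g' where g': "\<And>y. y \<in> ball z r \<Longrightarrow> (wp_reg n has_field_derivative g' y) (at y) \<and>
      ((\<lambda>X. \<Sum>w\<in>X. wp_term (Suc n) w y) \<longlongrightarrow> g' y) (finite_subsets_at_top (L - {0}))"
  proof (rule has_complex_derivative_uniform_limit[where z = z and r = r and g = "wp_reg n"
        and f = "\<lambda>X y. \<Sum>w\<in>X. wp_term n w y" and f' = "\<lambda>X y. \<Sum>w\<in>X. wp_term (Suc n) w y"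
        and F = "finite_subsets_at_top (L - {0})"])
    show "uniform_limit (cball z r) (\<lambda>X y. \<Sum>w\<in>X. wp_term n w y) (wp_reg n) (finite_subsets_at_top (L - {0}))"
      unfolding wp_reg_def
      by (rule Weierstrass_m_test_general[OF M summable_on_cmult_right[OF summable_norm_cube]])
    show "\<forall>\<^sub>F X in finite_subsets_at_top (L - {0}). continuous_on (cball z r) (\<lambda>y. \<Sum>w\<in>X. wp_term n w y) \<and>
        (\<forall>y\<in>ball z r. ((\<lambda>y. \<Sum>w\<in>X. wp_term n w y) has_field_derivative
          (\<Sum>w\<in>X. wp_term (Suc n) w y)) (at y))"
    proof (rule eventually_finite_subsets_at_top_weakI)
      fix X assume "finite X" "X \<subseteq> L - {0}"
      show "continuous_on (cball z r) (\<lambda>y. \<Sum>w\<in>X. wp_term n w y) \<and>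
          (\<forall>y\<in>ball z r. ((\<lambda>y. \<Sum>w\<in>X. wp_term n w y) has_field_derivative
            (\<Sum>w\<in>X. wp_term (Suc n) w y)) (at y))"
        using der[OF \<open>X \<subseteq> L - {0}\<close>]
        by (auto intro!: DERIV_continuous_on DERIV_subset[OF der[OF \<open>X \<subseteq> L - {0}\<close>]])
    qed
  qed (use r in \<open>auto intro: that\<close>)
  have "((\<lambda>X. \<Sum>w\<in>X. wp_term (Suc n) w z) \<longlongrightarrow> wp_reg (Suc n) z) (finite_subsets_at_top (L - {0}))"
    using has_sum_infsum[OF wp_term_summable[OF assms, of "Suc n"]]
    by (simp add: wp_reg_def has_sum_def)
  with g'[of z] r have "g' z = wp_reg (Suc n) z"
    using tendsto_unique[OF finite_subsets_at_top_neq_bot] by (metis centre_in_ball)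
  with g'[of z] r show ?thesis
    by simp
qed

lemma has_field_derivative_wp_deriv:
  assumes "z \<notin> L"
  shows "(wp_deriv n has_field_derivative wp_deriv (Suc n) z) (at z)"
proof -
  have z: "z \<noteq> 0"
    using assms zero_mem by auto
  \<comment> \<open>\<open>wp_term n 0\<close> is the singular part at 0: for n = 0 the subtracted
    \<open>1 / w ^ 2\<close> at w = 0 is 0 by the convention for division by zero.\<close>
  have "((\<lambda>z. wp_term n 0 z + wp_reg n z) has_field_derivative wp_term (Suc n) 0 z + wp_reg (Suc n) z) (at z)"
    using assms z by (intro DERIV_add has_field_derivative_wp_term has_field_derivative_wp_reg) auto
  moreover have "(\<lambda>z. wp_term n 0 z + wp_reg n z) = wp_deriv n"
    by (simp add: wp_deriv_def wp_term_def fun_eq_iff)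
  ultimately show ?thesis
    by (simp add: wp_deriv_def wp_term_def)
qed

lemma wp_reg_minus: "wp_reg n (- z) = (-1) ^ n * wp_reg n z"
proof -
  have eq: "wp_term n w (- z) = (-1) ^ n * wp_term n (- w) z" for w
  proof -
    have "- z - w = - (z + w)"
      by simp
    then have "(- z - w) ^ (n + 2) = (-1) ^ n * (z + w) ^ (n + 2)"
      by (simp only: power_minus[of "z + w"]) simp
    then show ?thesis
      by (simp add: wp_term_def)
  qed
  have "wp_reg n (- z) = (\<Sum>\<^sub>\<infinity>w\<in>L - {0}. (-1) ^ n * wp_term n (- w) z)"
    by (simp add: wp_reg_def eq)
  also have "\<dots> = (-1) ^ n * (\<Sum>\<^sub>\<infinity>w\<in>L - {0}. wp_term n (- w) z)"
    by (rule infsum_cmult_right')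
  also have "(\<Sum>\<^sub>\<infinity>w\<in>L - {0}. wp_term n (- w) z) = (\<Sum>\<^sub>\<infinity>w\<in>uminus ` (L - {0}). wp_term n w z)"
    by (subst infsum_reindex) (auto simp: o_def inj_on_def)
  also have "uminus ` (L - {0}) = L - {0}"
  proof -
    have "w \<in> uminus ` (L - {0})" if "w \<in> L - {0}" for w
      using that minus_mem[of w] by (intro image_eqI[of _ _ "- w"]) auto
    then show ?thesis
      using minus_mem by auto
  qed
  finally show ?thesis
    by (simp add: wp_reg_def)
qed

lemma wp_deriv_minus: "wp_deriv n (- z) = (-1) ^ n * wp_deriv n z"
proof -
  have "(- z) ^ (n + 2) = (-1) ^ n * z ^ (n + 2)"
    by (simp only: power_minus[of z]) simp
  then have "(-1) ^ n * fact (n + 1) / (- z) ^ (n + 2) = (-1) ^ n * ((-1) ^ n * fact (n + 1) / z ^ (n + 2))"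
    by (simp del: power_Suc fact_Suc)
  then show ?thesis
    by (simp only: wp_deriv_def wp_reg_minus distrib_left)
qed

text \<open>From the first derivative on, no subtracted constants remain. The pole term is then the
  summand w = 0 of a sum over the whole lattice, which a lattice translation merely
  reindexes.\<close>

lemma wp_deriv_Suc: "z \<notin> L \<Longrightarrow> wp_deriv (Suc n) z = (\<Sum>\<^sub>\<infinity>w\<in>L. wp_term (Suc n) w z)"
proof -
  assume "z \<notin> L"
  have "(\<Sum>\<^sub>\<infinity>w\<in>insert 0 (L - {0}). wp_term (Suc n) w z) = wp_term (Suc n) 0 z + (\<Sum>\<^sub>\<infinity>w\<in>L - {0}. wp_term (Suc n) w z)"
    using \<open>z \<notin> L\<close> by (intro infsum_insert wp_term_summable) auto
  moreover have "insert 0 (L - {0}) = L"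
    using zero_mem by auto
  ultimately show ?thesis
    by (simp add: wp_deriv_def wp_reg_def wp_term_def)
qed

lemma wp_deriv_Suc_add:
  assumes "v \<in> L" "z \<notin> L"
  shows "wp_deriv (Suc n) (z + v) = wp_deriv (Suc n) z"
proof -
  have "wp_deriv (Suc n) (z + v) = (\<Sum>\<^sub>\<infinity>w\<in>L. wp_term (Suc n) w (z + v))"
    using assms by (simp add: wp_deriv_Suc add_mem_iff)
  also have "\<dots> = (\<Sum>\<^sub>\<infinity>w\<in>(\<lambda>w. w + v) ` L. wp_term (Suc n) w (z + v))"
  proof -
    have "w \<in> (\<lambda>w. w + v) ` L" if "w \<in> L" for w
      using diff_mem[OF that assms(1)] by (intro image_eqI[of _ _ "w - v"]) auto
    then have "(\<lambda>w. w + v) ` L = L"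
      using add_mem assms(1) by auto
    then show ?thesis
      by simp
  qed
  also have "\<dots> = (\<Sum>\<^sub>\<infinity>w\<in>L. wp_term (Suc n) w z)"
    by (subst infsum_reindex) (auto simp: o_def inj_on_def wp_term_def)
  finally show ?thesis
    using assms by (simp add: wp_deriv_Suc)
qed

lemma open_complement: "open (- L)"
  using closed_subset by auto

lemma connected_Compl_countable:
  assumes "countable A"
  shows "connected (- A :: complex set)"
  using connected_open_diff_countable[of "UNIV :: complex set" A] assms
  by (auto simp: Compl_eq_Diff_UNIV)

lemma connected_complement: "connected (- L)"
  using connected_Compl_countable countable .

text \<open>For n = 0 the constants 1/w^2 prevent reindexing. The difference wp(z + v) - wp(z) has
  derivative 0 by periodicity of the first derivative, hence is a constant c on the connected
  complement of \<open>L\<close>; evaluating it at -z - v and using that wp is even gives c =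
  -c.\<close>

lemma wp_deriv_add:
  assumes "v \<in> L" "z \<notin> L"
  shows "wp_deriv n (z + v) = wp_deriv n z"
proof (cases n)
  case 0
  have "((\<lambda>z. wp_deriv 0 (z + v) - wp_deriv 0 z) has_field_derivative 0) (at z)" if "z \<notin> L" for z
  proof -
    have "((\<lambda>z. wp_deriv 0 (z + v)) has_field_derivative wp_deriv (Suc 0) (z + v) * 1) (at z)"
      by (rule DERIV_chain2[where g = "\<lambda>z. z + v"])
        (use that assms in \<open>auto intro!: has_field_derivative_wp_deriv derivative_eq_intros simp: add_mem_iff\<close>)
    from DERIV_diff[OF this has_field_derivative_wp_deriv[OF that, of 0]] show ?thesis
      using wp_deriv_Suc_add[OF assms(1) that] by simp
  qed
  then have der: "\<forall>z\<in>- L - {}. ((\<lambda>z. wp_deriv 0 (z + v) - wp_deriv 0 z) has_field_derivative 0) (at z)"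
    by simp
  then have "continuous_on (- L) (\<lambda>z. wp_deriv 0 (z + v) - wp_deriv 0 z)"
    by (intro DERIV_continuous_on[where D = "\<lambda>_. 0"]) (auto intro: has_field_derivative_at_within)
  then have "(\<lambda>z. wp_deriv 0 (z + v) - wp_deriv 0 z) constant_on - L"
    by (rule DERIV_zero_connected_constant_on[OF connected_complement open_complement finite.emptyI]) (rule der)
  then obtain c where c: "wp_deriv 0 (z + v) - wp_deriv 0 z = c" if "z \<notin> L" for z
    by (auto simp: constant_on_def)
  have "wp_deriv 0 (- z - v + v) - wp_deriv 0 (- z - v) = c"
    using assms minus_mem_iff[of "z + v"] by (intro c) (simp add: add_mem_iff)
  moreover have "wp_deriv 0 (- z - v + v) = wp_deriv 0 z" "wp_deriv 0 (- z - v) = wp_deriv 0 (z + v)"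
    using wp_deriv_minus[of 0 z] wp_deriv_minus[of 0 "z + v"] by simp_all
  ultimately have "wp_deriv 0 z - wp_deriv 0 (z + v) = c"
    by simp
  with c[OF assms(2)] have "c + c = 0"
    by (metis add.commute add_diff_eq diff_add_cancel diff_self)
  then have "2 * c = 0"
    by simp
  then show ?thesis
    using 0 c[OF assms(2)] by simp
next
  case (Suc m)
  then show ?thesis
    using wp_deriv_Suc_add[OF assms, of m] by simp
qed

end

subsection \<open>The differential equations of the Weierstrass function\<close>

context lattice
begin

lemma wp_reg_0_0: "wp_reg 0 0 = 0"
  by (simp add: wp_reg_def wp_term_def power2_eq_square)

lemma wp_reg_odd_0: "odd n \<Longrightarrow> wp_reg n 0 = 0"
  using wp_reg_minus[of n 0] by simp

lemma lattice_g2_conv: "lattice_g2 L = 10 * wp_reg 2 0"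
proof -
  have "wp_reg 2 0 = (\<Sum>\<^sub>\<infinity>w\<in>L - {0}. 6 * (1 / w ^ 4))"
    by (simp add: wp_reg_def wp_term_def fact_numeral eval_nat_numeral)
  also have "\<dots> = 6 * (\<Sum>\<^sub>\<infinity>w\<in>L - {0}. 1 / w ^ 4)"
    by (rule infsum_cmult_right')
  finally show ?thesis
    by (simp add: lattice_g2_def)
qed

lemma lattice_g3_conv: "lattice_g3 L = 7 / 6 * wp_reg 4 0"
proof -
  have "wp_reg 4 0 = (\<Sum>\<^sub>\<infinity>w\<in>L - {0}. 120 * (1 / w ^ 6))"
    by (simp add: wp_reg_def wp_term_def fact_numeral eval_nat_numeral)
  also have "\<dots> = 120 * (\<Sum>\<^sub>\<infinity>w\<in>L - {0}. 1 / w ^ 6)"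
    by (rule infsum_cmult_right')
  finally show ?thesis
    by (simp add: lattice_g3_def)
qed

lemma pole_isolated: "\<exists>r>0. \<forall>v\<in>L. \<forall>w\<in>L. dist v w < r \<longrightarrow> v = w"
proof -
  obtain c where c: "0 < c" "\<And>w. w \<in> L - {0} \<Longrightarrow> c \<le> cmod w"
    using norm_lower_bound by blast
  have "v = w" if "v \<in> L" "w \<in> L" "dist v w < c" for v w
    using c(2)[of "v - w"] diff_mem[of v w] that by (force simp: dist_norm)
  with c(1) show ?thesis
    by blast
qed

text \<open>On a disc that contains no other lattice point, the remainder of the Taylor formula is
  O(z^(n+1)).\<close>

lemma wp_reg_Taylor:
  "((\<lambda>z. (wp_reg k z - (\<Sum>i\<le>n. wp_reg (k + i) 0 * z ^ i / fact i)) / z ^ n) \<longlongrightarrow> 0) (at 0)"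
proof -
  obtain r where r: "0 < r" "\<And>v w. v \<in> L \<Longrightarrow> w \<in> L \<Longrightarrow> dist v w < r \<Longrightarrow> v = w"
    using pole_isolated by blast
  define K where "K = cball (0::complex) (r / 2)"
  have K: "z \<notin> L - {0}" if "z \<in> K" for z
    using r(2)[OF zero_mem, of z] that \<open>0 < r\<close> by (auto simp: K_def)
  have cont: "continuous_on K (wp_reg (k + Suc n))"
    by (rule DERIV_continuous_on[OF has_field_derivative_at_within[OF has_field_derivative_wp_reg[OF K]]])
  have "compact K" "convex K"
    by (simp_all add: K_def)
  then have "bounded (wp_reg (k + Suc n) ` K)"
    using cont by (intro compact_imp_bounded compact_continuous_image)
  then obtain B where "\<forall>x\<in>wp_reg (k + Suc n) ` K. cmod x \<le> B"
    unfolding bounded_iff by blast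
  then have B: "cmod (wp_reg (k + Suc n) z) \<le> B" if "z \<in> K" for z
    using that by blast
  have "\<forall>\<^sub>F z in at 0. z \<in> K \<and> z \<noteq> 0"
    using r(1) by (auto simp: eventually_at K_def intro!: exI[of _ "r / 2"])
  then have "\<forall>\<^sub>F z in at 0. norm ((wp_reg k z - (\<Sum>i\<le>n. wp_reg (k + i) 0 * z ^ i / fact i)) / z ^ n)
      \<le> B / fact n * cmod z"
  proof eventually_elim
    case (elim z)
    have "cmod (wp_reg (k + 0) z - (\<Sum>i\<le>n. wp_reg (k + i) 0 * (z - 0) ^ i / fact i))
        \<le> B * cmod (z - 0) ^ Suc n / fact n"
    proof (rule complex_Taylor[of K n "\<lambda>i. wp_reg (k + i)"])
      show "(wp_reg (k + i) has_field_derivative wp_reg (k + Suc i) x) (at x within K)" if "x \<in> K" for i x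
        using has_field_derivative_at_within[OF has_field_derivative_wp_reg[OF K[OF that]], of "k + i"] by simp
      show "0 \<in> K"
        using r(1) by (simp add: K_def)
    qed (use B elim \<open>convex K\<close> in simp_all)
    then show ?case
      using elim by (simp add: norm_divide norm_power field_simps)
  qed
  moreover have "((\<lambda>z. B / fact n * cmod z) \<longlongrightarrow> 0) (at 0)"
    by (auto intro!: tendsto_eq_intros)
  ultimately show ?thesis
    by (rule Lim_null_comparison)
qed

section \<open>Liouville's theorem for lattice-periodic functions\<close>

lemma exists_period_reduction:
  obtains K where "compact K" "\<And>z. \<exists>w\<in>L. z + w \<in> K"
proof -
  obtain w1 w2 where w: "w1 \<noteq> 0" "Im (w2 / w1) \<noteq> 0"
    and L: "L = {of_int m * w1 + of_int n * w2 | m n. True}"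
    using period_lattice by (auto simp: period_lattice_def)
  define h where "h = (\<lambda>(x, y). of_real x * w1 + of_real y * w2)"
  define K where "K = h ` ({0..1} \<times> {0..1})"
  have "compact K"
    unfolding K_def h_def by (intro compact_continuous_image compact_Times)
      (auto intro!: continuous_intros simp: case_prod_unfold)
  moreover have "\<exists>w\<in>L. z + w \<in> K" for z
  proof -
    define q where "q = w2 / w1"
    define y where "y = Im (z / w1) / Im q"
    define x where "x = Re (z / w1) - y * Re q"
    have "Im q \<noteq> 0"
      using w by (simp add: q_def)
    then have "z / w1 = of_real x + of_real y * q"
      by (simp add: complex_eq_iff x_def y_def)
    then have z: "z = of_real x * w1 + of_real y * w2"
      using w by (auto simp: field_simps q_def)
    have "z + (of_int (- \<lfloor>x\<rfloor>) * w1 + of_int (- \<lfloor>y\<rfloor>) * w2) = h (frac x, frac y)"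
      by (simp add: z h_def frac_def algebra_simps)
    also have "\<dots> \<in> K"
      unfolding K_def by (intro imageI) (simp add: frac_lt_1 less_imp_le)
    finally show ?thesis
      unfolding L by blast
  qed
  ultimately show ?thesis
    using that by blast
qed

text \<open>A periodic function with limit 0 at the lattice points extends by 0 to an entire
  function. It takes all its values on a compact set of representatives, so it is bounded, hence
  constant, and the constant is its value at the lattice.\<close>

lemma elliptic_eq_0:
  assumes hol: "f holomorphic_on - L"
    and per: "\<And>v z. v \<in> L \<Longrightarrow> z \<notin> L \<Longrightarrow> f (z + v) = f z"
    and lim: "(f \<longlongrightarrow> 0) (at 0)" and "z \<notin> L"
  shows "f z = 0"
proof -
  define g where "g z = (if z \<in> L then 0 else f z)" for z
  obtain r where r: "0 < r" and ball: "\<And>v w. v \<in> L \<Longrightarrow> w \<in> L \<Longrightarrow> dist v w < r \<Longrightarrow> v = w"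
    using pole_isolated by blast
  have g_per: "g (z + v) = g z" if "v \<in> L" for z v
    using that per[of v z] by (simp add: g_def add_mem_iff)
  have g_hol: "g holomorphic_on - L"
    using hol by (rule holomorphic_transform) (auto simp: g_def)
  have "\<exists>S. open S \<and> z \<in> S \<and> g holomorphic_on S" for z
  proof (cases "z \<in> L")
    case False
    then show ?thesis
      using open_complement g_hol by blast
  next
    case True
    have "(g \<longlongrightarrow> 0) (at 0)"
    proof (rule Lim_transform_eventually[OF lim])
      have "\<forall>\<^sub>F z in at 0. z \<in> ball 0 r - {0}"
        using r by (intro eventually_at_in_open) auto
      then show "\<forall>\<^sub>F z in at 0. f z = g z"
        by eventually_elim (use ball[OF zero_mem] in \<open>auto simp: g_def\<close>)
    qed
    then have "((\<lambda>h. g (z + h)) \<longlongrightarrow> 0) (at 0)"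
      using g_per[OF True] by (simp add: add.commute)
    then have "(g \<longlongrightarrow> g z) (at z)"
      using LIM_offset_zero_cancel[of g z 0] True by (simp add: g_def)
    then have lim_z: "(g \<longlongrightarrow> g z) (at z within ball z r)"
      by (rule tendsto_within_subset) simp
    have "g holomorphic_on ball z r"
    proof (rule no_isolated_singularity'[of "{z}"])
      show "(g \<longlongrightarrow> g w) (at w within ball z r)" if "w \<in> {z}" for w
        using that lim_z by simp
      show "g holomorphic_on ball z r - {z}"
        by (rule holomorphic_on_subset[OF g_hol]) (use ball[OF True] in force)
    qed auto
    then show ?thesis
      using r by (intro exI[of _ "ball z r"]) auto
  qed
  then have hol': "g holomorphic_on UNIV"
    by (metis at_within_open field_differentiable_at_within holomorphic_on_def)
  obtain K where K: "compact K" "\<And>z. \<exists>w\<in>L. z + w \<in> K"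
    using exists_period_reduction by blast
  have "range g \<subseteq> g ` K"
  proof
    fix x assume "x \<in> range g"
    then obtain z where z: "x = g z"
      by auto
    obtain w where w: "w \<in> L" "z + w \<in> K"
      using K by blast
    then show "x \<in> g ` K"
      using g_per[of w z] z by (intro image_eqI[of _ _ "z + w"]) auto
  qed
  moreover have "bounded (g ` K)"
    using hol' K by (intro compact_imp_bounded compact_continuous_image)
      (auto intro: holomorphic_on_imp_continuous_on holomorphic_on_subset)
  ultimately have "g constant_on UNIV"
    using Liouville_theorem[OF hol'] bounded_subset by blast
  then have "g z = g 0"
    by (auto simp: constant_on_def)
  then show ?thesis
    using \<open>z \<notin> L\<close> zero_mem by (simp add: g_def)
qed

lemma wp_deriv_holomorphic: "wp_deriv n holomorphic_on - L"
  using has_field_derivative_wp_deriv open_complement by (subst holomorphic_on_open) auto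

text \<open>\<alpha> and \<beta> are Laurent coefficients: wp(z) = z^(-2) + \<alpha> z^2 + \<beta>
  z^4 + ..., where the constant term is absent by construction and odd terms by evenness. Stated as
  limits, the expansions allow principal parts to be cancelled by algebra.\<close>

lemma wp_reg_limits:
  defines "\<alpha> \<equiv> lattice_g2 L / 20" and "\<beta> \<equiv> lattice_g3 L / 28"
  shows "((\<lambda>z. (wp_reg 0 z - (\<alpha> * z ^ 2 + \<beta> * z ^ 4)) / z ^ 4) \<longlongrightarrow> 0) (at 0)"
    and "((\<lambda>z. (wp_reg 1 z - (2 * \<alpha> * z + 4 * \<beta> * z ^ 3)) / z ^ 3) \<longlongrightarrow> 0) (at 0)"
    and "(wp_reg 2 \<longlongrightarrow> 2 * \<alpha>) (at 0)"
    and "((\<lambda>z. wp_reg 0 z / z ^ 2) \<longlongrightarrow> \<alpha>) (at 0)"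
    and "(wp_reg 0 \<longlongrightarrow> 0) (at 0)" "(wp_reg 1 \<longlongrightarrow> 0) (at 0)"
proof -
  have v: "wp_reg 0 0 = 0" "wp_reg (Suc 0) 0 = 0" "wp_reg 2 0 = 2 * \<alpha>" "wp_reg 3 0 = 0" "wp_reg 4 0 = 24 * \<beta>"
    by (simp_all add: wp_reg_0_0 wp_reg_odd_0 \<alpha>_def \<beta>_def lattice_g2_conv lattice_g3_conv)
  have v': "wp_reg (Suc (Suc 0)) 0 = 2 * \<alpha>" "wp_reg (Suc (Suc (Suc 0))) 0 = 0"
    "wp_reg (Suc (Suc (Suc (Suc 0)))) 0 = 24 * \<beta>"
    using v by (simp_all add: eval_nat_numeral)
  show "((\<lambda>z. (wp_reg 0 z - (\<alpha> * z ^ 2 + \<beta> * z ^ 4)) / z ^ 4) \<longlongrightarrow> 0) (at 0)"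
    using wp_reg_Taylor[of 0 4] by (simp add: eval_nat_numeral v v')
  show "((\<lambda>z. (wp_reg 1 z - (2 * \<alpha> * z + 4 * \<beta> * z ^ 3)) / z ^ 3) \<longlongrightarrow> 0) (at 0)"
    using wp_reg_Taylor[of 1 3] by (simp add: eval_nat_numeral v v' mult_ac)
  have "((\<lambda>z. (wp_reg 0 z - \<alpha> * z ^ 2) / z ^ 2 + \<alpha>) \<longlongrightarrow> 0 + \<alpha>) (at 0)"
    using wp_reg_Taylor[of 0 2]
    by (intro tendsto_intros) (simp add: eval_nat_numeral v v')
  then have "((\<lambda>z. (wp_reg 0 z - \<alpha> * z ^ 2) / z ^ 2 + \<alpha>) \<longlongrightarrow> \<alpha>) (at 0)"
    by simp
  then show "((\<lambda>z. wp_reg 0 z / z ^ 2) \<longlongrightarrow> \<alpha>) (at 0)"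
    by (rule Lim_transform_eventually) (auto simp: eventually_at diff_divide_distrib intro!: exI[of _ 1])
  have "isCont (wp_reg n) 0" for n
    by (rule DERIV_isCont[OF has_field_derivative_wp_reg]) simp
  then show "(wp_reg 2 \<longlongrightarrow> 2 * \<alpha>) (at 0)" "(wp_reg 0 \<longlongrightarrow> 0) (at 0)" "(wp_reg 1 \<longlongrightarrow> 0) (at 0)"
    using v unfolding isCont_def by (metis One_nat_def)+
qed

theorem wp_second_order_equation:
  assumes "z \<notin> L"
  shows "wp_deriv 2 z = 6 * wp_deriv 0 z ^ 2 - lattice_g2 L / 2"
proof -
  define \<alpha> where "\<alpha> = lattice_g2 L / 20"
  define f where "f = (\<lambda>z. wp_deriv 2 z - 6 * wp_deriv 0 z ^ 2 + lattice_g2 L / 2)"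
  have "f z = 0"
  proof (rule elliptic_eq_0[of f])
    show "f holomorphic_on - L"
      unfolding f_def by (intro holomorphic_intros wp_deriv_holomorphic)
    show "f (z + v) = f z" if "v \<in> L" "z \<notin> L" for v z
      by (simp add: f_def wp_deriv_add that)
    \<comment> \<open>The terms 6/z^4 of wp'' and 6 wp^2 have already cancelled here; what is left
      tends to 2\<alpha> - 12\<alpha> + 10\<alpha> = 0.\<close>
    have "((\<lambda>z. wp_reg 2 z - 12 * (wp_reg 0 z / z ^ 2) - 6 * wp_reg 0 z ^ 2 + 10 * \<alpha>)
        \<longlongrightarrow> 2 * \<alpha> - 12 * \<alpha> - 6 * 0 ^ 2 + 10 * \<alpha>) (at 0)"
      unfolding \<alpha>_def by (intro tendsto_intros wp_reg_limits)
    then have "((\<lambda>z. wp_reg 2 z - 12 * (wp_reg 0 z / z ^ 2) - 6 * wp_reg 0 z ^ 2 + 10 * \<alpha>) \<longlongrightarrow> 0) (at 0)"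
      by simp
    then show "(f \<longlongrightarrow> 0) (at 0)"
    proof (rule Lim_transform_eventually)
      have "wp_reg 2 z - 12 * (wp_reg 0 z / z ^ 2) - 6 * wp_reg 0 z ^ 2 + 10 * \<alpha> = f z" if "z \<noteq> 0" for z
        using that by (simp add: f_def wp_deriv_def \<alpha>_def power2_eq_square field_simps eval_nat_numeral)
      then show "\<forall>\<^sub>F z in at 0. wp_reg 2 z - 12 * (wp_reg 0 z / z ^ 2) - 6 * wp_reg 0 z ^ 2 + 10 * \<alpha> = f z"
        by (auto simp: eventually_at intro!: exI[of _ 1])
    qed
  qed (rule assms)
  then show ?thesis
    by (simp add: f_def algebra_simps)
qed

theorem wp_first_order_equation:
  assumes "z \<notin> L"
  shows "wp_deriv 1 z ^ 2 = 4 * wp_deriv 0 z ^ 3 - lattice_g2 L * wp_deriv 0 z - lattice_g3 L"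
proof -
  define \<alpha> \<beta> where "\<alpha> = lattice_g2 L / 20" and "\<beta> = lattice_g3 L / 28"
  define f where "f = (\<lambda>z. wp_deriv 1 z ^ 2 - 4 * wp_deriv 0 z ^ 3 + lattice_g2 L * wp_deriv 0 z + lattice_g3 L)"
  \<comment> \<open>\<open>g\<close> is \<open>f\<close> after cancelling 4/z^6. The two expansions
    subtracted in it contribute -8\<alpha>/z^2 - 16\<beta> and -12\<alpha>/z^2 - 12\<beta>, which
    cancel against g2/z^2 + g3 because g2 = 20\<alpha> and g3 = 28\<beta>. Every summand of
    \<open>g\<close> tends to 0.\<close>
  define g where "g = (\<lambda>z. - 4 * ((wp_reg 1 z - (2 * \<alpha> * z + 4 * \<beta> * z ^ 3)) / z ^ 3)
      - 12 * ((wp_reg 0 z - (\<alpha> * z ^ 2 + \<beta> * z ^ 4)) / z ^ 4)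
      + wp_reg 1 z ^ 2 - 12 * (wp_reg 0 z / z ^ 2) * wp_reg 0 z - 4 * wp_reg 0 z ^ 3 + lattice_g2 L * wp_reg 0 z)"
  have "f z = 0"
  proof (rule elliptic_eq_0[of f])
    show "f holomorphic_on - L"
      unfolding f_def by (intro holomorphic_intros wp_deriv_holomorphic)
    show "f (z + v) = f z" if "v \<in> L" "z \<notin> L" for v z
      by (simp add: f_def wp_deriv_add that)
    have "(g \<longlongrightarrow> - 4 * 0 - 12 * 0 + 0 ^ 2 - 12 * \<alpha> * 0 - 4 * 0 ^ 3 + lattice_g2 L * 0) (at 0)"
      unfolding g_def \<alpha>_def \<beta>_def by (intro tendsto_intros wp_reg_limits)
    then have "(g \<longlongrightarrow> 0) (at 0)"
      by simp
    then show "(f \<longlongrightarrow> 0) (at 0)"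
    proof (rule Lim_transform_eventually)
      have "g z = f z" if "z \<noteq> 0" for z
      proof -
        have g: "lattice_g2 L = 20 * \<alpha>" "lattice_g3 L = 28 * \<beta>"
          by (simp_all add: \<alpha>_def \<beta>_def)
        have "wp_deriv 1 z = - 2 / z ^ 3 + wp_reg 1 z" "wp_deriv 0 z = 1 / z ^ 2 + wp_reg 0 z"
          by (simp_all add: wp_deriv_def eval_nat_numeral)
        then show ?thesis
          unfolding f_def g_def g using that by (simp add: divide_simps) algebra
      qed
      then show "\<forall>\<^sub>F z in at 0. g z = f z"
        by (auto simp: eventually_at intro!: exI[of _ 1])
    qed
  qed (rule assms)
  then show ?thesis
    by (simp add: f_def algebra_simps)
qed

end

subsection \<open>Real invariants\<close>

text \<open>The weighted energy (y^2 + u^2) exp(-(1 + K)t) is nonincreasing, because 2yu \<le> y^2 +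
  u^2 and 2u g \<le> K(y^2 + u^2). It starts at 0 and is nonnegative, so it vanishes at the right
  end.\<close>

lemma gronwall_second_order:
  fixes y u g :: "real \<Rightarrow> real"
  assumes "a \<le> b" "0 \<le> K" "y a = 0" "u a = 0"
    and cont: "continuous_on {a..b} y" "continuous_on {a..b} u"
    and y: "\<And>t. a < t \<Longrightarrow> t < b \<Longrightarrow> (y has_real_derivative u t) (at t)"
    and u: "\<And>t. a < t \<Longrightarrow> t < b \<Longrightarrow> (u has_real_derivative g t) (at t)"
    and g: "\<And>t. a < t \<Longrightarrow> t < b \<Longrightarrow> \<bar>g t\<bar> \<le> K * \<bar>y t\<bar>"
  shows "y b = 0 \<and> u b = 0"
proof -
  define W where "W t = ((y t)\<^sup>2 + (u t)\<^sup>2) * exp (- ((1 + K) * t))" for t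
  have "W b \<le> W a"
  proof (rule DERIV_nonpos_imp_decreasing_open[OF \<open>a \<le> b\<close>])
    show "continuous_on {a..b} W"
      unfolding W_def by (intro continuous_intros cont)
    fix t assume t: "a < t" "t < b"
    define D where "D = (2 * y t * u t + 2 * u t * g t - (1 + K) * ((y t)\<^sup>2 + (u t)\<^sup>2)) * exp (- ((1 + K) * t))"
    have "(W has_real_derivative D) (at t)"
      unfolding W_def D_def
      by (auto intro!: derivative_eq_intros y[OF t] u[OF t] simp: algebra_simps)
    moreover have "D \<le> 0"
    proof -
      have sq: "2 * x * z \<le> x\<^sup>2 + z\<^sup>2" for x z :: real
        using sum_squares_ge_zero[of "x - z" 0] by (simp add: power2_eq_square algebra_simps)
      have "2 * u t * g t \<le> 2 * \<bar>u t\<bar> * (K * \<bar>y t\<bar>)"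
        using mult_left_mono[OF g[OF t], of "2 * \<bar>u t\<bar>"] abs_ge_self[of "2 * u t * g t"]
        by (simp add: abs_mult)
      also have "\<dots> = K * (2 * \<bar>u t\<bar> * \<bar>y t\<bar>)"
        by simp
      also have "\<dots> \<le> K * ((u t)\<^sup>2 + (y t)\<^sup>2)"
        using sq[of "\<bar>u t\<bar>" "\<bar>y t\<bar>"] \<open>0 \<le> K\<close> by (intro mult_left_mono) simp_all
      finally have "2 * y t * u t + 2 * u t * g t - (1 + K) * ((y t)\<^sup>2 + (u t)\<^sup>2) \<le> 0"
        using sq[of "y t" "u t"] by (simp add: algebra_simps)
      then show ?thesis
        by (simp add: D_def mult_le_0_iff)
    qed
    ultimately show "\<exists>D. (W has_real_derivative D) (at t) \<and> D \<le> 0"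
      by blast
  qed
  then have "(y b)\<^sup>2 + (u b)\<^sup>2 \<le> 0"
    using assms(3,4) by (simp add: W_def mult_le_0_iff)
  then show ?thesis
    by (simp add: sum_power2_le_zero_iff)
qed

lemma has_real_derivative_Re_Im:
  assumes "(f has_field_derivative d) (at (complex_of_real t))"
  shows "((\<lambda>t. Re (f (of_real t))) has_real_derivative Re d) (at t)"
    and "((\<lambda>t. Im (f (of_real t))) has_real_derivative Im d) (at t)"
  using has_vector_derivative_real_field[OF assms, of UNIV]
  by (auto simp: has_real_derivative_iff_has_vector_derivative
      intro: bounded_linear.has_vector_derivative[OF bounded_linear_Re]
        bounded_linear.has_vector_derivative[OF bounded_linear_Im])

context lattice
begin

text \<open>The reciprocal of the Weierstrass function extends holomorphically over the pole, where it
  satisfies an equation of second order with real coefficients and zero initial data. Hence its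
  imaginary part vanishes on the real axis near the pole.\<close>

lemma Im_wp_near_pole:
  assumes g2: "lattice_g2 L = of_real a" and g3: "lattice_g3 L = of_real b"
  obtains \<rho> where "0 < \<rho>" "\<And>t. 0 < t \<Longrightarrow> t < \<rho> \<Longrightarrow>
    complex_of_real t \<notin> L \<and> Im (wp_deriv 0 (complex_of_real t)) = 0"
proof -
  \<comment> \<open>Writing 1/wp as \<open>v\<close> in this form turns the double pole into a
    double zero of a holomorphic function.\<close>
  define den where "den z = 1 + z\<^sup>2 * wp_reg 0 z" for z
  define v where "v z = z\<^sup>2 / den z" for z
  obtain r where r: "0 < r" "\<And>v w. v \<in> L \<Longrightarrow> w \<in> L \<Longrightarrow> dist v w < r \<Longrightarrow> v = w"
    using pole_isolated by blast
  have notin: "z \<notin> L" if "z \<noteq> 0" "cmod z < r" for z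
    using r(2)[OF zero_mem, of z] that by auto
  have den_hol: "den holomorphic_on ball 0 r"
    unfolding den_def
  proof (intro holomorphic_intros)
    show "wp_reg 0 holomorphic_on ball 0 r"
      using has_field_derivative_wp_reg notin by (subst holomorphic_on_open) (auto, metis)
  qed
  then have "continuous_on (ball 0 r) den"
    by (rule holomorphic_on_imp_continuous_on)
  then have "isCont den 0"
    using r(1) by (simp add: continuous_on_eq_continuous_at)
  then obtain r1 where r1: "0 < r1" "\<And>z. dist z 0 < r1 \<Longrightarrow> dist (den z) (den 0) < 1"
    unfolding continuous_at_eps_delta by (metis dist_commute zero_less_one)
  define q where "q = min r r1"
  have q: "0 < q" "q \<le> r"
    using r r1 by (auto simp: q_def)
  have den: "den z \<noteq> 0" if "cmod z < q" for z
  proof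
    assume "den z = 0"
    then have "z\<^sup>2 * wp_reg 0 z = - 1"
      by (simp add: den_def eq_neg_iff_add_eq_0 add.commute)
    then show False
      using r1(2)[of z] that by (simp add: q_def den_def dist_norm)
  qed
  have v_hol: "v holomorphic_on ball 0 q"
    unfolding v_def
    by (intro holomorphic_intros holomorphic_on_subset[OF den_hol]) (use q den in auto)
  have v': "(v has_field_derivative deriv v z) (at z)"
    "(deriv v has_field_derivative deriv (deriv v) z) (at z)" if "cmod z < q" for z
    using that by (auto intro!: holomorphic_derivI[of _ "ball 0 q"] holomorphic_deriv v_hol)
  have v_eq: "wp_deriv 0 z \<noteq> 0" "v z = 1 / wp_deriv 0 z" if "z \<noteq> 0" "cmod z < q" for z
  proof -
    have "wp_deriv 0 z = den z / z\<^sup>2"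
      using that by (simp add: wp_deriv_def den_def field_simps power2_eq_square)
    then show "wp_deriv 0 z \<noteq> 0" "v z = 1 / wp_deriv 0 z"
      using that den[of z] by (auto simp: v_def)
  qed
  have dv: "deriv v z = - wp_deriv 1 z / (wp_deriv 0 z)\<^sup>2" if z: "z \<noteq> 0" "cmod z < q" for z
  proof (rule DERIV_imp_deriv)
    have "((\<lambda>z. 1 / wp_deriv 0 z) has_field_derivative - wp_deriv 1 z / (wp_deriv 0 z)\<^sup>2) (at z)"
      using v_eq(1)[OF z] notin[of z] z q has_field_derivative_wp_deriv[of z 0]
      by (auto intro!: derivative_eq_intros simp: power2_eq_square)
    then show "(v has_field_derivative - wp_deriv 1 z / (wp_deriv 0 z)\<^sup>2) (at z)"
      by (rule has_field_derivative_transform_within_open[where S = "ball 0 q - {0}"])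
        (use z v_eq(2) in auto)
  qed
  \<comment> \<open>v'' = -wp''/wp^2 + 2 wp'^2/wp^3, and the two differential equations of wp turn
    this into a cubic polynomial in v with real coefficients.\<close>
  have ddv: "deriv (deriv v) z = 2 - 3 / 2 * of_real a * (v z)\<^sup>2 - 2 * of_real b * v z ^ 3"
    if z: "z \<noteq> 0" "cmod z < q" for z
  proof (rule DERIV_imp_deriv)
    let ?p = "wp_deriv 0 z"
    have L: "z \<notin> L"
      using notin[of z] z q by auto
    have p0: "?p \<noteq> 0"
      using v_eq(1)[OF z] .
    have "((\<lambda>z. - wp_deriv 1 z / (wp_deriv 0 z)\<^sup>2) has_field_derivative
        - wp_deriv 2 z / ?p\<^sup>2 + 2 * (wp_deriv 1 z)\<^sup>2 / ?p ^ 3) (at z)"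
      using p0 has_field_derivative_wp_deriv[OF L, of 0] has_field_derivative_wp_deriv[OF L, of 1]
      by (auto intro!: derivative_eq_intros simp: field_simps eval_nat_numeral)
    also have "- wp_deriv 2 z / ?p\<^sup>2 + 2 * (wp_deriv 1 z)\<^sup>2 / ?p ^ 3
        = 2 - 3 / 2 * of_real a * (v z)\<^sup>2 - 2 * of_real b * v z ^ 3"
      unfolding wp_first_order_equation[OF L] wp_second_order_equation[OF L] v_eq(2)[OF z] g2 g3
      using p0 by (simp add: field_simps eval_nat_numeral)
    finally show "(deriv v has_field_derivative 2 - 3 / 2 * of_real a * (v z)\<^sup>2 - 2 * of_real b * v z ^ 3) (at z)"
      by (rule has_field_derivative_transform_within_open[where S = "ball 0 q - {0}"])
        (use z dv in auto)
  qed
  define \<rho> where "\<rho> = q / 2"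
  have \<rho>: "0 < \<rho>" "\<rho> < q"
    using q by (auto simp: \<rho>_def)
  have "continuous_on (cball 0 \<rho>) v"
    by (rule holomorphic_on_imp_continuous_on[OF holomorphic_on_subset[OF v_hol]]) (use \<rho> in auto)
  then have "bounded (v ` cball 0 \<rho>)"
    by (intro compact_imp_bounded compact_continuous_image compact_cball)
  then obtain R where "0 < R" "\<forall>x\<in>v ` cball 0 \<rho>. cmod x \<le> R"
    unfolding bounded_pos by blast
  then have R: "0 < R" "cmod (v z) \<le> R" if "cmod z \<le> \<rho>" for z
    using that by auto
  define y u where "y t = Im (v (of_real t))" and "u t = Im (deriv v (of_real t))" for t
  define K where "K = 3 * \<bar>a\<bar> * R + 8 * \<bar>b\<bar> * R\<^sup>2"
  have Rpos: "0 < R"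
    using R(1)[of 0] \<rho> by simp
  have yd: "(y has_real_derivative u t) (at t)"
    and ud: "(u has_real_derivative Im (deriv (deriv v) (of_real t))) (at t)" if "\<bar>t\<bar> < q" for t
    unfolding y_def u_def by (intro has_real_derivative_Re_Im v'; use that in simp)+
  have "y t = 0" if t: "0 < t" "t < \<rho>" for t
  proof -
    have "y t = 0 \<and> u t = 0"
    proof (rule gronwall_second_order[of 0 t K y u "\<lambda>t. Im (deriv (deriv v) (of_real t))"])
      show "y 0 = 0"
        by (simp add: y_def v_def)
      have "(v has_field_derivative 0) (at 0)"
      proof -
        have "(den has_field_derivative deriv den 0) (at 0)"
          using r by (intro holomorphic_derivI[OF den_hol]) auto
        moreover have "((\<lambda>z::complex. z\<^sup>2) has_field_derivative 0) (at 0)"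
          by (auto intro!: derivative_eq_intros)
        ultimately have "((\<lambda>z. z\<^sup>2 / den z) has_field_derivative
            (0 * den 0 - 0\<^sup>2 * deriv den 0) / (den 0 * den 0)) (at 0)"
          using den[of 0] q by (intro DERIV_divide) simp_all
        then show ?thesis
          by (simp add: v_def[abs_def] den_def)
      qed
      then show "u 0 = 0"
        by (simp add: u_def DERIV_imp_deriv)
      show "continuous_on {0..t} y" "continuous_on {0..t} u"
        using t \<rho> by (auto intro!: DERIV_continuous_on[OF has_field_derivative_at_within[OF yd]]
            DERIV_continuous_on[OF has_field_derivative_at_within[OF ud]])
      show "0 \<le> K"
        using Rpos by (simp add: K_def)
    next
      fix s assume s: "0 < s" "s < t"
      define z where "z = v (of_real s)"
      have z: "\<bar>Re z\<bar> \<le> R" "\<bar>Im z\<bar> \<le> R"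
        using abs_Re_le_cmod[of z] abs_Im_le_cmod[of z] R(2)[of "of_real s"] s t by (auto simp: z_def)
      have "Im (deriv (deriv v) (of_real s)) = Im (2 - 3 / 2 * of_real a * z\<^sup>2 - 2 * of_real b * z ^ 3)"
        using s t \<rho> by (simp add: ddv z_def)
      \<comment> \<open>Im(z^2) and Im(z^3) both contain the factor Im z. This makes the second
        derivative of y at most a multiple of |y|, as the Gronwall estimate demands.\<close>
      also have "\<dots> = (- 3 * a * Re z - 2 * b * (3 * (Re z)\<^sup>2 - (Im z)\<^sup>2)) * Im z"
        by (simp add: power2_eq_square power3_eq_cube algebra_simps)
      also have "\<bar>\<dots>\<bar> = \<bar>- 3 * a * Re z - 2 * b * (3 * (Re z)\<^sup>2 - (Im z)\<^sup>2)\<bar> * \<bar>Im z\<bar>"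
        by (rule abs_mult)
      also have "\<dots> \<le> K * \<bar>Im z\<bar>"
      proof (rule mult_right_mono)
        have "(Re z)\<^sup>2 \<le> R\<^sup>2" "(Im z)\<^sup>2 \<le> R\<^sup>2"
          using z Rpos by (auto simp: abs_le_square_iff[symmetric])
        then have "\<bar>3 * (Re z)\<^sup>2 - (Im z)\<^sup>2\<bar> \<le> 4 * R\<^sup>2"
          using zero_le_power2[of "Re z"] zero_le_power2[of "Im z"] by linarith
        then have "\<bar>b\<bar> * \<bar>3 * (Re z)\<^sup>2 - (Im z)\<^sup>2\<bar> \<le> \<bar>b\<bar> * (4 * R\<^sup>2)" "\<bar>a\<bar> * \<bar>Re z\<bar> \<le> \<bar>a\<bar> * R"
          using z by (auto intro!: mult_left_mono)
        then have "\<bar>b * (3 * (Re z)\<^sup>2 - (Im z)\<^sup>2)\<bar> \<le> 4 * \<bar>b\<bar> * R\<^sup>2" "\<bar>a * Re z\<bar> \<le> \<bar>a\<bar> * R"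
          by (simp_all only: abs_mult)
        then have "\<bar>- 3 * (a * Re z) - 2 * (b * (3 * (Re z)\<^sup>2 - (Im z)\<^sup>2))\<bar>
            \<le> 3 * (\<bar>a\<bar> * R) + 2 * (4 * \<bar>b\<bar> * R\<^sup>2)"
          by linarith
        then show "\<bar>- 3 * a * Re z - 2 * b * (3 * (Re z)\<^sup>2 - (Im z)\<^sup>2)\<bar> \<le> K"
          by (simp add: K_def mult.assoc)
      qed simp
      finally show "\<bar>Im (deriv (deriv v) (of_real s))\<bar> \<le> K * \<bar>y s\<bar>"
        by (simp add: y_def z_def)
    qed (use t \<rho> yd ud in auto)
    then show ?thesis ..
  qed
  have "complex_of_real t \<notin> L \<and> Im (wp_deriv 0 (complex_of_real t)) = 0" if t: "0 < t" "t < \<rho>" for t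
  proof
    show "complex_of_real t \<notin> L"
      using t \<rho> q by (intro notin) auto
    have "1 / wp_deriv 0 (complex_of_real t) \<in> \<real>"
      using \<open>\<And>t. 0 < t \<Longrightarrow> t < \<rho> \<Longrightarrow> y t = 0\<close>[OF t] v_eq(2)[of "of_real t"] t \<rho>
      by (simp add: y_def complex_is_Real_iff)
    then have "inverse (1 / wp_deriv 0 (complex_of_real t)) \<in> \<real>"
      by (rule Reals_inverse)
    then show "Im (wp_deriv 0 (complex_of_real t)) = 0"
      by (simp add: complex_is_Real_iff inverse_eq_divide)
  qed
  with \<rho>(1) show ?thesis
    using that by blast
qed

text \<open>wp and its conjugate reflection agree on a real interval next to the pole, hence
  wherever both are holomorphic. The reflection has its poles on the conjugate lattice, which is not
  known to be \<open>L\<close>; both lattices are removed, and the remaining domain is connected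
  because they are countable.\<close>

theorem Im_wp_real_axis:
  assumes g2: "lattice_g2 L = of_real a" and g3: "lattice_g3 L = of_real b"
    and "complex_of_real t \<notin> L"
  shows "Im (wp_deriv 0 (complex_of_real t)) = 0"
proof -
  obtain \<rho> where \<rho>: "0 < \<rho>" "\<And>t. 0 < t \<Longrightarrow> t < \<rho> \<Longrightarrow>
      complex_of_real t \<notin> L \<and> Im (wp_deriv 0 (complex_of_real t)) = 0"
    using Im_wp_near_pole[OF g2 g3] by blast
  define S where "S = - (L \<union> cnj ` L)"
  define U where "U = complex_of_real ` {0<..<\<rho>}"
  define h where "h z = wp_deriv 0 z - (cnj \<circ> wp_deriv 0 \<circ> cnj) z" for z
  have "closed (cnj ` L)"
  proof -
    have "cnj ` L = cnj -` L"
      by (auto intro: image_eqI[of _ cnj "cnj z" for z])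
    then show ?thesis
      using continuous_closed_vimage[of L cnj] closed_subset[of L] by (simp add: continuous_cnj)
  qed
  then have "open S"
    unfolding S_def by (intro open_Compl closed_Un closed_subset[OF order_refl])
  have cnj_real: "complex_of_real x \<in> cnj ` L \<longleftrightarrow> complex_of_real x \<in> L" for x
    by (metis complex_cnj_cnj complex_cnj_complex_of_real image_iff)
  have "h (of_real t) = 0"
  proof (rule analytic_continuation[of h S U "of_real (\<rho> / 2)"])
    show "open S" by fact
    show "connected S"
      unfolding S_def by (intro connected_Compl_countable) (simp add: countable)
    have "cnj ` S \<subseteq> - L"
    proof
      fix w assume "w \<in> cnj ` S"
      then obtain z where z: "z \<in> S" "w = cnj z"
        by blast
      have "z \<in> cnj ` L" if "cnj z \<in> L"
        using imageI[OF that, of cnj] by simp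
      then show "w \<in> - L"
        using z by (auto simp: S_def)
    qed
    then have "wp_deriv 0 holomorphic_on cnj ` S"
      using wp_deriv_holomorphic holomorphic_on_subset by blast
    then have "cnj \<circ> wp_deriv 0 \<circ> cnj holomorphic_on S"
      using \<open>open S\<close> by (rule holomorphic_on_compose_cnj_cnj)
    moreover have "wp_deriv 0 holomorphic_on S"
      by (rule holomorphic_on_subset[OF wp_deriv_holomorphic]) (simp add: S_def)
    ultimately show "h holomorphic_on S"
      unfolding h_def by (rule holomorphic_on_diff[rotated])
    show "U \<subseteq> S"
    proof
      fix z assume "z \<in> U"
      then obtain x where "z = of_real x" "complex_of_real x \<notin> L"
        using \<rho>(2) by (auto simp: U_def)
      then show "z \<in> S"
        using cnj_real[of x] by (simp add: S_def)
    qed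
    have "complex_of_real (\<rho> / 2) \<in> U" "complex_of_real (\<rho> / 3) \<in> U"
      using \<rho>(1) unfolding U_def by (intro imageI; simp)+
    moreover have "complex_of_real (\<rho> / 2) \<noteq> complex_of_real (\<rho> / 3)"
      using \<rho>(1) by (simp only: of_real_eq_iff)
    moreover have "connected U"
      unfolding U_def by (intro connected_continuous_image continuous_intros) auto
    ultimately show "complex_of_real (\<rho> / 2) islimpt U"
      by (intro connected_imp_perfect) (blast, blast, metis singletonD)
    show "complex_of_real (\<rho> / 2) \<in> S"
      using \<open>complex_of_real (\<rho> / 2) \<in> U\<close> \<open>U \<subseteq> S\<close> by blast
    show "h z = 0" if "z \<in> U" for z
      using that \<rho>(2) by (auto simp: U_def h_def complex_eq_iff)
    show "complex_of_real t \<in> S"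
      using assms(3) by (simp add: S_def cnj_real)
  qed
  then show ?thesis
    by (simp add: h_def complex_eq_iff)
qed

end

subsection \<open>The conformal equation\<close>

definition first_integral :: "real \<Rightarrow> real \<Rightarrow> real \<Rightarrow> real" where
  "first_integral \<aa> H x = x\<^sup>2 + H * x - \<aa> / 3 * x ^ 4"

definition force :: "real \<Rightarrow> real \<Rightarrow> real \<Rightarrow> real" where
  "force \<aa> H x = x + H / 2 - 2 * \<aa> / 3 * x ^ 3"

lemma has_real_derivative_first_integral:
  "(first_integral \<aa> H has_real_derivative 2 * force \<aa> H x) (at x)"
  unfolding first_integral_def[abs_def] force_def
  by (auto intro!: derivative_eq_intros simp: field_simps)

lemma continuous_on_force [continuous_intros]:
  "continuous_on A S \<Longrightarrow> continuous_on A (\<lambda>x. force \<aa> H (S x))"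
  unfolding force_def by (intro continuous_intros)

text \<open>y = 3H/x plays the role of 12wp - 1. The zero d = 2c - 1 is the value of 12p - 1 at the
  real root p = c/6 of the Weierstrass cubic, and the quadratic factor carries the pair of complex
  conjugate roots.\<close>

lemma first_integral_factorization:
  assumes "\<aa> * H\<^sup>2 = 2 / 9 * (c + 1) * (2 * c - 1)\<^sup>2" "x \<noteq> 0" "H \<noteq> 0"
  defines "y \<equiv> 3 * H / x" and "d \<equiv> 2 * c - 1"
  shows "first_integral \<aa> H x = x ^ 4 / (27 * H\<^sup>2) * ((y - d) * (y\<^sup>2 + (3 + d) * y + d * (3 + d)))"
proof -
  have a: "\<aa> = (d + 3) * d\<^sup>2 / (9 * H\<^sup>2)"
    using assms(1,3) by (simp add: d_def field_simps)
  have "(y - d) * (y\<^sup>2 + (3 + d) * y + d * (3 + d)) = y ^ 3 + 3 * y\<^sup>2 - d\<^sup>2 * (d + 3)"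
    by (simp add: algebra_simps power2_eq_square power3_eq_cube)
  also have "x ^ 4 / (27 * H\<^sup>2) * \<dots> = first_integral \<aa> H x"
    using assms(2,3) by (simp add: y_def a first_integral_def field_simps eval_nat_numeral)
  finally show ?thesis by simp
qed

lemma quadratic_factor_pos:
  assumes "1 < (d::real)"
  shows "0 < y\<^sup>2 + (3 + d) * y + d * (3 + d)"
proof -
  have "y\<^sup>2 + (3 + d) * y + d * (3 + d) = (y + (3 + d) / 2)\<^sup>2 + (3 + d) * (3 * d - 3) / 4"
    by (simp add: power2_eq_square field_simps)
  moreover have "0 < (3 + d) * (3 * d - 3) / 4"
    using assms by simp
  ultimately show ?thesis
    by (simp add: add_nonneg_pos)
qed

text \<open>Q(x) has the sign of y - d with y = 3H/x. Since d > 1, the inequality y \<ge> d makes y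
  positive, hence also H, and bounds x from above.\<close>

lemma first_integral_nonneg_imp:
  assumes "\<aa> * H\<^sup>2 = 2 / 9 * (c + 1) * (2 * c - 1)\<^sup>2" "1 < c" "0 < x" "H \<noteq> 0"
    and "0 \<le> first_integral \<aa> H x"
  shows "0 < H" "x \<le> 3 * H / (2 * c - 1)"
proof -
  define y where "y = 3 * H / x"
  define d where "d = 2 * c - 1"
  have d: "1 < d"
    using assms by (simp add: d_def)
  have "0 \<le> x ^ 4 / (27 * H\<^sup>2) * ((y - d) * (y\<^sup>2 + (3 + d) * y + d * (3 + d)))"
    using first_integral_factorization[OF assms(1)] assms unfolding y_def d_def by auto
  moreover have "0 < x ^ 4 / (27 * H\<^sup>2)"
    using assms by simp
  ultimately have "0 \<le> (y - d) * (y\<^sup>2 + (3 + d) * y + d * (3 + d))"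
    by (metis mult_zero_right mult_le_cancel_left_pos)
  then have "d \<le> y"
    using quadratic_factor_pos[OF d, of y] by (simp add: zero_le_mult_iff)
  then show "0 < H"
    using d assms(3) by (simp add: y_def pos_le_divide_eq) (smt (verit) mult_pos_pos)
  have "x \<le> 3 * H / d"
    using \<open>d \<le> y\<close> d assms(3) by (simp add: y_def field_simps)
  then show "x \<le> 3 * H / (2 * c - 1)"
    by (simp add: d_def)
qed

text \<open>\<open>c\<close> stands for cosh \<theta>. The relation for \<aa> is \<aa>H^2 = (2/9)(1
  + cosh 3\<theta>), rewritten by 1 + cosh 3\<theta> = (c + 1)(2c - 1)^2.\<close>

locale critical_parameters =
  fixes \<aa> H c :: real
  assumes c: "1 < c" and H: "0 < H" and \<aa>: "\<aa> * H\<^sup>2 = 2 / 9 * (c + 1) * (2 * c - 1)\<^sup>2"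
begin

abbreviation "Q \<equiv> first_integral \<aa> H"
abbreviation "G \<equiv> force \<aa> H"

definition max_scale :: real where
  "max_scale = 3 * H / (2 * c - 1)"

lemma max_scale_pos: "0 < max_scale"
  using c H by (simp add: max_scale_def)

lemma Q_nonneg_imp_le: "0 \<le> x \<Longrightarrow> 0 \<le> Q x \<Longrightarrow> x \<le> max_scale"
  using first_integral_nonneg_imp(2)[OF \<aa> c, of x] H max_scale_pos
  by (cases "x = 0") (auto simp: max_scale_def)

lemma Q_0 [simp]: "Q 0 = 0"
  by (simp add: first_integral_def)

lemma Q_eq_0_iff: "0 < x \<Longrightarrow> Q x = 0 \<longleftrightarrow> x = max_scale"
proof -
  assume x: "0 < x"
  define k where "k = x ^ 4 / (27 * H\<^sup>2)"
  define q where "q = (3 * H / x)\<^sup>2 + (3 + (2 * c - 1)) * (3 * H / x) + (2 * c - 1) * (3 + (2 * c - 1))"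
  have "Q x = k * ((3 * H / x - (2 * c - 1)) * q)"
    using first_integral_factorization[OF \<aa>, of x] x H by (simp add: k_def q_def)
  moreover have "0 < k" "0 < q"
    using x H quadratic_factor_pos[of "2 * c - 1" "3 * H / x"] c by (simp_all add: k_def q_def)
  ultimately have "Q x = 0 \<longleftrightarrow> 3 * H / x = 2 * c - 1"
    by simp
  also have "\<dots> \<longleftrightarrow> x = max_scale"
    using x c by (auto simp: max_scale_def field_simps)
  finally show ?thesis .
qed

lemma \<aa>_eq: "\<aa> = 2 / 9 * (c + 1) * (2 * c - 1)\<^sup>2 / H\<^sup>2"
  using \<aa> H by (simp add: field_simps)

text \<open>Q has a simple zero at \<open>max_scale\<close> and decreases through it. This sign is
  what excludes a solution that rests at its maximum.\<close>

lemma G_max_scale: "G max_scale < 0"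
proof -
  define d where "d = 2 * c - 1"
  have d: "1 < d" "\<aa> = (d + 3) * d\<^sup>2 / (9 * H\<^sup>2)" "max_scale = 3 * H / d"
    using c H by (simp_all add: d_def \<aa>_eq max_scale_def field_simps)
  have "G max_scale = - (3 * H * (d + 2)) / (2 * d)"
    unfolding force_def d(2,3) using d(1) H by (simp add: field_simps eval_nat_numeral)
  then show ?thesis
    using d(1) H by simp
qed

lemma G_lipschitz:
  assumes "x \<in> {0..max_scale}" "y \<in> {0..max_scale}"
  shows "\<bar>G x - G y\<bar> \<le> (1 + 2 * \<bar>\<aa>\<bar> * max_scale\<^sup>2) * \<bar>x - y\<bar>"
proof -
  define k where "k = 2 * \<aa> / 3"
  have G_eq: "G z = z + H / 2 - k * z ^ 3" for z
    by (simp add: force_def k_def)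
  have "G x - G y = (1 - k * (x * x + x * y + y * y)) * (x - y)"
    unfolding G_eq by (simp add: algebra_simps power3_eq_cube)
  then have "G x - G y = (1 - 2 * \<aa> / 3 * (x * x + x * y + y * y)) * (x - y)"
    by (simp only: k_def)
  then have "\<bar>G x - G y\<bar> = \<bar>1 - 2 * \<aa> / 3 * (x * x + x * y + y * y)\<bar> * \<bar>x - y\<bar>"
    by (simp add: abs_mult)
  also have "\<dots> \<le> (1 + 2 * \<bar>\<aa>\<bar> * max_scale\<^sup>2) * \<bar>x - y\<bar>"
  proof (rule mult_right_mono)
    have "x * x \<le> max_scale\<^sup>2" "x * y \<le> max_scale\<^sup>2" "y * y \<le> max_scale\<^sup>2"
      using assms by (auto simp: power2_eq_square intro!: mult_mono)
    moreover have "0 \<le> x * x + x * y + y * y"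
      using assms by simp
    ultimately have "\<bar>\<aa>\<bar> * \<bar>x * x + x * y + y * y\<bar> \<le> \<bar>\<aa>\<bar> * (3 * max_scale\<^sup>2)"
      by (intro mult_left_mono) auto
    then have "\<bar>2 * \<aa> / 3 * (x * x + x * y + y * y)\<bar> \<le> 2 * \<bar>\<aa>\<bar> * max_scale\<^sup>2"
      by (simp add: abs_mult)
    then show "\<bar>1 - 2 * \<aa> / 3 * (x * x + x * y + y * y)\<bar> \<le> 1 + 2 * \<bar>\<aa>\<bar> * max_scale\<^sup>2"
      by linarith
  qed simp
  finally show ?thesis .
qed

text \<open>Constancy at the maximal value is compatible with the first integral but not with a
  continuous second derivative, which would jump from 0 to a negative value.\<close>

lemma second_order_equation_positive:
  fixes S v g :: "real \<Rightarrow> real"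
  assumes J: "open J" "connected J" and nonneg: "\<And>x. x \<in> J \<Longrightarrow> 0 \<le> S x"
    and S: "\<And>x. x \<in> J \<Longrightarrow> (S has_real_derivative v x) (at x)"
    and v: "\<And>x. x \<in> J \<Longrightarrow> (v x)\<^sup>2 = Q (S x)"
    and g: "\<And>x. x \<in> J \<Longrightarrow> 0 < S x \<Longrightarrow> (v has_real_derivative g x) (at x)"
    and cont_g: "continuous_on {x \<in> J. 0 < S x} g"
    and nonconst: "\<not> S constant_on J" and p: "p \<in> J" "0 < S p"
  shows "g p = G (S p)"
proof (rule ccontr)
  define U where "U = {x \<in> J. 0 < S x}"
  \<comment> \<open>\<open>V\<close> is the set where the second-order equation fails. It turns out
    to be open and closed in \<open>J\<close>, and to consist of points where S is maximal; so S
    would be constant.\<close>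
  define V where "V = {x \<in> U. g x \<noteq> G (S x)}"
  assume "g p \<noteq> G (S p)"
  then have "p \<in> V"
    using p by (simp add: V_def U_def)
  have cont_S: "continuous_on J S"
    by (rule DERIV_continuous_on[OF has_field_derivative_at_within[OF S]])
  have "open U"
  proof -
    have "U = J \<inter> S -` {0<..}"
      by (auto simp: U_def)
    then show ?thesis
      using continuous_open_preimage[OF cont_S J(1), of "{0<..}"] by simp
  qed
  have "U \<subseteq> J"
    by (auto simp: U_def)
  have "open V"
  proof -
    have "continuous_on U (\<lambda>x. g x - G (S x))"
      by (intro continuous_intros continuous_on_subset[OF cont_S \<open>U \<subseteq> J\<close>]) (use cont_g in \<open>simp add: U_def\<close>)
    moreover have "V = U \<inter> (\<lambda>x. g x - G (S x)) -` (- {0})"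
      by (auto simp: V_def)
    ultimately show ?thesis
      using continuous_open_preimage[OF _ \<open>open U\<close>, of "\<lambda>x. g x - G (S x)" "- {0}"] by auto
  qed
  have v_zero: "v x = 0" if "x \<in> V" for x
  proof -
    have x: "x \<in> J" "0 < S x" "g x \<noteq> G (S x)"
      using that by (auto simp: V_def U_def)
    have "((\<lambda>x. (v x)\<^sup>2) has_real_derivative 2 * v x * g x) (at x)"
      using g[OF x(1,2)] by (auto intro!: derivative_eq_intros)
    moreover have "((\<lambda>x. (v x)\<^sup>2) has_real_derivative 2 * G (S x) * v x) (at x)"
    proof (rule has_field_derivative_transform_within_open)
      show "((\<lambda>x. Q (S x)) has_real_derivative 2 * G (S x) * v x) (at x)"
        by (rule DERIV_chain2[OF has_real_derivative_first_integral S[OF x(1)]])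
    qed (use J x v in auto)
    ultimately have "2 * v x * g x = 2 * G (S x) * v x"
      by (rule DERIV_unique)
    then have "v x * (g x - G (S x)) = 0"
      by (simp add: algebra_simps)
    with x(3) show ?thesis
      by simp
  qed
  have on_V: "S x = max_scale" "g x = 0" if "x \<in> V" for x
  proof -
    have x: "x \<in> J" "0 < S x"
      using that by (auto simp: V_def U_def)
    show "S x = max_scale"
      using v[OF x(1)] v_zero[OF that] Q_eq_0_iff[OF x(2)] by simp
    have "(v has_real_derivative 0) (at x)"
      by (rule has_field_derivative_transform_within_open[of "\<lambda>_. 0" _ _ V])
        (use \<open>open V\<close> that v_zero in auto)
    then show "g x = 0"
      using g[OF x] DERIV_unique by blast
  qed
  define A where "A = {x \<in> J. S x = max_scale}"
  have "A \<subseteq> U"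
    using max_scale_pos by (auto simp: A_def U_def)
  have V_eq: "V = {x \<in> A. g x = 0}"
  proof
    show "V \<subseteq> {x \<in> A. g x = 0}"
    proof
      fix x assume "x \<in> V"
      with on_V[OF this] show "x \<in> {x \<in> A. g x = 0}"
        by (simp add: A_def V_def U_def)
    qed
    show "{x \<in> A. g x = 0} \<subseteq> V"
      using \<open>A \<subseteq> U\<close> G_max_scale by (auto simp: A_def V_def)
  qed
  have "closedin (top_of_set A) V"
    unfolding V_eq
    by (rule continuous_closedin_preimage_constant, rule continuous_on_subset[OF _ \<open>A \<subseteq> U\<close>])
      (use cont_g in \<open>simp add: U_def\<close>)
  moreover have "closedin (top_of_set J) A"
    unfolding A_def by (rule continuous_closedin_preimage_constant[OF cont_S])
  ultimately have "closedin (top_of_set J) V"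
    by (rule closedin_trans)
  moreover have "openin (top_of_set J) V"
    using \<open>open V\<close> J(1) by (simp add: openin_open_eq V_def U_def subset_iff)
  ultimately have "V = J"
    using J(2) \<open>p \<in> V\<close> unfolding connected_clopen by blast
  then show False
    using on_V(1) nonconst by (auto simp: constant_on_def)
qed

text \<open>The solution leaves each zero immediately: between two zeros it has a critical point, where
  it takes the maximal value.\<close>

lemma second_order_equation:
  fixes S v :: "real \<Rightarrow> real"
  assumes J: "open J" and nonneg: "\<And>x. x \<in> J \<Longrightarrow> 0 \<le> S x"
    and S: "\<And>x. x \<in> J \<Longrightarrow> (S has_real_derivative v x) (at x)"
    and v: "\<And>x. x \<in> J \<Longrightarrow> (v x)\<^sup>2 = Q (S x)"
    and pos: "\<And>x. x \<in> J \<Longrightarrow> 0 < S x \<Longrightarrow> (v has_real_derivative G (S x)) (at x)"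
    and nonzero: "\<And>a b. a < b \<Longrightarrow> {a..b} \<subseteq> J \<Longrightarrow> \<exists>x\<in>{a..b}. S x \<noteq> 0"
    and p: "p \<in> J"
  shows "(v has_real_derivative G (S p)) (at p)"
proof (cases "S p = 0")
  case False
  then show ?thesis
    using pos[OF p] nonneg[OF p] by simp
next
  case True
  have cont_S: "continuous_on J S"
    by (rule DERIV_continuous_on[OF has_field_derivative_at_within[OF S]])
  have isCont: "isCont S x" if "x \<in> J" for x
    using DERIV_isCont[OF S[OF that]] .
  \<comment> \<open>Below \<open>max_scale\<close> no positive critical value is possible, so that
    within the ball chosen here p is the only zero.\<close>
  have "open (J \<inter> S -` {..<max_scale})"
    by (rule continuous_open_preimage[OF cont_S J]) simp
  then obtain r where r: "0 < r" "ball p r \<subseteq> J \<inter> S -` {..<max_scale}"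
    using p True max_scale_pos by (metis IntI lessThan_iff openE vimageI2)
  have no_zeros: False if xy: "x < y" "x \<in> ball p r" "y \<in> ball p r" "S x = 0" "S y = 0" for x y
  proof -
    have sub: "{x..y} \<subseteq> ball p r"
      using xy by (auto simp: dist_real_def)
    then have sub': "{x..y} \<subseteq> J"
      using r by blast
    obtain z where z: "z \<in> {x..y}" "S z \<noteq> 0"
      using nonzero[OF xy(1) sub'] by blast
    obtain m where m: "m \<in> {x..y}" "\<And>w. w \<in> {x..y} \<Longrightarrow> S w \<le> S m"
      using continuous_attains_sup[OF compact_Icc, of x y S] continuous_on_subset[OF cont_S sub'] xy(1)
      by fastforce
    have Sm: "0 < S m"
      using m(2)[OF z(1)] z(2) nonneg[of z] z(1) sub' by force
    then have m': "x < m" "m < y"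
      using m(1) xy by (auto simp: less_le)
    have mJ: "m \<in> J"
      using m(1) sub' by blast
    have "v m = 0"
    proof (rule DERIV_local_max[OF S[OF mJ]])
      show "0 < min (m - x) (y - m)"
        using m' by simp
      show "\<forall>w. \<bar>m - w\<bar> < min (m - x) (y - m) \<longrightarrow> S w \<le> S m"
        using m(2) by (auto simp: abs_less_iff)
    qed
    then have "S m = max_scale"
      using v[OF mJ] Q_eq_0_iff[OF Sm] by simp
    moreover have "S m < max_scale"
      using r(2) sub m(1) by blast
    ultimately show False
      by simp
  qed
  have near: "0 < S x" if "x \<in> ball p r" "x \<noteq> p" for x
  proof (rule ccontr)
    assume "\<not> 0 < S x"
    then have "S x = 0"
      using nonneg[of x] r(2) that(1) by force
    then show False
      using no_zeros[of x p] no_zeros[of p x] that True r(1) by (cases "x < p") auto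
  qed
  have ev: "\<forall>\<^sub>F x in at p. x \<in> ball p r - {p}"
    using r(1) by (intro eventually_at_in_open) auto
  have SG: "((\<lambda>x. G (S x)) \<longlongrightarrow> G (S p)) (at p)" "((\<lambda>x. Q (S x)) \<longlongrightarrow> Q (S p)) (at p)"
    unfolding force_def first_integral_def
    using isCont[OF p] by (auto intro!: tendsto_intros simp: isCont_def)
  have vp: "v p = 0"
    using v[OF p] True by simp
  have "((\<lambda>x. sqrt (Q (S x))) \<longlongrightarrow> sqrt (Q (S p))) (at p)"
    by (intro tendsto_real_sqrt SG)
  then have "((\<lambda>x. sqrt (Q (S x))) \<longlongrightarrow> 0) (at p)"
    using True by simp
  then have "((\<lambda>x. \<bar>v x\<bar>) \<longlongrightarrow> 0) (at p)"
  proof (rule Lim_transform_eventually)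
    show "\<forall>\<^sub>F x in at p. sqrt (Q (S x)) = \<bar>v x\<bar>"
      using ev by eventually_elim (use r(2) v in \<open>force simp flip: real_sqrt_abs\<close>)
  qed
  then have v0: "(v \<longlongrightarrow> 0) (at p)"
    by (rule tendsto_rabs_zero_cancel)
  \<comment> \<open>Off p the equation for v is known and its right-hand side is continuous at p.
    Since v(p) = 0, this quotient is the difference quotient of v, and l'Hospital's rule gives its
    limit.\<close>
  have "((\<lambda>x. v x / (x - p)) \<longlongrightarrow> G (S p)) (at p)"
  proof (rule lhopital[OF v0, where g' = "\<lambda>_. 1" and f' = "\<lambda>x. G (S x)"])
    show "((\<lambda>x. x - p) \<longlongrightarrow> 0) (at p)"
      by (auto intro!: tendsto_eq_intros)
    show "\<forall>\<^sub>F x in at p. x - p \<noteq> 0"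
      using ev by eventually_elim auto
    show "\<forall>\<^sub>F x in at p. (v has_real_derivative G (S x)) (at x)"
      using ev by eventually_elim (use r(2) near in \<open>auto intro!: pos\<close>)
    show "((\<lambda>x. G (S x) / 1) \<longlongrightarrow> G (S p)) (at p)"
      using SG by simp
  qed (auto intro!: always_eventually derivative_eq_intros)
  then show ?thesis
    by (simp add: has_field_derivative_iff vp)
qed

section \<open>Uniqueness for the second-order equation\<close>

lemma solution_unique:
  fixes S\<^sub>1 v\<^sub>1 S\<^sub>2 v\<^sub>2 :: "real \<Rightarrow> real"
  assumes J: "is_interval J"
    and 1: "\<And>x. x \<in> J \<Longrightarrow> S\<^sub>1 x \<in> {0..max_scale}"
      "\<And>x. x \<in> J \<Longrightarrow> (S\<^sub>1 has_real_derivative v\<^sub>1 x) (at x)"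
      "\<And>x. x \<in> J \<Longrightarrow> (v\<^sub>1 has_real_derivative G (S\<^sub>1 x)) (at x)"
    and 2: "\<And>x. x \<in> J \<Longrightarrow> S\<^sub>2 x \<in> {0..max_scale}"
      "\<And>x. x \<in> J \<Longrightarrow> (S\<^sub>2 has_real_derivative v\<^sub>2 x) (at x)"
      "\<And>x. x \<in> J \<Longrightarrow> (v\<^sub>2 has_real_derivative G (S\<^sub>2 x)) (at x)"
    and p: "p \<in> J" "S\<^sub>1 p = S\<^sub>2 p" "v\<^sub>1 p = v\<^sub>2 p" and x: "x \<in> J"
  shows "S\<^sub>1 x = S\<^sub>2 x"
proof -
  define K where "K = 1 + 2 * \<bar>\<aa>\<bar> * max_scale\<^sup>2"
  have K: "0 \<le> K"
    by (simp add: K_def)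
  define y u g where "y = (\<lambda>t. S\<^sub>1 t - S\<^sub>2 t)" and "u = (\<lambda>t. v\<^sub>1 t - v\<^sub>2 t)" and "g = (\<lambda>t. G (S\<^sub>1 t) - G (S\<^sub>2 t))"
  have yd: "(y has_real_derivative u t) (at t)" and ud: "(u has_real_derivative g t) (at t)"
    and gb: "\<bar>g t\<bar> \<le> K * \<bar>y t\<bar>" if "t \<in> J" for t
    unfolding y_def u_def g_def K_def using that by (auto intro!: DERIV_diff 1 2 G_lipschitz)
  have "y x = 0"
  proof (cases "p \<le> x")
    case True
    then have sub: "t \<in> J" if "p \<le> t" "t \<le> x" for t
      using J p(1) x that unfolding is_interval_1 by blast
    have "y x = 0 \<and> u x = 0"
    proof (rule gronwall_second_order[OF True K, of y u g])
      show "continuous_on {p..x} y"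
        by (rule DERIV_continuous_on[OF has_field_derivative_at_within[OF yd]]) (simp add: sub)
      show "continuous_on {p..x} u"
        by (rule DERIV_continuous_on[OF has_field_derivative_at_within[OF ud]]) (simp add: sub)
    qed (use yd ud gb sub p in \<open>auto simp: y_def u_def\<close>)
    then show ?thesis ..
  next
    case False
    \<comment> \<open>To the left of p, reflection t to -t changes the sign of the velocity and
      keeps the second derivative, so the same estimate applies.\<close>
    then have "- p \<le> - x"
      by simp
    have sub: "- t \<in> J" if "- p \<le> t" "t \<le> - x" for t
      using J p(1) x that False unfolding is_interval_1 by (metis minus_le_iff le_minus_iff)
    have yd': "((\<lambda>t. y (- t)) has_real_derivative - u (- t)) (at t)"
      and ud': "((\<lambda>t. - u (- t)) has_real_derivative g (- t)) (at t)" if "- t \<in> J" for t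
      using yd[OF that] DERIV_minus[of "\<lambda>t. u (- t)" "- g (- t)" t] ud[OF that]
      by (simp_all add: DERIV_mirror)
    have "y (- (- x)) = 0 \<and> - u (- (- x)) = 0"
    proof (rule gronwall_second_order[OF \<open>- p \<le> - x\<close> K, of "\<lambda>t. y (- t)" "\<lambda>t. - u (- t)" "\<lambda>t. g (- t)"])
      show "continuous_on {- p..- x} (\<lambda>t. y (- t))"
        by (rule DERIV_continuous_on[OF has_field_derivative_at_within[OF yd']]) (simp add: sub)
      show "continuous_on {- p..- x} (\<lambda>t. - u (- t))"
        by (rule DERIV_continuous_on[OF has_field_derivative_at_within[OF ud']]) (simp add: sub)
    qed (use yd' ud' gb sub p in \<open>auto simp: y_def u_def\<close>)
    then show ?thesis
      by simp
  qed
  then show ?thesis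
    by (simp add: y_def)
qed

end

subsection \<open>The model solution\<close>

text \<open>\<open>c * (4 * c\<^sup>2 - 3)\<close> is cosh 3\<theta> for c = cosh \<theta>, so this
  is the cubic invariant of negative type.\<close>

locale critical_profile = lattice L + critical_parameters \<aa> H c
  for L \<aa> H c +
  fixes \<omega> :: real
  assumes g2: "lattice_g2 L = of_real (1 / 12)"
    and g3: "lattice_g3 L = of_real (c * (4 * c\<^sup>2 - 3) / 216)"
    and half_period: "real_half_period L \<omega>"
begin

definition wp1 :: "real \<Rightarrow> real" where
  "wp1 t = Re (wp_deriv 1 (of_real t))"

definition profile :: "real \<Rightarrow> real" where
  "profile t = (if of_real t \<in> L then 0 else 3 * H / (12 * real_wp L t - 1))"

text \<open>The value 0 at lattice points is the true derivative: \<open>profile\<close> has a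
  double zero there and behaves like H/4 times the squared distance.\<close>

definition profile' :: "real \<Rightarrow> real" where
  "profile' t = (if of_real t \<in> L then 0 else - 36 * H * wp1 t / (12 * real_wp L t - 1)\<^sup>2)"

lemma open_regular: "open {t. complex_of_real t \<notin> L}"
proof -
  have "{t. complex_of_real t \<notin> L} = complex_of_real -` (- L)"
    by auto
  then show ?thesis
    using open_vimage[OF open_complement, of complex_of_real] by (simp add: continuous_on_of_real)
qed

text \<open>For the derivative, reality follows by differentiating Im wp = 0 along the open set of
  regular real points.\<close>

lemma wp_real:
  assumes "complex_of_real t \<notin> L"
  shows "wp_deriv 0 (of_real t) = of_real (real_wp L t)" "wp_deriv 1 (of_real t) = of_real (wp1 t)"
proof -
  note zero = Im_wp_real_axis[OF g2 g3]
  show "wp_deriv 0 (of_real t) = of_real (real_wp L t)"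
    using zero[OF assms] by (simp add: complex_eq_iff real_wp_def wp_deriv_0)
  have "((\<lambda>t. Im (wp_deriv 0 (of_real t))) has_real_derivative Im (wp_deriv (Suc 0) (of_real t))) (at t)"
    using assms by (intro has_real_derivative_Re_Im has_field_derivative_wp_deriv)
  moreover have "((\<lambda>t. Im (wp_deriv 0 (of_real t))) has_real_derivative 0) (at t)"
    by (rule has_field_derivative_transform_within_open[OF DERIV_const[of 0] open_regular])
      (use assms zero in auto)
  ultimately have "Im (wp_deriv 1 (of_real t)) = 0"
    using DERIV_unique by fastforce
  then show "wp_deriv 1 (of_real t) = of_real (wp1 t)"
    by (simp add: complex_eq_iff wp1_def)
qed

lemma wp1_square:
  assumes "complex_of_real t \<notin> L"
  shows "(wp1 t)\<^sup>2 = 4 * real_wp L t ^ 3 - real_wp L t / 12 - c * (4 * c\<^sup>2 - 3) / 216"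
proof -
  have "complex_of_real ((wp1 t)\<^sup>2) =
      of_real (4 * real_wp L t ^ 3 - real_wp L t / 12 - c * (4 * c\<^sup>2 - 3) / 216)"
    using wp_first_order_equation[OF assms] unfolding g2 g3 wp_real[OF assms] by simp
  then show ?thesis
    by (simp only: of_real_eq_iff)
qed

lemma has_real_derivative_real_wp:
  assumes "complex_of_real t \<notin> L"
  shows "(real_wp L has_real_derivative wp1 t) (at t)"
    and "(wp1 has_real_derivative 6 * (real_wp L t)\<^sup>2 - 1 / 24) (at t)"
proof -
  show "(real_wp L has_real_derivative wp1 t) (at t)"
    using has_real_derivative_Re_Im(1)[OF has_field_derivative_wp_deriv[OF assms, of 0]]
    by (simp add: real_wp_def[abs_def] wp_deriv_0 wp1_def)
  have "wp_deriv 2 (of_real t) = of_real (6 * (real_wp L t)\<^sup>2 - 1 / 24)"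
    using wp_second_order_equation[OF assms] unfolding g2 wp_real[OF assms] by simp
  then show "(wp1 has_real_derivative 6 * (real_wp L t)\<^sup>2 - 1 / 24) (at t)"
    using has_real_derivative_Re_Im(1)[OF has_field_derivative_wp_deriv[OF assms, of 1]]
    by (simp add: wp1_def[abs_def] numeral_2_eq_2)
qed

text \<open>The square of the real number wp' is nonnegative, so the Weierstrass cubic is
  nonnegative at wp; having only one real root, it keeps wp above that root. The denominator of
  \<open>profile\<close> is therefore positive.\<close>

lemma real_wp_ge:
  assumes "complex_of_real t \<notin> L"
  shows "2 * c - 1 \<le> 12 * real_wp L t - 1"
proof -
  define x where "x = 12 * real_wp L t - 1"
  have "(x - (2 * c - 1)) * (x\<^sup>2 + (3 + (2 * c - 1)) * x + (2 * c - 1) * (3 + (2 * c - 1)))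
      = 432 * (4 * real_wp L t ^ 3 - real_wp L t / 12 - c * (4 * c\<^sup>2 - 3) / 216)"
    by (simp add: x_def field_simps power2_eq_square power3_eq_cube)
  also have "\<dots> = 432 * (wp1 t)\<^sup>2"
    by (simp only: wp1_square[OF assms])
  finally have "0 \<le> (x - (2 * c - 1)) * (x\<^sup>2 + (3 + (2 * c - 1)) * x + (2 * c - 1) * (3 + (2 * c - 1)))"
    by simp
  then show ?thesis
    using quadratic_factor_pos[of "2 * c - 1" x] c by (simp add: zero_le_mult_iff x_def)
qed

lemma profile_zero_iff: "profile t = 0 \<longleftrightarrow> complex_of_real t \<in> L"
  using real_wp_ge[of t] c H by (auto simp: profile_def)

lemma profile_nonneg: "0 \<le> profile t"
  using real_wp_ge[of t] c H by (auto simp: profile_def)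

lemma wp1_square_shifted:
  assumes "complex_of_real t \<notin> L"
  defines "x \<equiv> 12 * real_wp L t - 1"
  shows "(wp1 t)\<^sup>2 = (x ^ 3 + 3 * x\<^sup>2 - 9 * \<aa> * H\<^sup>2) / 432"
proof -
  have "9 * \<aa> * H\<^sup>2 = 2 * (c + 1) * (2 * c - 1)\<^sup>2"
    using \<aa> by simp
  then show ?thesis
    unfolding wp1_square[OF assms(1)] x_def
    by (simp add: field_simps power2_eq_square power3_eq_cube)
qed

lemma profile_regular_derivatives:
  assumes t: "complex_of_real t \<notin> L"
  shows "(profile has_real_derivative profile' t) (at t)"
    and "(profile' has_real_derivative G (profile t)) (at t)"
    and "(profile' t)\<^sup>2 = Q (profile t)"
proof -
  define x where "x = 12 * real_wp L t - 1"
  have x: "0 < x"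
    using real_wp_ge[OF t] c by (simp add: x_def)
  have "((\<lambda>t. 3 * H / (12 * real_wp L t - 1)) has_real_derivative profile' t) (at t)"
    using x t by (auto intro!: derivative_eq_intros has_real_derivative_real_wp
        simp: x_def profile'_def power2_eq_square)
  then show "(profile has_real_derivative profile' t) (at t)"
    by (rule has_field_derivative_transform_within_open[OF _ open_regular]) (use t in \<open>auto simp: profile_def\<close>)
  have "((\<lambda>t. - 36 * H * wp1 t) has_real_derivative - 36 * H * (6 * (real_wp L t)\<^sup>2 - 1 / 24)) (at t)"
    by (intro DERIV_cmult has_real_derivative_real_wp t)
  moreover have "((\<lambda>t. (12 * real_wp L t - 1)\<^sup>2) has_real_derivative 2 * x * (12 * wp1 t)) (at t)"
    using t by (auto intro!: derivative_eq_intros has_real_derivative_real_wp simp: x_def)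
  ultimately have "((\<lambda>t. - 36 * H * wp1 t / (12 * real_wp L t - 1)\<^sup>2) has_real_derivative
      ((- 36 * H * (6 * (real_wp L t)\<^sup>2 - 1 / 24)) * (12 * real_wp L t - 1)\<^sup>2
        - (- 36 * H * wp1 t) * (2 * x * (12 * wp1 t))) / ((12 * real_wp L t - 1)\<^sup>2 * (12 * real_wp L t - 1)\<^sup>2)) (at t)"
    using x by (intro DERIV_divide) (simp_all add: x_def)
  then have "((\<lambda>t. - 36 * H * wp1 t / (12 * real_wp L t - 1)\<^sup>2) has_real_derivative
      (- 36 * H * (6 * (real_wp L t)\<^sup>2 - 1 / 24) * x\<^sup>2 + 36 * H * wp1 t * (2 * x * (12 * wp1 t))) / (x\<^sup>2 * x\<^sup>2)) (at t)"
    by (simp add: x_def)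
  also have "36 * H * wp1 t * (2 * x * (12 * wp1 t)) = 864 * H * x * (wp1 t)\<^sup>2"
    by (simp add: power2_eq_square)
  also have "(- 36 * H * (6 * (real_wp L t)\<^sup>2 - 1 / 24) * x\<^sup>2 + 864 * H * x * (wp1 t)\<^sup>2) / (x\<^sup>2 * x\<^sup>2) = G (3 * H / x)"
  proof -
    have p: "real_wp L t = (x + 1) / 12"
      by (simp add: x_def)
    show ?thesis
      unfolding wp1_square_shifted[OF t, folded x_def] force_def p
      using x by (simp add: field_simps eval_nat_numeral)
  qed
  also have "3 * H / x = profile t"
    using t by (simp add: profile_def x_def)
  finally show "(profile' has_real_derivative G (profile t)) (at t)"
    by (rule has_field_derivative_transform_within_open[OF _ open_regular]) (use t in \<open>auto simp: profile'_def\<close>)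
  have "(profile' t)\<^sup>2 = 1296 * H\<^sup>2 * (wp1 t)\<^sup>2 / x ^ 4"
    using t by (simp add: profile'_def x_def power_divide power_mult_distrib flip: power_mult)
  also have "\<dots> = Q (3 * H / x)"
    unfolding wp1_square_shifted[OF t, folded x_def] first_integral_def
    using x by (simp add: field_simps eval_nat_numeral)
  finally show "(profile' t)\<^sup>2 = Q (profile t)"
    using t by (simp add: profile_def x_def)
qed

lemma profile_add:
  assumes "complex_of_real u \<in> L"
  shows "profile (t + u) = profile t"
proof (cases "complex_of_real t \<in> L")
  case False
  have "real_wp L (t + u) = real_wp L t"
    using wp_deriv_add[OF assms False, of 0] by (simp add: real_wp_def wp_deriv_0)
  then show ?thesis
    using add_mem_iff[OF assms, of "of_real t"] by (simp add: profile_def)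
qed (use add_mem_iff[OF assms, of "of_real t"] in \<open>simp add: profile_def\<close>)

lemma profile_minus: "profile (- t) = profile t"
  using wp_deriv_minus[of 0 "of_real t"] minus_mem_iff[of "of_real t"]
  by (simp add: profile_def real_wp_def wp_deriv_0)

lemma profile'_minus: "profile' (- t) = - profile' t"
  using wp_deriv_minus[of 0 "of_real t"] wp_deriv_minus[of 1 "of_real t"] minus_mem_iff[of "of_real t"]
  by (simp add: profile'_def real_wp_def wp_deriv_0 wp1_def)

text \<open>The formula for the derivative degenerates at the pole, so the difference quotient is
  estimated directly from the Laurent form of wp.\<close>

lemma profile_derivative_zero: "(profile has_real_derivative 0) (at 0)"
proof -
  have "((\<lambda>t. Re (wp_reg 0 (of_real t)) :: real) has_real_derivative Re (wp_reg 1 (of_real 0))) (at 0)"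
    using has_real_derivative_Re_Im(1)[OF has_field_derivative_wp_reg[of "of_real 0" 0]] by simp
  then have "isCont (\<lambda>t. Re (wp_reg 0 (of_real t))) 0"
    by (rule DERIV_isCont)
  then have "((\<lambda>t. Re (wp_reg 0 (of_real t))) \<longlongrightarrow> 0) (at (0::real))"
    by (simp add: isCont_def wp_reg_0_0)
  then have ev: "\<forall>\<^sub>F t in at (0::real). - 1 < Re (wp_reg 0 (of_real t))"
    by (rule order_tendstoD) simp
  have "((\<lambda>t. t\<^sup>2) \<longlongrightarrow> (0::real)) (at 0)"
    by (auto intro!: tendsto_eq_intros)
  \<comment> \<open>With the regular part above -1, 12wp - 1 exceeds 12/t^2 - 13. For t^2 < 1/26 the
    number 13 is below half of 1/t^2, so the lower bound 3/t^2 holds with room to spare.\<close>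
  then have ev2: "\<forall>\<^sub>F t in at (0::real). t\<^sup>2 < 1 / 26"
    by (rule order_tendstoD) simp
  have ev3: "\<forall>\<^sub>F t in at (0::real). t \<noteq> 0"
    by (auto simp: eventually_at intro!: exI[of _ 1])
  have "\<forall>\<^sub>F t in at 0. norm (profile t / t) \<le> H * \<bar>t\<bar>"
    using ev ev2 ev3
  proof eventually_elim
    case (elim t)
    show ?case
    proof (cases "complex_of_real t \<in> L")
      case False
      have "real_wp L t = 1 / t\<^sup>2 + Re (wp_reg 0 (of_real t))"
        unfolding real_wp_def wp_deriv_0[symmetric] wp_deriv_def
        by (simp add: Re_divide power2_eq_square)
      then have "12 / t\<^sup>2 - 13 \<le> 12 * real_wp L t - 1"
        using elim(1) by simp
      moreover have "26 \<le> 1 / t\<^sup>2"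
        using elim(2,3) by (simp add: field_simps)
      ultimately have le: "3 / t\<^sup>2 \<le> 12 * real_wp L t - 1"
        by simp
      have "\<bar>profile t\<bar> = 3 * H / (12 * real_wp L t - 1)"
        using False by (simp only: abs_of_nonneg[OF profile_nonneg]) (simp add: profile_def)
      also have "\<dots> \<le> 3 * H / (3 / t\<^sup>2)"
      proof (rule divide_left_mono[OF le])
        have "0 < 3 / t\<^sup>2"
          using elim(3) by simp
        then show "0 < (12 * real_wp L t - 1) * (3 / t\<^sup>2)"
          using le by (intro mult_pos_pos) linarith+
      qed (use H in simp)
      finally have "\<bar>profile t\<bar> \<le> H * \<bar>t\<bar> * \<bar>t\<bar>"
        using elim(3) by (simp add: power2_eq_square)
      then show ?thesis
        using elim(3) by (simp add: pos_divide_le_eq)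
    qed (use H in \<open>simp add: profile_def\<close>)
  qed
  moreover have "((\<lambda>t. H * \<bar>t\<bar>) \<longlongrightarrow> 0) (at 0)"
    by (auto intro!: tendsto_eq_intros)
  ultimately have "((\<lambda>t. profile t / t) \<longlongrightarrow> 0) (at 0)"
    by (rule Lim_null_comparison)
  then show ?thesis
    using zero_mem by (simp add: has_field_derivative_iff profile_def[of 0])
qed

lemma has_real_derivative_profile: "(profile has_real_derivative profile' t) (at t)"
proof (cases "complex_of_real t \<in> L")
  case True
  have "((\<lambda>x. profile (x + t)) has_real_derivative 0) (at 0)"
    using profile_derivative_zero profile_add[OF True] by simp
  then show ?thesis
    using DERIV_shift[of profile 0 0 t] True by (simp add: profile'_def)
qed (rule profile_regular_derivatives)

lemma profile'_square: "(profile' t)\<^sup>2 = Q (profile t)"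
  using profile_regular_derivatives(3)[of t] by (cases "complex_of_real t \<in> L") (simp_all add: profile'_def profile_def)

lemma profile_range: "profile t \<in> {0..max_scale}"
  using profile_nonneg[of t] Q_nonneg_imp_le[of "profile t"] profile'_square[of t]
  by (metis atLeastAtMost_iff zero_le_power2)

lemma profile_nonzero:
  assumes "a < b"
  shows "\<exists>t\<in>{a..b}. profile t \<noteq> 0"
proof (rule ccontr)
  assume "\<not> ?thesis"
  then have "{a..b} \<subseteq> complex_of_real -` L"
    by (auto simp: profile_zero_iff)
  moreover have "complex_of_real -` L \<subseteq> Re ` L"
    by (force intro: image_eqI[of _ Re "complex_of_real t" for t])
  then have "countable (complex_of_real -` L)"
    by (rule countable_subset) (simp add: countable)
  ultimately have "countable {a..b}"
    by (rule countable_subset)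
  with assms show False
    using uncountable_closed_interval by blast
qed

text \<open>At lattice points the equation is not read off from wp; it follows from the extension
  across zeros, applied to \<open>profile\<close> on the whole line.\<close>

lemma has_real_derivative_profile': "(profile' has_real_derivative G (profile t)) (at t)"
proof (rule second_order_equation[OF open_UNIV, of profile])
  show "(profile' has_real_derivative G (profile x)) (at x)" if "0 < profile x" for x
    using that profile_zero_iff[of x] by (intro profile_regular_derivatives) auto
  show "\<exists>x\<in>{a..b}. profile x \<noteq> 0" if "a < b" for a b
    using profile_nonzero[OF that] .
qed (simp_all add: profile_nonneg has_real_derivative_profile profile'_square)

section \<open>Real lattice points, and the states reached by the profile\<close>

lemma \<omega>_pos: "0 < \<omega>"
  using half_period by (simp add: real_half_period_def)

lemma period_mem: "complex_of_real (2 * \<omega>) \<in> L"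
proof -
  have "0 + complex_of_real (2 * \<omega>) \<in> L \<longleftrightarrow> 0 \<in> L"
    using half_period unfolding real_half_period_def period_of_wp_def by blast
  then show ?thesis
    using zero_mem by simp
qed

lemma of_int_mult_mem: "w \<in> L \<Longrightarrow> of_int h * w \<in> L"
proof (induction h rule: int_induct[of _ 0])
  case base
  then show ?case
    using zero_mem by simp
next
  case (step1 i)
  then show ?case
    using add_mem[of "of_int i * w" w] by (simp add: distrib_right)
next
  case (step2 i)
  then show ?case
    using diff_mem[of "of_int i * w" w] by (simp add: left_diff_distrib)
qed

text \<open>A real lattice point reduced modulo 2\<omega> is a lattice point in [0, 2\<omega>),
  hence a period of wp. Minimality of 2\<omega> leaves only 0.\<close>

lemma real_mem_iff: "complex_of_real t \<in> L \<longleftrightarrow> (\<exists>h::int. t = 2 * of_int h * \<omega>)"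
proof
  assume t: "complex_of_real t \<in> L"
  define h where "h = \<lfloor>t / (2 * \<omega>)\<rfloor>"
  define s where "s = t - of_int h * (2 * \<omega>)"
  have "of_int h * complex_of_real (2 * \<omega>) \<in> L"
    using of_int_mult_mem period_mem by blast
  then have s: "complex_of_real s \<in> L"
    using diff_mem[OF t] by (simp add: s_def)
  have "s = frac (t / (2 * \<omega>)) * (2 * \<omega>)"
    using \<omega>_pos by (simp add: s_def h_def frac_def field_simps)
  then have "0 \<le> s" "s < 2 * \<omega>"
    using frac_lt_1[of "t / (2 * \<omega>)"] \<omega>_pos by simp_all
  moreover have "period_of_wp L (of_real s)"
    using add_mem_iff[OF s] wp_deriv_add[OF s, of _ 0] by (simp add: period_of_wp_def wp_deriv_0)
  moreover have "\<not> period_of_wp L (of_real s)" if "0 < s" "s < 2 * \<omega>"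
    using half_period that by (simp add: real_half_period_def)
  ultimately have "s = 0"
    by (cases "0 < s") auto
  then show "\<exists>h::int. t = 2 * of_int h * \<omega>"
    by (auto simp: s_def)
next
  assume "\<exists>h::int. t = 2 * of_int h * \<omega>"
  then obtain h :: int where "t = 2 * of_int h * \<omega>" ..
  then show "complex_of_real t \<in> L"
    using of_int_mult_mem[OF period_mem, of h] by (simp add: mult_ac)
qed

lemma profile_periodic: "profile (t + 2 * \<omega>) = profile t"
  by (rule profile_add[OF period_mem])

text \<open>Between the consecutive zeros 0 and 2\<omega> there is a critical point that is not a
  zero; there Q vanishes at a positive value.\<close>

lemma profile_attains_max: "\<exists>t. profile t = max_scale"
proof -
  have cont: "continuous_on {0..2 * \<omega>} profile"
    by (rule DERIV_continuous_on[OF has_field_derivative_at_within[OF has_real_derivative_profile]])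
  have "profile 0 = profile (2 * \<omega>)"
    using profile_periodic[of 0] by simp
  then have "\<exists>t>0. t < 2 * \<omega> \<and> (profile has_real_derivative 0) (at t)"
    using Rolle[OF _ _ cont] \<omega>_pos has_real_derivative_profile real_differentiable_def by auto
  then obtain t where t: "0 < t" "t < 2 * \<omega>" "(profile has_real_derivative 0) (at t)"
    by blast
  then have "profile' t = 0"
    using has_real_derivative_profile DERIV_unique by blast
  moreover have "complex_of_real t \<notin> L"
  proof
    assume "complex_of_real t \<in> L"
    then obtain h :: int where h: "t = 2 * of_int h * \<omega>"
      using real_mem_iff by blast
    then have "0 < real_of_int h" "real_of_int h < 1"
      using t \<omega>_pos by (simp_all add: zero_less_mult_iff mult_less_cancel_right)
    then show False
      by simp
  qed
  then have "0 < profile t"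
    using profile_nonneg[of t] profile_zero_iff[of t] by simp
  ultimately show ?thesis
    using profile'_square[of t] Q_eq_0_iff by auto
qed

text \<open>Every admissible initial state occurs: the position by the intermediate value theorem
  between a zero and a maximum, the sign of the velocity by reflection. Any solution can thus be
  matched with a translate at a single point.\<close>

lemma profile_attains:
  assumes "x \<in> {0..max_scale}" "v\<^sup>2 = Q x"
  obtains t where "profile t = x" "profile' t = v"
proof -
  obtain m where m: "profile m = max_scale"
    using profile_attains_max by blast
  then have m': "profile \<bar>m\<bar> = max_scale"
    using profile_minus[of m] by (simp add: abs_if)
  have "profile 0 = 0"
    using zero_mem by (simp add: profile_def)
  then have "\<exists>t\<ge>0. t \<le> \<bar>m\<bar> \<and> profile t = x"
    using assms m' by (intro IVT) (auto intro: DERIV_isCont has_real_derivative_profile)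
  then obtain t where t: "profile t = x"
    by blast
  then have "(profile' t)\<^sup>2 = v\<^sup>2"
    using assms profile'_square[of t] by simp
  then have "profile' t = v \<or> profile' (- t) = v"
    by (auto simp: power2_eq_iff profile'_minus)
  then show ?thesis
    using that t profile_minus by metis
qed

theorem solution_is_translate:
  assumes J: "open_interval J" and nonneg: "\<And>x. x \<in> J \<Longrightarrow> 0 \<le> S x"
    and S: "\<And>x. x \<in> J \<Longrightarrow> (S has_real_derivative v x) (at x)"
    and v: "\<And>x. x \<in> J \<Longrightarrow> (v x)\<^sup>2 = Q (S x)"
    and g: "\<And>x. x \<in> J \<Longrightarrow> 0 < S x \<Longrightarrow> (v has_real_derivative g x) (at x)"
    and cont_g: "continuous_on {x \<in> J. 0 < S x} g"
    and nonconst: "\<not> S constant_on J"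
    and nonzero: "\<And>a b. a < b \<Longrightarrow> {a..b} \<subseteq> J \<Longrightarrow> \<exists>x\<in>{a..b}. S x \<noteq> 0"
  obtains d where "\<And>x. x \<in> J \<Longrightarrow> S x = profile (x + d)"
proof -
  have J': "open J" "connected J" "is_interval J"
    using J by (auto simp: open_interval_def is_interval_connected)
  have range: "S x \<in> {0..max_scale}" if "x \<in> J" for x
    using nonneg[OF that] v[OF that] Q_nonneg_imp_le[of "S x"] by (metis atLeastAtMost_iff zero_le_power2)
  have second: "(v has_real_derivative G (S x)) (at x)" if "x \<in> J" for x
  proof (rule second_order_equation[OF J'(1) nonneg S v _ nonzero that])
    fix x assume x: "x \<in> J" "0 < S x"
    then have "g x = G (S x)"
      by (intro second_order_equation_positive[OF J'(1,2) nonneg S v g cont_g nonconst])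
    with g[OF x] show "(v has_real_derivative G (S x)) (at x)"
      by simp
  qed
  obtain p where p: "p \<in> J"
    using J by (auto simp: open_interval_def)
  obtain t where t: "profile t = S p" "profile' t = v p"
    using profile_attains[OF range[OF p] v[OF p]] .
  have "S x = profile (x + (t - p))" if "x \<in> J" for x
    by (rule solution_unique[OF J'(3), of S v _ "\<lambda>x. profile' (x + (t - p))" p])
      (use p t that in \<open>auto intro: range S second simp: DERIV_shift[symmetric] has_real_derivative_profile
        has_real_derivative_profile' profile_range simp del: atLeastAtMost_iff\<close>)
  then show ?thesis
    using that by blast
qed

end

subsection \<open>Spacetimes in conformal time\<close>

text \<open>\<open>Ck_on\<close> asserts the existence of some family of derivatives, whereas
  density and pressure use \<open>deriv\<close>. On an open set the two agree, and smoothness is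
  carried over this agreement twice.\<close>

lemma smooth_on_real_derivatives:
  fixes s :: "real \<Rightarrow> real"
  assumes U: "open U" and s: "smooth_on U s"
  shows "t \<in> U \<Longrightarrow> (s has_real_derivative deriv s t) (at t)"
    and "t \<in> U \<Longrightarrow> (deriv s has_real_derivative deriv (deriv s) t) (at t)"
    and "continuous_on U (deriv (deriv s))"
proof -
  have step: "(\<forall>t\<in>U. (f has_real_derivative deriv f t) (at t)) \<and> Ck_on k U (deriv f)"
    if smooth: "Ck_on (Suc k) U f" for k and f :: "real \<Rightarrow> real"
  proof -
    obtain f' where f': "\<And>x. x \<in> U \<Longrightarrow> (f has_derivative f' x) (at x)" "\<And>v. Ck_on k U (\<lambda>x. f' x v)"
      using smooth by auto
    have der: "(f has_real_derivative f' x 1) (at x)" if "x \<in> U" for x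
    proof (rule has_derivative_imp_has_field_derivative[OF f'(1)[OF that]])
      show "v * f' x 1 = f' x v" for v
        using linear_cmul[OF has_derivative_linear[OF f'(1)[OF that]], of v 1] by simp
    qed
    have cong: "Ck_on k U h" if g: "Ck_on k U g" "\<And>x. x \<in> U \<Longrightarrow> g x = h x" for g h :: "real \<Rightarrow> real"
    proof (cases k)
      case 0
      then show ?thesis
        using g continuous_on_cong[of U U g h] by simp
    next
      case (Suc n)
      obtain g' where g': "\<And>x. x \<in> U \<Longrightarrow> (g has_derivative g' x) (at x)" "\<And>v. Ck_on n U (\<lambda>x. g' x v)"
        using g(1) Suc by auto
      have "(h has_derivative g' x) (at x)" if "x \<in> U" for x
        using has_derivative_transform_within_open[OF g'(1)[OF that] U that] g(2) by blast
      with g'(2) Suc show ?thesis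
        by auto
    qed
    have "f' x 1 = deriv f x" if "x \<in> U" for x
      using DERIV_imp_deriv[OF der[OF that]] by simp
    with der cong[OF f'(2)[of 1]] show ?thesis
      by metis
  qed
  have "Ck_on (Suc (Suc 0)) U s"
    using s unfolding smooth_on_def by blast
  from step[OF this] have 1: "\<forall>t\<in>U. (s has_real_derivative deriv s t) (at t)" "Ck_on (Suc 0) U (deriv s)"
    by blast+
  from step[OF 1(2)] have 2: "\<forall>t\<in>U. (deriv s has_real_derivative deriv (deriv s) t) (at t)"
    "Ck_on 0 U (deriv (deriv s))"
    by blast+
  show "t \<in> U \<Longrightarrow> (s has_real_derivative deriv s t) (at t)"
    "t \<in> U \<Longrightarrow> (deriv s has_real_derivative deriv (deriv s) t) (at t)"
    "continuous_on U (deriv (deriv s))"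
    using 1 2 by simp_all
qed

locale RW_spacetime =
  fixes \<Lambda> :: real and I :: "real set" and s :: "real \<Rightarrow> real"
  assumes RW: "closed_RW_spacetime \<Lambda> I s"
begin

lemma I: "open I" "is_interval I" "I \<noteq> {}"
  using RW by (auto simp: closed_RW_spacetime_def open_interval_def)

lemma scale_nonneg: "t \<in> I \<Longrightarrow> 0 \<le> s t"
  using RW by (simp add: closed_RW_spacetime_def)

end

locale conformal_RW_spacetime = RW_spacetime +
  fixes t\<^sub>0 :: real
  assumes t\<^sub>0: "t\<^sub>0 \<in> I"
begin

definition "\<tau> = conformal_time s t\<^sub>0"
definition "J = conformal_domain I s t\<^sub>0"
definition "\<sigma> = the_inv_into I \<tau>"
definition "S = conformal_scale I s t\<^sub>0"

lemma admits: "admits_conformal_time I s t" if "t \<in> I"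
  using RW that by (simp add: closed_RW_spacetime_def)

lemma J: "open_interval J" "open J"
  using admits[OF t\<^sub>0] by (auto simp: admits_conformal_time_def J_def open_interval_def)

lemma \<tau>_mono: "strict_mono_on I \<tau>"
  using admits[OF t\<^sub>0] by (auto simp: admits_conformal_time_def \<tau>_def)

lemma inj_\<tau>: "inj_on \<tau> I"
  using \<tau>_mono by (rule strict_mono_on_imp_inj_on)

lemma \<tau>_mem: "t \<in> I \<Longrightarrow> \<tau> t \<in> J"
  by (simp add: J_def \<tau>_def conformal_domain_def)

lemma \<sigma>_\<tau>: "t \<in> I \<Longrightarrow> \<sigma> (\<tau> t) = t"
  by (simp add: \<sigma>_def the_inv_into_f_f[OF inj_\<tau>])

lemma \<sigma>: "x \<in> J \<Longrightarrow> \<sigma> x \<in> I" "x \<in> J \<Longrightarrow> \<tau> (\<sigma> x) = x"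
  using \<sigma>_\<tau> by (auto simp: J_def \<tau>_def conformal_domain_def)

lemma S: "S x = s (\<sigma> x)"
  by (simp add: S_def conformal_scale_def \<sigma>_def \<tau>_def)

lemma S_\<tau>: "t \<in> I \<Longrightarrow> S (\<tau> t) = s t"
  by (simp add: S \<sigma>_\<tau>)

lemma S_nonneg: "x \<in> J \<Longrightarrow> 0 \<le> S x"
  by (simp add: S \<sigma> scale_nonneg)

lemma differentiable: "x \<in> J \<Longrightarrow> \<sigma> differentiable (at x)" "x \<in> J \<Longrightarrow> S differentiable (at x)"
  using admits[OF t\<^sub>0] J(2)
  by (auto simp: admits_conformal_time_def J_def \<sigma>_def \<tau>_def S_def differentiable_on_eq_differentiable_at)

lemma S_deriv: "x \<in> J \<Longrightarrow> (S has_real_derivative deriv S x) (at x)"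
  using differentiable(2) by (simp add: DERIV_deriv_iff_real_differentiable)

text \<open>Smoothness is given only where s is positive. Across its zeros, continuity comes from
  writing s as S composed with \<tau>.\<close>

lemma continuous_scale: "continuous_on I s"
proof -
  have "continuous_on I \<tau>"
    using admits[OF t\<^sub>0] by (simp add: admits_conformal_time_def \<tau>_def)
  moreover have "continuous_on J S"
    by (rule DERIV_continuous_on[OF has_field_derivative_at_within[OF S_deriv]])
  ultimately have "continuous_on I (\<lambda>t. S (\<tau> t))"
    by (intro continuous_on_compose2[of J S I \<tau>]) (auto intro: \<tau>_mem)
  then show ?thesis
    using S_\<tau> by (simp cong: continuous_on_cong)
qed

lemma open_positive: "open {t \<in> I. 0 < s t}"
proof -
  have "{t \<in> I. 0 < s t} = I \<inter> s -` {0<..}"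
    by auto
  then show ?thesis
    using continuous_open_preimage[OF continuous_scale I(1), of "{0<..}"] by simp
qed

lemma scale_derivatives:
  assumes "t \<in> I" "0 < s t"
  shows "(s has_real_derivative deriv s t) (at t)"
    and "(deriv s has_real_derivative deriv (deriv s) t) (at t)"
  using smooth_on_real_derivatives[OF open_positive, of s] RW assms
  by (auto simp: closed_RW_spacetime_def)

lemma continuous_deriv2: "continuous_on {t \<in> I. 0 < s t} (deriv (deriv s))"
  using smooth_on_real_derivatives(3)[OF open_positive, of s] RW
  by (auto simp: closed_RW_spacetime_def)

lemma continuous_deriv: "continuous_on {t \<in> I. 0 < s t} (deriv s)"
  by (rule DERIV_continuous_on[OF has_field_derivative_at_within[OF scale_derivatives(2)]]) auto

lemma integrable:
  assumes "t \<in> I" "u \<in> I"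
  shows "interval_lebesgue_integrable lborel (ereal t) (ereal u) (\<lambda>u. 1 / s u)"
  using admits[OF assms(1)] assms(2) by (simp add: admits_conformal_time_def)

lemma \<tau>_deriv:
  assumes t: "t \<in> I" "0 < s t"
  shows "(\<tau> has_real_derivative 1 / s t) (at t)"
proof -
  obtain e where e: "0 < e" "cball t e \<subseteq> {t \<in> I. 0 < s t}"
    using open_positive t open_contains_cball by (metis (mono_tags, lifting) mem_Collect_eq)
  define a b where "a = t - e" and "b = t + e"
  have ab: "a < t" "t < b" "{a..b} \<subseteq> {t \<in> I. 0 < s t}"
    using e by (auto simp: a_def b_def cball_eq_atLeastAtMost)
  then have a: "a \<in> I"
    by force
  \<comment> \<open>Rebasing the integral at \<open>a\<close>, near t, where 1/s is continuous,
    makes the fundamental theorem of calculus applicable. Integrability over the hull of the three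
    points is obtained by taking the least of them as base point.\<close>
  have eq: "\<tau> u = \<tau> a + (LBINT y=a..u. 1 / s y)" if "u \<in> I" for u
  proof -
    have "min t\<^sub>0 (min a u) \<in> I" "max t\<^sub>0 (max a u) \<in> I"
      using t\<^sub>0 a that by (auto simp: min_def max_def)
    from integrable[OF this]
    have "interval_lebesgue_integrable lborel (min (ereal t\<^sub>0) (min (ereal a) (ereal u)))
        (max (ereal t\<^sub>0) (max (ereal a) (ereal u))) (\<lambda>u. 1 / s u)"
      by (simp only: ereal_min ereal_max)
    from interval_integral_sum[OF this] show ?thesis
      by (simp add: \<tau>_def conformal_time_def)
  qed
  have "((\<lambda>u. LBINT y=a..u. 1 / s y) has_vector_derivative 1 / s t) (at t within {a..b})"
  proof (rule interval_integral_FTC2)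
    show "continuous_on {a..b} (\<lambda>y. 1 / s y)"
      by (intro continuous_intros continuous_on_subset[OF continuous_scale]) (use ab in auto)
  qed (use ab in auto)
  then have "((\<lambda>u. \<tau> a + (LBINT y=a..u. 1 / s y)) has_real_derivative 1 / s t) (at t)"
    using ab by (auto intro!: derivative_eq_intros
        simp: has_real_derivative_iff_has_vector_derivative at_within_Icc_at)
  then show ?thesis
    by (rule has_field_derivative_transform_within_open[OF _ I(1) t(1)]) (rule eq[symmetric])
qed

text \<open>Differentiability of \<sigma> belongs to the conformal model; the chain rule for
  \<tau>(\<sigma>(x)) = x then determines the derivative.\<close>

lemma \<sigma>_deriv:
  assumes x: "x \<in> J" "0 < S x"
  shows "(\<sigma> has_real_derivative S x) (at x)"
proof -
  obtain d where d: "(\<sigma> has_real_derivative d) (at x)"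
    using differentiable(1)[OF x(1)] by (auto simp: real_differentiable_def)
  have "((\<lambda>y. \<tau> (\<sigma> y)) has_real_derivative 1 / s (\<sigma> x) * d) (at x)"
    by (rule DERIV_chain2[OF \<tau>_deriv d]) (use x \<sigma> in \<open>auto simp: S\<close>)
  moreover have "((\<lambda>y. \<tau> (\<sigma> y)) has_real_derivative 1) (at x)"
    by (rule has_field_derivative_transform_within_open[OF DERIV_ident J(2) x(1)]) (simp add: \<sigma>)
  ultimately have "1 / s (\<sigma> x) * d = 1"
    by (rule DERIV_unique)
  then have "d = S x"
    using x by (simp add: S field_simps)
  with d show ?thesis
    by simp
qed

lemma deriv_S:
  assumes x: "x \<in> J" "0 < S x"
  shows "deriv S x = deriv s (\<sigma> x) * s (\<sigma> x)"
proof (rule DERIV_imp_deriv)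
  have "((\<lambda>y. s (\<sigma> y)) has_real_derivative deriv s (\<sigma> x) * S x) (at x)"
    by (rule DERIV_chain2[OF scale_derivatives(1) \<sigma>_deriv]) (use x \<sigma> in \<open>auto simp: S\<close>)
  then show "(S has_real_derivative deriv s (\<sigma> x) * s (\<sigma> x)) (at x)"
    by (simp add: S[abs_def])
qed

lemma open_positive_S: "open {x \<in> J. 0 < S x}"
proof -
  have "{x \<in> J. 0 < S x} = J \<inter> S -` {0<..}"
    by auto
  moreover have "continuous_on J S"
    by (rule DERIV_continuous_on[OF has_field_derivative_at_within[OF S_deriv]])
  ultimately show ?thesis
    using continuous_open_preimage[OF _ J(2), of S "{0<..}"] by simp
qed

text \<open>The second conformal derivative of S where S is positive. A conformal derivative is s
  times a proper-time derivative, here applied to S' = s s'.\<close>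

definition S2 :: "real \<Rightarrow> real" where
  "S2 x = (deriv (deriv s) (\<sigma> x) * s (\<sigma> x) + (deriv s (\<sigma> x))\<^sup>2) * s (\<sigma> x)"

lemma deriv_S_deriv:
  assumes x: "x \<in> J" "0 < S x"
  shows "(deriv S has_real_derivative S2 x) (at x)"
proof -
  have "((\<lambda>t. deriv s t * s t) has_real_derivative
      deriv (deriv s) (\<sigma> x) * s (\<sigma> x) + (deriv s (\<sigma> x))\<^sup>2) (at (\<sigma> x))"
    using scale_derivatives[of "\<sigma> x"] x \<sigma>
    by (auto intro!: derivative_eq_intros simp: S power2_eq_square)
  from DERIV_chain2[OF this \<sigma>_deriv[OF x]]
  have "((\<lambda>y. deriv s (\<sigma> y) * s (\<sigma> y)) has_real_derivative S2 x) (at x)"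
    by (simp add: S2_def S)
  then show ?thesis
    by (rule has_field_derivative_transform_within_open[OF _ open_positive_S]) (use x deriv_S in auto)
qed

lemma continuous_S2: "continuous_on {x \<in> J. 0 < S x} S2"
proof -
  have \<sigma>_cont: "continuous_on {x \<in> J. 0 < S x} \<sigma>"
    by (rule DERIV_continuous_on[OF has_field_derivative_at_within[OF \<sigma>_deriv]]) auto
  have sub: "\<sigma> ` {x \<in> J. 0 < S x} \<subseteq> {t \<in> I. 0 < s t}"
    using \<sigma> by (auto simp: S)
  have "continuous_on {t \<in> I. 0 < s t} s"
    by (rule continuous_on_subset[OF continuous_scale]) auto
  with continuous_deriv continuous_deriv2 show ?thesis
    unfolding S2_def
    by (intro continuous_intros continuous_on_compose2[OF _ \<sigma>_cont sub])
qed

lemma S_nonconstant: "\<not> s constant_on I \<Longrightarrow> \<not> S constant_on J"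
  using S_\<tau> \<tau>_mem unfolding constant_on_def by metis

text \<open>An interval of zeros in conformal time would come from a nondegenerate interval of zeros
  of s in proper time, which has positive measure.\<close>

lemma S_nonzero:
  assumes "a < b" "{a..b} \<subseteq> J"
  shows "\<exists>x\<in>{a..b}. S x \<noteq> 0"
proof (rule ccontr)
  assume zero: "\<not> ?thesis"
  have ab: "a \<in> J" "b \<in> J"
    using assms by auto
  have less: "\<sigma> a < \<sigma> b"
    using \<tau>_mono \<sigma>[OF ab(1)] \<sigma>[OF ab(2)] assms(1)
    by (metis linorder_neqE_linordered_idom order_less_asym strict_mono_onD)
  have sub: "{\<sigma> a..\<sigma> b} \<subseteq> {t \<in> I. s t = 0}"
  proof
    fix t assume t: "t \<in> {\<sigma> a..\<sigma> b}"
    then have "t \<in> I"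
      using I(2) \<sigma>[OF ab(1)] \<sigma>[OF ab(2)] unfolding is_interval_1 by (metis atLeastAtMost_iff)
    have "\<tau> (\<sigma> a) \<le> \<tau> t" "\<tau> t \<le> \<tau> (\<sigma> b)"
      using t strict_mono_on_leD[OF \<tau>_mono \<sigma>(1)[OF ab(1)] \<open>t \<in> I\<close>]
        strict_mono_on_leD[OF \<tau>_mono \<open>t \<in> I\<close> \<sigma>(1)[OF ab(2)]] by simp_all
    then have "\<tau> t \<in> {a..b}"
      using \<sigma>[OF ab(1)] \<sigma>[OF ab(2)] by simp
    then show "t \<in> {t \<in> I. s t = 0}"
      using zero S_\<tau>[OF \<open>t \<in> I\<close>] \<open>t \<in> I\<close> by auto
  qed
  have "{t \<in> I. s t = 0} \<in> null_sets lborel"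
    using admits[OF t\<^sub>0] by (simp add: admits_conformal_time_def)
  from null_sets_subset[OF this _ sub] have "{\<sigma> a..\<sigma> b} \<in> null_sets lborel"
    by simp
  then have "emeasure lborel {\<sigma> a..\<sigma> b} = 0"
    by auto
  with less show False
    by simp
qed

text \<open>Where S is positive, S' = s s' turns the proper-time identity into this one. At a zero S
  is minimal, so both sides vanish.\<close>

lemma first_integral_scale:
  assumes "internal_parameters I s \<aa> H" "x \<in> J"
  shows "(deriv S x)\<^sup>2 = first_integral \<aa> H (S x)"
proof (cases "0 < S x")
  case True
  define t where "t = \<sigma> x"
  have t: "s t * ((deriv s t)\<^sup>2 + \<aa> / 3 * (s t)\<^sup>2 - 1) = H"
    using assms True \<sigma> by (auto simp: internal_parameters_def t_def S)
  have "(deriv S x)\<^sup>2 = s t * (s t * (deriv s t)\<^sup>2)"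
    using deriv_S[OF assms(2) True] by (simp add: t_def power2_eq_square)
  also have "s t * (deriv s t)\<^sup>2 = H - \<aa> / 3 * s t ^ 3 + s t"
    using t by (simp add: algebra_simps power2_eq_square power3_eq_cube)
  also have "s t * \<dots> = first_integral \<aa> H (s t)"
    by (simp add: first_integral_def algebra_simps power2_eq_square eval_nat_numeral)
  finally show ?thesis
    by (simp only: t_def S[of x])
next
  case False
  then have zero: "S x = 0"
    using S_nonneg[OF assms(2)] by simp
  obtain d where d: "0 < d" "ball x d \<subseteq> J"
    using J(2) assms(2) openE by blast
  have "deriv S x = 0"
  proof (rule DERIV_local_min[OF S_deriv[OF assms(2)] d(1)])
    show "\<forall>y. \<bar>x - y\<bar> < d \<longrightarrow> S x \<le> S y"
      using zero d(2) S_nonneg by (auto simp: dist_real_def)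
  qed
  then show ?thesis
    by (simp add: zero first_integral_def)
qed

end

subsection \<open>Geometry of the cylinder\<close>

lemma Ck_on_const: "Ck_on k U (\<lambda>_. c)"
  by (induction k arbitrary: c) (auto intro!: exI[of _ "\<lambda>_ _. 0"])

lemma smooth_on_const: "smooth_on U (\<lambda>_. c)"
  by (simp add: smooth_on_def Ck_on_const)

lemma smooth_on_bounded_linear_diff:
  assumes "bounded_linear f"
  shows "smooth_on U (\<lambda>x. f x - c)"
proof -
  have "Ck_on k U (\<lambda>x. f x - c)" for k
  proof (cases k)
    case 0
    then show ?thesis
      using continuous_on_diff[OF linear_continuous_on[OF assms] continuous_on_const] by simp
  next
    case (Suc n)
    have "((\<lambda>x. f x - c) has_derivative f) (at x)" for x
      using has_derivative_diff[OF bounded_linear_imp_has_derivative[OF assms] has_derivative_const[of c]] by simp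
    then show ?thesis
      unfolding Suc Ck_on.simps by (intro exI[of _ "\<lambda>_. f"]) (auto intro: Ck_on_const)
  qed
  then show ?thesis
    by (simp add: smooth_on_def)
qed

abbreviation (input) cylinder :: "point set" where
  "cylinder \<equiv> UNIV \<times> sphere 0 1"

abbreviation (input) level :: "real \<Rightarrow> point set" where
  "level r \<equiv> {x \<in> cylinder. fst x = r}"

lemma tangent_space_cylinder:
  assumes x: "x \<in> cylinder"
  shows "tangent_space cylinder x = UNIV \<times> {v. snd x \<bullet> v = 0}"
proof
  have norm_x: "snd x \<bullet> snd x = 1"
    using x by (auto simp: dot_square_norm)
  show "tangent_space cylinder x \<subseteq> UNIV \<times> {v. snd x \<bullet> v = 0}"
  proof
    fix v assume "v \<in> tangent_space cylinder x"
    then obtain \<gamma> where \<gamma>: "\<gamma> 0 = x" "\<forall>\<^sub>F t in nhds 0. \<gamma> t \<in> cylinder"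
      "(\<gamma> has_vector_derivative v) (at (0::real))"
      by (auto simp: tangent_space_def)
    have "((\<lambda>t. snd (\<gamma> t)) has_vector_derivative snd v) (at 0)"
      by (rule bounded_linear.has_vector_derivative[OF bounded_linear_snd \<gamma>(3)])
    from bounded_bilinear.has_vector_derivative[OF bounded_bilinear_inner this this]
    have "((\<lambda>t. snd (\<gamma> t) \<bullet> snd (\<gamma> t)) has_real_derivative 2 * (snd x \<bullet> snd v)) (at 0)"
      using \<gamma>(1) by (simp add: has_real_derivative_iff_has_vector_derivative inner_commute)
    moreover have "((\<lambda>t. snd (\<gamma> t) \<bullet> snd (\<gamma> t)) has_real_derivative 0) (at 0)"
    proof (rule DERIV_cong_ev[THEN iffD2, OF refl _ refl])
      show "\<forall>\<^sub>F t in nhds 0. snd (\<gamma> t) \<bullet> snd (\<gamma> t) = 1"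
        using \<gamma>(2) by eventually_elim (auto simp: dot_square_norm)
    qed simp
    ultimately have "2 * (snd x \<bullet> snd v) = 0"
      by (rule DERIV_unique)
    then show "v \<in> UNIV \<times> {v. snd x \<bullet> v = 0}"
      by (simp add: mem_Times_iff)
  qed
  show "UNIV \<times> {v. snd x \<bullet> v = 0} \<subseteq> tangent_space cylinder x"
  proof
    fix v :: point assume "v \<in> UNIV \<times> {v. snd x \<bullet> v = 0}"
    then have v: "snd x \<bullet> snd v = 0"
      by (simp add: mem_Times_iff)
    define q where "q = snd v \<bullet> snd v"
    \<comment> \<open>The straight line with direction v is projected radially to the sphere. By
      orthogonality its squared norm is 1 + t^2 q, so the normalizing factor is stationary at t =
      0.\<close>
    define \<gamma> where "\<gamma> t = (fst x + t * fst v, (1 / sqrt (1 + t\<^sup>2 * q)) *\<^sub>R (snd x + t *\<^sub>R snd v))" for t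
    have q: "0 \<le> q"
      by (simp add: q_def)
    have "\<gamma> t \<in> cylinder" for t
    proof -
      have "(snd x + t *\<^sub>R snd v) \<bullet> (snd x + t *\<^sub>R snd v) = 1 + t\<^sup>2 * q"
        using v norm_x by (simp add: inner_add_left inner_add_right inner_commute q_def power2_eq_square)
      then have "norm (snd x + t *\<^sub>R snd v) = sqrt (1 + t\<^sup>2 * q)"
        by (simp add: norm_eq_sqrt_inner)
      moreover have "0 < 1 + t\<^sup>2 * q"
        using q by (simp add: add_pos_nonneg)
      ultimately show ?thesis
        by (simp add: \<gamma>_def)
    qed
    moreover have "\<gamma> 0 = x"
      by (simp add: \<gamma>_def)
    moreover have "(\<gamma> has_vector_derivative v) (at 0)"
    proof -
      have "((\<lambda>t. fst x + t * fst v) has_vector_derivative fst v) (at 0)"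
        by (auto intro!: derivative_eq_intros simp: has_real_derivative_iff_has_vector_derivative[symmetric])
      moreover have "((\<lambda>t. 1 / sqrt (1 + t\<^sup>2 * q)) has_real_derivative 0) (at 0)"
        by (auto intro!: derivative_eq_intros)
      moreover have "((\<lambda>t. snd x + t *\<^sub>R snd v) has_vector_derivative snd v) (at 0)"
        by (auto intro!: derivative_eq_intros)
      ultimately have "((\<lambda>t. (fst x + t * fst v, (1 / sqrt (1 + t\<^sup>2 * q)) *\<^sub>R (snd x + t *\<^sub>R snd v)))
          has_vector_derivative (fst v, (1 / sqrt (1 + 0\<^sup>2 * q)) *\<^sub>R snd v + 0 *\<^sub>R (snd x + 0 *\<^sub>R snd v))) (at 0)"
        by (intro has_vector_derivative_Pair has_vector_derivative_scaleR)
      then show ?thesis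
        by (simp add: \<gamma>_def[abs_def])
    qed
    ultimately show "v \<in> tangent_space cylinder x"
      unfolding tangent_space_def by (auto intro!: exI[of _ \<gamma>])
  qed
qed

lemma tangent_space_level:
  assumes "X \<in> tangent_space (level r) x"
  shows "fst X = 0"
proof -
  obtain \<gamma> where \<gamma>: "\<forall>\<^sub>F t in nhds 0. \<gamma> t \<in> level r" "(\<gamma> has_vector_derivative X) (at (0::real))"
    using assms by (auto simp: tangent_space_def)
  have "((\<lambda>t. fst (\<gamma> t)) has_real_derivative fst X) (at 0)"
    using bounded_linear.has_vector_derivative[OF bounded_linear_fst \<gamma>(2)]
    by (simp add: has_real_derivative_iff_has_vector_derivative)
  moreover have "((\<lambda>t. fst (\<gamma> t)) has_real_derivative 0) (at 0)"
  proof (rule DERIV_cong_ev[THEN iffD2, OF refl _ refl])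
    show "\<forall>\<^sub>F t in nhds 0. fst (\<gamma> t) = r"
      using \<gamma>(1) by eventually_elim auto
  qed simp
  ultimately show ?thesis
    by (rule DERIV_unique)
qed

lemma spacelike_level: "spacelike (level r)"
proof -
  have "0 < minkowski X X" if "X \<in> tangent_space (level r) x" "X \<noteq> 0" for x X
  proof -
    have "fst X = 0"
      using tangent_space_level[OF that(1)] .
    with that(2) show ?thesis
      by (simp add: minkowski_def prod_eq_iff)
  qed
  then show ?thesis
    by (simp add: spacelike_def)
qed

lemma time_direction_tangent: "x \<in> cylinder \<Longrightarrow> (1, 0) \<in> tangent_space cylinder x"
  by (simp add: tangent_space_cylinder)

lemma hypersurface_level: "hypersurface_in cylinder (level r)"
  unfolding hypersurface_in_def
proof (intro conjI ballI)
  fix x assume "x \<in> level r"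
  define f :: "point \<Rightarrow> real" where "f = (\<lambda>y. fst y - r)"
  have "(f has_derivative fst) (at y)" for y
    unfolding f_def by (auto intro!: derivative_eq_intros)
  then have "frechet_derivative f (at y) = fst" for y
    by (metis frechet_derivative_at)
  moreover have "smooth_on UNIV f"
    unfolding f_def by (rule smooth_on_bounded_linear_diff[OF bounded_linear_fst])
  ultimately show "\<exists>U f. open U \<and> x \<in> U \<and> smooth_on U (f :: point \<Rightarrow> real) \<and>
      level r \<inter> U = {y \<in> cylinder \<inter> U. f y = 0} \<and>
      (\<forall>y\<in>level r \<inter> U. \<exists>X\<in>tangent_space cylinder y. frechet_derivative f (at y) X \<noteq> 0)"
    by (intro exI[of _ UNIV] exI[of _ f]) (auto simp: f_def intro!: bexI[OF _ time_direction_tangent])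
qed auto

text \<open>The coordinate field of \<open>\<tau>\<close> is a parallel unit normal field.\<close>

lemma totally_umbilical_level: "totally_umbilical_in cylinder (level r)"
  unfolding totally_umbilical_in_def
proof (intro ballI exI conjI)
  fix x y assume y: "y \<in> level r \<inter> UNIV"
  then show "(1, 0) \<in> tangent_space cylinder y"
    by (intro time_direction_tangent) auto
  show "minkowski (1, 0) Y = 0" if "Y \<in> tangent_space (level r) y" for Y
    using tangent_space_level[OF that] by (simp add: minkowski_def)
  show "minkowski (frechet_derivative (\<lambda>_. (1, 0)) (at y) X) Y = 0 * minkowski X Y" for X Y :: point
    by (simp add: minkowski_def)
qed (auto simp: smooth_on_const minkowski_def)

section \<open>Nondegeneracy and signature of a rescaled Minkowski form\<close>

context
  fixes x :: point and k :: real and B :: "point \<Rightarrow> point \<Rightarrow> real"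
  assumes x: "x \<in> cylinder" and k: "k \<noteq> 0" and B: "\<And>X Y. B X Y = k\<^sup>2 * minkowski X Y"
begin

lemma nondegenerate_conformal: "nondegenerate_on (tangent_space cylinder x) B"
  unfolding nondegenerate_on_def
proof (intro ballI impI)
  fix X assume X: "X \<in> tangent_space cylinder x" and *: "\<forall>Y\<in>tangent_space cylinder x. B X Y = 0"
  have "(1, 0) \<in> tangent_space cylinder x" "(0, snd X) \<in> tangent_space cylinder x"
    using X x by (auto simp: tangent_space_cylinder)
  then have "minkowski X (1, 0) = 0" "minkowski X (0, snd X) = 0"
    using * k by (simp_all add: B)
  then show "X = 0"
    by (simp add: minkowski_def prod_eq_iff)
qed

lemma lorentz_conformal: "lorentz_type_on (tangent_space cylinder x) B"
proof -
  define P where "P = {v. snd x \<bullet> v = 0}"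
  have V: "tangent_space cylinder x = UNIV \<times> P"
    using tangent_space_cylinder[OF x] by (simp add: P_def)
  have P: "subspace P"
    unfolding P_def by (rule subspace_hyperplane)
  have "snd x \<noteq> 0"
    using x by auto
  then have dimP: "dim P = 3"
    unfolding P_def by (simp add: dim_hyperplane)
  have dimV: "dim (tangent_space cylinder x) = 4"
    unfolding V using P by (simp add: dim_Times dimP)
  obtain C where C: "C \<subseteq> P" "pairwise orthogonal C" "\<And>v. v \<in> C \<Longrightarrow> norm v = 1"
    "independent C" "card C = dim P" "span C = P"
    using orthonormal_basis_subspace[OF P] by blast
  have "finite C"
    using C(4) by (rule independent_imp_finite)
  then obtain b where b: "bij_betw b {0..<3::nat} C"
    using ex_bij_betw_nat_finite[of C] C(5) dimP by auto
  \<comment> \<open>The unit time vector and an orthonormal basis of the tangent space of the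
    sphere, all divided by k. Index 0 is the time direction, hence the shift by one in
    \<open>b\<close>.\<close>
  define e :: "nat \<Rightarrow> point" where "e i = (if i = 0 then (1 / k, 0) else (0, (1 / k) *\<^sub>R b (i - 1)))" for i
  have inner_b: "b i \<bullet> b j = (if i = j then 1 else 0)" if "i < 3" "j < 3" for i j
  proof -
    have mem: "b i \<in> C" "b j \<in> C"
      using b that by (auto simp: bij_betw_def)
    have "b i \<noteq> b j" if "i \<noteq> j"
      using b \<open>i < 3\<close> \<open>j < 3\<close> that by (auto simp: bij_betw_def inj_on_def)
    then show ?thesis
      using C(2,3) mem by (auto simp: pairwise_def orthogonal_def dot_square_norm)
  qed
  have "B (e i) (e j) = (if i \<noteq> j then 0 else if i = 0 then -1 else 1)" if "i < 4" "j < 4" for i j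
  proof -
    have "b (i - 1) \<bullet> b (j - 1) = (if i = j then 1 else 0)" if "i \<noteq> 0" "j \<noteq> 0"
      using inner_b[of "i - 1" "j - 1"] \<open>i < 4\<close> \<open>j < 4\<close> that by auto
    then show ?thesis
      using k by (auto simp: B minkowski_def e_def power2_eq_square)
  qed
  moreover have "span (e ` {..<4}) = tangent_space cylinder x"
  proof
    have "subspace (tangent_space cylinder x)"
      unfolding V using P by (simp add: subspace_Times)
    moreover have "e i \<in> tangent_space cylinder x" if "i < 4" for i
    proof (cases "i = 0")
      case True
      then show ?thesis
        using P by (simp add: V e_def subspace_0)
    next
      case False
      then have "b (i - 1) \<in> P"
        using b C(1) that by (auto simp: bij_betw_def)
      with False show ?thesis
        using P by (simp add: V e_def subspace_scale)
    qed
    ultimately show "span (e ` {..<4}) \<subseteq> tangent_space cylinder x"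
      by (intro span_minimal) auto
    show "tangent_space cylinder x \<subseteq> span (e ` {..<4})"
    proof
      fix X assume X: "X \<in> tangent_space cylinder x"
      define j :: "real ^ 4 \<Rightarrow> point" where "j = Pair 0"
      have "j ` C \<subseteq> span (e ` {..<4})"
      proof
        fix Y assume "Y \<in> j ` C"
        then obtain i where i: "i < 3" "Y = (0, b i)"
          using b by (auto simp: bij_betw_def image_iff j_def)
        have "k *\<^sub>R e (Suc i) \<in> span (e ` {..<4})"
          using i by (intro span_scale span_base) auto
        then show "Y \<in> span (e ` {..<4})"
          using i k by (simp add: e_def)
      qed
      then have "span (j ` C) \<subseteq> span (e ` {..<4})"
        by (rule span_minimal) simp
      moreover have "linear j"
        unfolding j_def by (intro linearI) auto
      ultimately have "j ` P \<subseteq> span (e ` {..<4})"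
        using C(6) span_linear_image by metis
      then have "(0, snd X) \<in> span (e ` {..<4})"
        using X by (auto simp: V mem_Times_iff j_def)
      moreover have "(k * fst X) *\<^sub>R e 0 \<in> span (e ` {..<4})"
        by (intro span_scale span_base) auto
      ultimately have "(k * fst X) *\<^sub>R e 0 + (0, snd X) \<in> span (e ` {..<4})"
        by (rule span_add[rotated])
      then show "X \<in> span (e ` {..<4})"
        using k by (simp add: e_def)
    qed
  qed
  ultimately show ?thesis
    unfolding lorentz_type_on_def dimV by (intro exI[of _ e]) auto
qed

end

subsection \<open>Critical spacetimes\<close>

locale critical_spacetime = critical_profile L \<aa> H c \<omega> + RW_spacetime \<Lambda> I s
  for L \<aa> H c \<omega> \<Lambda> I s +
  assumes nonconstant: "\<not> s constant_on I"
    and parameters: "internal_parameters I s \<aa> H"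
    and maximal: "maximal_domain I s \<aa> H"
begin

lemma critical_translate: "critical_conformal_scale \<aa> H UNIV (\<lambda>x. profile (x + d))"
proof -
  have der: "((\<lambda>x. profile (x + d)) has_real_derivative profile' (x + d)) (at x)" for x
    using has_real_derivative_profile[of "x + d"] by (simp add: DERIV_shift)
  have "(profile' (x + d))\<^sup>2 + \<aa> / 3 * profile (x + d) ^ 4 - (profile (x + d))\<^sup>2 - H * profile (x + d) = 0" for x
    unfolding profile'_square first_integral_def by simp
  then show ?thesis
    unfolding critical_conformal_scale_def
    using der profile_nonneg DERIV_imp_deriv[OF der]
    by (auto simp: open_interval_def real_differentiable_def)
qed

lemma conformal_scale_translate:
  assumes t: "t \<in> I"
  shows "conformal_domain I s t = UNIV" and "\<exists>d. \<forall>x. conformal_scale I s t x = profile (x + d)"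
proof -
  interpret C: conformal_RW_spacetime \<Lambda> I s t
    by unfold_locales (rule t)
  obtain d where d: "\<And>x. x \<in> C.J \<Longrightarrow> C.S x = profile (x + d)"
    using solution_is_translate[OF C.J(1) C.S_nonneg C.S_deriv C.first_integral_scale[OF parameters]
        C.deriv_S_deriv C.continuous_S2 C.S_nonconstant[OF nonconstant] C.S_nonzero] by blast
  have "UNIV = conformal_domain I s t"
    using maximal t critical_translate[of d] d
    unfolding maximal_domain_def C.J_def C.S_def by (metis subset_UNIV)
  then show "conformal_domain I s t = UNIV"
    by simp
  then show "\<exists>d. \<forall>x. conformal_scale I s t x = profile (x + d)"
    using d by (auto simp: C.J_def C.S_def)
qed

text \<open>A translate by \<open>d1\<close> vanishes at \<open>- d1\<close>, which supplies a zero
  of s. Taking that zero as the new origin forces the new translation constant to satisfy profile d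
  = 0; then d is a lattice point and the translation by d is invisible.\<close>

lemma exists_normalized_origin:
  obtains t where "t \<in> I" "conformal_domain I s t = UNIV" "conformal_scale I s t = profile"
proof -
  obtain t1 where t1: "t1 \<in> I"
    using I(3) by blast
  obtain d1 where "\<forall>x. conformal_scale I s t1 x = profile (x + d1)"
    using conformal_scale_translate(2)[OF t1] by blast
  note d1 = conformal_scale_translate(1)[OF t1] spec[OF this]
  interpret C1: conformal_RW_spacetime \<Lambda> I s t1
    by unfold_locales (rule t1)
  define t where "t = C1.\<sigma> (- d1)"
  have t: "t \<in> I" "s t = 0"
    using C1.\<sigma>(1)[of "- d1"] d1(2)[of "- d1"] C1.S[of "- d1"] zero_mem
    by (auto simp: t_def C1.J_def d1(1) C1.S_def profile_def)
  obtain d where "\<forall>x. conformal_scale I s t x = profile (x + d)"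
    using conformal_scale_translate(2)[OF t(1)] by blast
  note d = conformal_scale_translate(1)[OF t(1)] spec[OF this]
  interpret C: conformal_RW_spacetime \<Lambda> I s t
    by unfold_locales (rule t(1))
  have "C.\<tau> t = 0"
    by (simp add: C.\<tau>_def conformal_time_def)
  then have "profile d = 0"
    using C.S_\<tau>[OF t(1)] t(2) d(2)[of 0] by (simp add: C.S_def)
  then have "conformal_scale I s t x = profile x" for x
    using d(2) profile_add[of d x] profile_zero_iff by simp
  with t(1) d(1) show ?thesis
    using that by blast
qed

section \<open>Matter and the energy conditions\<close>

definition min_inverse :: real where
  "min_inverse = (2 * c - 1) / (3 * H)"

lemma min_inverse_pos: "0 < min_inverse"
  using c H by (simp add: min_inverse_def)

text \<open>This is the equation Q(x) = 0 at x = \<open>max_scale\<close>, solved for \<aa> and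
  written in 1/x.\<close>

lemma \<aa>_min_inverse: "\<aa> = 3 * H * min_inverse ^ 3 + 3 * min_inverse\<^sup>2"
  using H by (simp add: \<aa>_eq min_inverse_def field_simps eval_nat_numeral)

lemma inverse_scale_ge:
  assumes "t \<in> I" "0 < s t"
  shows "min_inverse \<le> 1 / s t"
proof -
  obtain d where d: "\<forall>x. conformal_scale I s t x = profile (x + d)"
    using conformal_scale_translate(2)[OF assms(1)] by blast
  interpret C: conformal_RW_spacetime \<Lambda> I s t
    by unfold_locales (rule assms(1))
  have "s t \<le> max_scale"
    using C.S_\<tau>[OF assms(1)] d profile_range by (metis C.S_def atLeastAtMost_iff)
  then show ?thesis
    using assms(2) c H by (simp add: max_scale_def min_inverse_def field_simps)
qed

lemma exists_min_inverse:
  obtains t where "t \<in> I" "0 < s t" "1 / s t = min_inverse"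
proof -
  obtain t where t: "t \<in> I" "conformal_domain I s t = UNIV" "conformal_scale I s t = profile"
    using exists_normalized_origin .
  interpret C: conformal_RW_spacetime \<Lambda> I s t
    by unfold_locales (rule t(1))
  obtain x where x: "profile x = max_scale"
    using profile_attains_max by blast
  then have "C.\<sigma> x \<in> I" "s (C.\<sigma> x) = max_scale"
    using C.\<sigma>(1)[of x] C.S[of x] t(2,3) by (simp_all add: C.J_def C.S_def)
  moreover have "1 / max_scale = min_inverse"
    by (simp add: max_scale_def min_inverse_def)
  ultimately show ?thesis
    using that max_scale_pos by metis
qed

text \<open>The first integral eliminates the square of the first derivative of s, and the
  second-order equation eliminates the second derivative. \<aa> and \<Lambda> then enter only
  through their sum.\<close>

lemma matter:
  assumes t: "t \<in> I" "0 < s t"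
  defines "u \<equiv> 1 / s t"
  shows "energy_density \<Lambda> s t = 3 / (8 * pi) * (H * u ^ 3 + 2 * u\<^sup>2 - (\<aa> + \<Lambda>) / 3)"
    and "pressure \<Lambda> s t = - (1 / (4 * pi)) * (u\<^sup>2 - (\<aa> + \<Lambda>) / 2)"
proof -
  interpret C: conformal_RW_spacetime \<Lambda> I s t
    by unfold_locales (rule t(1))
  define x where "x = C.\<tau> t"
  have x: "x \<in> C.J" "C.S x = s t" "C.\<sigma> x = t"
    using t by (simp_all add: x_def C.\<tau>_mem C.S_\<tau> C.\<sigma>_\<tau>)
  have "C.S2 x = G (C.S x)"
    using C.J C.S_nonneg C.S_deriv C.first_integral_scale[OF parameters] C.deriv_S_deriv C.continuous_S2
      C.S_nonconstant[OF nonconstant] x(1,2) t(2)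
    by (intro second_order_equation_positive[where J = C.J and S = C.S and v = "deriv C.S"])
      (auto simp: open_interval_def is_interval_connected)
  then have second: "(deriv (deriv s) t * s t + (deriv s t)\<^sup>2) * s t = s t + H / 2 - 2 * \<aa> / 3 * s t ^ 3"
    by (simp add: C.S2_def x(2,3) force_def)
  have first: "s t * ((deriv s t)\<^sup>2 + \<aa> / 3 * (s t)\<^sup>2 - 1) = H"
    using parameters t by (simp add: internal_parameters_def)
  have d1: "(deriv s t)\<^sup>2 = H / s t + 1 - \<aa> / 3 * (s t)\<^sup>2"
    using first t(2) by (simp add: field_simps)
  have half: "H / (2 * s t) = H / s t / 2"
    by simp
  have "deriv (deriv s) t * s t + (deriv s t)\<^sup>2 = 1 + H / (2 * s t) - 2 * \<aa> / 3 * (s t)\<^sup>2"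
    using second t(2) by (simp add: field_simps power2_eq_square power3_eq_cube)
  then have "deriv (deriv s) t * s t = - H / (2 * s t) - \<aa> / 3 * (s t)\<^sup>2"
    using d1 half by linarith
  then have "deriv (deriv s) t = (- H / (2 * s t) - \<aa> / 3 * (s t)\<^sup>2) / s t"
    using t(2) by (simp add: eq_divide_eq)
  also have "\<dots> = - H / (2 * (s t)\<^sup>2) - \<aa> / 3 * s t"
    using t(2) by (simp add: field_simps power2_eq_square)
  finally have d2: "deriv (deriv s) t = - H / (2 * (s t)\<^sup>2) - \<aa> / 3 * s t" .
  show "energy_density \<Lambda> s t = 3 / (8 * pi) * (H * u ^ 3 + 2 * u\<^sup>2 - (\<aa> + \<Lambda>) / 3)"
    unfolding energy_density_def d1 u_def using t(2) by (simp add: field_simps eval_nat_numeral)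
  show "pressure \<Lambda> s t = - (1 / (4 * pi)) * (u\<^sup>2 - (\<aa> + \<Lambda>) / 2)"
    unfolding pressure_def d1 d2 u_def using t(2) by (simp add: field_simps eval_nat_numeral)
qed

text \<open>After multiplication by 8 pi both quantities are polynomials in u. In 8 pi (m + p) the
  constant \<aa> + \<Lambda> cancels and 3H u^3 + 4u^2 remains, which is why the weak condition puts
  no bound on \<Lambda>.\<close>

lemma energy_combinations:
  assumes t: "t \<in> I" "0 < s t"
  defines "u \<equiv> 1 / s t"
  shows "0 \<le> energy_density \<Lambda> s t \<longleftrightarrow> \<Lambda> \<le> 3 * H * u ^ 3 + 6 * u\<^sup>2 - \<aa>"
    and "- energy_density \<Lambda> s t \<le> pressure \<Lambda> s t"
    and "pressure \<Lambda> s t \<le> energy_density \<Lambda> s t \<longleftrightarrow> \<Lambda> \<le> 3 / 2 * H * u ^ 3 + 4 * u\<^sup>2 - \<aa>"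
    and "- energy_density \<Lambda> s t / 3 \<le> pressure \<Lambda> s t \<longleftrightarrow> - \<aa> - 3 / 2 * H * u ^ 3 \<le> \<Lambda>"
proof -
  define m p where "m = energy_density \<Lambda> s t" and "p = pressure \<Lambda> s t"
  have cancel: "8 * pi * (3 / (8 * pi) * x) = 3 * x" "8 * pi * (- (1 / (4 * pi)) * x) = - 2 * x" for x :: real
    by simp_all
  have "8 * pi * m = 3 * (H * u ^ 3 + 2 * u\<^sup>2 - (\<aa> + \<Lambda>) / 3)"
    and "8 * pi * p = - 2 * (u\<^sup>2 - (\<aa> + \<Lambda>) / 2)"
    unfolding m_def p_def u_def matter[OF t] by (simp_all only: cancel)
  then have m: "8 * pi * m = 3 * H * u ^ 3 + 6 * u\<^sup>2 - (\<aa> + \<Lambda>)"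
    and p: "8 * pi * p = (\<aa> + \<Lambda>) - 2 * u\<^sup>2"
    by argo+
  have u: "0 < u"
    using t by (simp add: u_def)
  have scale: "x \<le> y \<longleftrightarrow> 8 * pi * x \<le> 8 * pi * y" for x y :: real
    by simp
  have pos: "0 \<le> H * u ^ 3" "0 \<le> u\<^sup>2"
    using H u by simp_all
  show "0 \<le> m \<longleftrightarrow> \<Lambda> \<le> 3 * H * u ^ 3 + 6 * u\<^sup>2 - \<aa>"
    unfolding scale[of 0] m by auto
  show "- m \<le> p"
    unfolding scale[of "- m"] mult_minus_right m p using pos by linarith
  show "p \<le> m \<longleftrightarrow> \<Lambda> \<le> 3 / 2 * H * u ^ 3 + 4 * u\<^sup>2 - \<aa>"
    unfolding scale[of p] m p by auto
  have "- m / 3 \<le> p \<longleftrightarrow> - m \<le> 3 * p"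
    by linarith
  also have "\<dots> \<longleftrightarrow> - (8 * pi * m) \<le> 3 * (8 * pi * p)"
    unfolding scale[of "- m"] by (simp only: mult_minus_right mult.left_commute)
  finally show "- m / 3 \<le> p \<longleftrightarrow> - \<aa> - 3 / 2 * H * u ^ 3 \<le> \<Lambda>"
    unfolding m p by auto
qed

lemma bound_at_min_inverse:
  assumes "0 \<le> \<alpha>" "0 \<le> \<beta>"
  shows "(\<forall>t\<in>I. 0 < s t \<longrightarrow> x \<le> \<alpha> * (1 / s t) ^ 3 + \<beta> * (1 / s t)\<^sup>2)
    \<longleftrightarrow> x \<le> \<alpha> * min_inverse ^ 3 + \<beta> * min_inverse\<^sup>2"
proof
  assume "\<forall>t\<in>I. 0 < s t \<longrightarrow> x \<le> \<alpha> * (1 / s t) ^ 3 + \<beta> * (1 / s t)\<^sup>2"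
  moreover obtain t where "t \<in> I" "0 < s t" "1 / s t = min_inverse"
    using exists_min_inverse .
  ultimately show "x \<le> \<alpha> * min_inverse ^ 3 + \<beta> * min_inverse\<^sup>2"
    by metis
next
  assume le: "x \<le> \<alpha> * min_inverse ^ 3 + \<beta> * min_inverse\<^sup>2"
  show "\<forall>t\<in>I. 0 < s t \<longrightarrow> x \<le> \<alpha> * (1 / s t) ^ 3 + \<beta> * (1 / s t)\<^sup>2"
  proof (intro ballI impI order_trans[OF le] add_mono mult_left_mono power_mono)
    fix t assume "t \<in> I" "0 < s t"
    then show "min_inverse \<le> 1 / s t" "min_inverse \<le> 1 / s t"
      by (rule inverse_scale_ge)+
  qed (use assms min_inverse_pos in auto)
qed

text \<open>This is where the thresholds come from: they are the bounds on \<Lambda> from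
  nonnegative density, from p \<le> m and from -m/3 \<le> p, taken at the least value of
  1/s.\<close>

lemma h_min_inverse:
  assumes "cosh \<theta> = c"
  shows "h\<^sub>1 \<theta> H = 3 * H * min_inverse ^ 3 + 6 * min_inverse\<^sup>2 - \<aa>"
    and "h\<^sub>2 \<theta> H = 3 / 2 * H * min_inverse ^ 3 + 4 * min_inverse\<^sup>2 - \<aa>"
    and "h\<^sub>3 \<theta> H = - \<aa> - 3 / 2 * H * min_inverse ^ 3"
  unfolding h\<^sub>1_def h\<^sub>2_def h\<^sub>3_def assms \<aa>_min_inverse
  using H by (simp_all add: min_inverse_def field_simps eval_nat_numeral)

lemma \<Lambda>_le: "cosh \<theta> = c \<Longrightarrow> \<Lambda> \<le> h\<^sub>1 \<theta> H"
proof -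
  assume "cosh \<theta> = c"
  obtain t where t: "t \<in> I" "0 < s t" "1 / s t = min_inverse"
    using exists_min_inverse .
  have "0 \<le> energy_density \<Lambda> s t"
    using RW t by (simp add: closed_RW_spacetime_def)
  then show ?thesis
    using energy_combinations(1)[OF t(1,2)] by (simp add: t(3) h_min_inverse \<open>cosh \<theta> = c\<close>)
qed

lemma weak: "weak_energy_condition \<Lambda> I s"
  by (simp add: weak_energy_condition_def energy_combinations)

lemma pressure_le_density_iff:
  assumes "cosh \<theta> = c"
  shows "(\<forall>t\<in>I. 0 < s t \<longrightarrow> pressure \<Lambda> s t \<le> energy_density \<Lambda> s t) \<longleftrightarrow> \<Lambda> \<le> h\<^sub>2 \<theta> H"
proof -
  have "(\<forall>t\<in>I. 0 < s t \<longrightarrow> pressure \<Lambda> s t \<le> energy_density \<Lambda> s t) \<longleftrightarrow>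
      (\<forall>t\<in>I. 0 < s t \<longrightarrow> \<Lambda> + \<aa> \<le> 3 / 2 * H * (1 / s t) ^ 3 + 4 * (1 / s t)\<^sup>2)"
    by (auto simp: energy_combinations)
  also have "\<dots> \<longleftrightarrow> \<Lambda> + \<aa> \<le> 3 / 2 * H * min_inverse ^ 3 + 4 * min_inverse\<^sup>2"
    using H by (intro bound_at_min_inverse) auto
  also have "\<dots> \<longleftrightarrow> \<Lambda> \<le> h\<^sub>2 \<theta> H"
    by (auto simp: h_min_inverse[OF assms])
  finally show ?thesis .
qed

lemma dominant_iff: "cosh \<theta> = c \<Longrightarrow> dominant_energy_condition \<Lambda> I s \<longleftrightarrow> \<Lambda> \<le> h\<^sub>2 \<theta> H"
  using pressure_le_density_iff[of \<theta>] by (simp add: dominant_energy_condition_def energy_combinations(2))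

lemma strong_iff:
  assumes "cosh \<theta> = c"
  shows "strong_energy_condition \<Lambda> I s \<longleftrightarrow> h\<^sub>3 \<theta> H \<le> \<Lambda> \<and> \<Lambda> \<le> h\<^sub>2 \<theta> H"
proof -
  have "(\<forall>t\<in>I. 0 < s t \<longrightarrow> - energy_density \<Lambda> s t / 3 \<le> pressure \<Lambda> s t) \<longleftrightarrow>
      (\<forall>t\<in>I. 0 < s t \<longrightarrow> - \<aa> - \<Lambda> \<le> 3 / 2 * H * (1 / s t) ^ 3 + 0 * (1 / s t)\<^sup>2)"
    using energy_combinations(4) by (intro ball_cong refl imp_cong) auto
  also have "\<dots> \<longleftrightarrow> - \<aa> - \<Lambda> \<le> 3 / 2 * H * min_inverse ^ 3 + 0 * min_inverse\<^sup>2"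
    using H by (intro bound_at_min_inverse) auto
  also have "\<dots> \<longleftrightarrow> h\<^sub>3 \<theta> H \<le> \<Lambda>"
    by (auto simp: h_min_inverse[OF assms])
  finally show ?thesis
    using pressure_le_density_iff[OF assms] unfolding strong_energy_condition_def by blast
qed

end

section \<open>From the angular parameter to the constant c\<close>

lemma cosh_triple: "cosh (3 * x) = cosh x * (4 * (cosh x)\<^sup>2 - 3)" for x :: real
proof -
  have "cosh (3 * x) = cosh (x + 2 * x)"
    by simp
  also have "\<dots> = cosh x * (4 * (cosh x)\<^sup>2 - 3)"
    unfolding cosh_add cosh_double sinh_double using sinh_square_eq[of x] by algebra
  finally show ?thesis .
qed

lemma angular_parameter_imp:
  assumes "type_and_angular_parameter \<aa> H (-1) \<theta>"
  shows "1 < cosh \<theta>" "\<aa> * H\<^sup>2 = 2 / 9 * (cosh \<theta> + 1) * (2 * cosh \<theta> - 1)\<^sup>2"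
proof -
  define e1 e2 where "e1 = - cosh \<theta> / 12" and "e2 = sinh \<theta> / (4 * sqrt 3)"
  have \<theta>: "0 < \<theta>" and "\<forall>x::complex. 4 * x ^ 3 - of_real invariant_g2 * x - of_real (invariant_g3 \<aa> H) =
        4 * (x - Complex e1 e2) * (x - Complex e1 (- e2)) * (x - of_real (- 2 * e1))"
    using assms by (simp_all add: type_and_angular_parameter_def e1_def e2_def Let_def)
  \<comment> \<open>At x = 0 the factorization compares constant terms: g3 is four times the product
    of the roots, that is, -8 e1 (e1^2 + e2^2).\<close>
  from spec[OF this(2), of 0]
  have "- invariant_g3 \<aa> H = Re (4 * (0 - Complex e1 e2) * (0 - Complex e1 (- e2)) * (0 - of_real (- 2 * e1)))"
    by (metis (no_types, lifting) Re_complex_of_real diff_0 mult_zero_right of_real_minus power_zero_numeral diff_self)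
  also have "\<dots> = 8 * e1 * (e1\<^sup>2 + e2\<^sup>2)"
    by (simp add: algebra_simps power2_eq_square)
  also have "e2\<^sup>2 = ((cosh \<theta>)\<^sup>2 - 1) / 48"
    by (simp add: e2_def power_divide power_mult_distrib sinh_square_eq)
  finally have "\<aa> * H\<^sup>2 - 2 / 9 = 2 / 9 * cosh \<theta> * (4 * (cosh \<theta>)\<^sup>2 - 3)"
    by (simp add: invariant_g3_def e1_def field_simps power2_eq_square)
  then show "\<aa> * H\<^sup>2 = 2 / 9 * (cosh \<theta> + 1) * (2 * cosh \<theta> - 1)\<^sup>2"
    by (simp add: field_simps power2_eq_square)
  have "0 < (sinh \<theta>)\<^sup>2"
    using \<theta> by simp
  then have "1\<^sup>2 < (cosh \<theta>)\<^sup>2"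
    by (simp add: sinh_square_eq)
  then show "1 < cosh \<theta>"
    by (rule power_less_imp_less_base) simp
qed

theorem theorem5:
  fixes \<Lambda> \<aa> H \<theta> \<omega> :: real and I :: "real set" and s :: "real \<Rightarrow> real" and L :: "complex set"
  assumes "closed_RW_spacetime \<Lambda> I s"
    and "m_critical \<Lambda> I s"
    and "\<not> s constant_on I"
    and "internal_parameters I s \<aa> H"
    and "H \<noteq> 0"
    and "maximal_domain I s \<aa> H"
    and "class_II \<aa> H"
    and "type_and_angular_parameter \<aa> H (-1) \<theta>"
    and "weierstrass_lattice \<theta> (-1) L"
    and "real_half_period L \<omega>"
  shows "0 < H \<and>
    \<Lambda> \<le> h\<^sub>1 \<theta> H \<and>
    (\<exists>t\<^sub>0\<in>I.
       conformal_model I s t\<^sub>0 = UNIV \<times> sphere 0 1 \<and>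
       cyclic I s t\<^sub>0 \<and>
       (\<forall>x\<in>conformal_model I s t\<^sub>0.
          \<forall>X\<in>tangent_space (conformal_model I s t\<^sub>0) x.
          \<forall>Y\<in>tangent_space (conformal_model I s t\<^sub>0) x.
            conformal_form I s t\<^sub>0 x X Y = conformal_factor L H (fst x) * minkowski X Y) \<and>
       (\<forall>h::int.
          hypersurface_in (conformal_model I s t\<^sub>0) (slice I s t\<^sub>0 \<omega> h) \<and>
          spacelike (slice I s t\<^sub>0 \<omega> h) \<and>
          totally_umbilical_in (conformal_model I s t\<^sub>0) (slice I s t\<^sub>0 \<omega> h) \<and>
          (\<forall>x\<in>slice I s t\<^sub>0 \<omega> h.
             \<forall>X\<in>tangent_space (conformal_model I s t\<^sub>0) x.
             \<forall>Y\<in>tangent_space (conformal_model I s t\<^sub>0) x.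
               conformal_form I s t\<^sub>0 x X Y = 0)) \<and>
       (\<forall>x\<in>conformal_model I s t\<^sub>0 - (\<Union>h. slice I s t\<^sub>0 \<omega> h).
          nondegenerate_on (tangent_space (conformal_model I s t\<^sub>0) x) (conformal_form I s t\<^sub>0 x) \<and>
          lorentz_type_on (tangent_space (conformal_model I s t\<^sub>0) x) (conformal_form I s t\<^sub>0 x))) \<and>
    weak_energy_condition \<Lambda> I s \<and>
    (dominant_energy_condition \<Lambda> I s \<longleftrightarrow> \<Lambda> \<le> h\<^sub>2 \<theta> H) \<and>
    (strong_energy_condition \<Lambda> I s \<longleftrightarrow> h\<^sub>3 \<theta> H \<le> \<Lambda> \<and> \<Lambda> \<le> h\<^sub>2 \<theta> H)"
proof -
  define c where "c = cosh \<theta>"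
  note c = angular_parameter_imp[OF assms(8), folded c_def]
  interpret R: RW_spacetime \<Lambda> I s
    by unfold_locales (rule assms(1))
  have "0 < H"
  proof -
    obtain t where t: "t \<in> I" "0 < s t"
    proof -
      have "\<exists>t\<in>I. s t \<noteq> 0"
        using assms(3) unfolding constant_on_def by blast
      then show ?thesis
        using R.scale_nonneg that by (metis less_eq_real_def)
    qed
    \<comment> \<open>Inserting this expression for H into Q(s) leaves the square of s s', which is
      nonnegative; the sign analysis of Q then yields H > 0.\<close>
    have "H = s t * ((deriv s t)\<^sup>2 + \<aa> / 3 * (s t)\<^sup>2 - 1)"
      using assms(4) t by (simp add: internal_parameters_def)
    then have "first_integral \<aa> H (s t) =
        (s t)\<^sup>2 + s t * ((deriv s t)\<^sup>2 + \<aa> / 3 * (s t)\<^sup>2 - 1) * s t - \<aa> / 3 * s t ^ 4"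
      by (simp only: first_integral_def)
    also have "\<dots> = (s t)\<^sup>2 * (deriv s t)\<^sup>2"
      by (simp add: algebra_simps eval_nat_numeral)
    finally have "first_integral \<aa> H (s t) = (s t)\<^sup>2 * (deriv s t)\<^sup>2" .
    then show ?thesis
      using first_integral_nonneg_imp(1)[OF c(2,1) t(2) assms(5)] by simp
  qed
  interpret K: critical_spacetime L \<aa> H c \<omega> \<Lambda> I s
  proof unfold_locales
    show "period_lattice L" "lattice_g2 L = of_real (1 / 12)"
      using assms(9) by (simp_all add: weierstrass_lattice_def)
    show "lattice_g3 L = of_real (c * (4 * c\<^sup>2 - 3) / 216)"
      using assms(9) by (simp add: weierstrass_lattice_def cosh_triple c_def)
  qed (use assms c \<open>0 < H\<close> in auto)
  obtain t\<^sub>0 where t\<^sub>0: "t\<^sub>0 \<in> I" "conformal_domain I s t\<^sub>0 = UNIV" "conformal_scale I s t\<^sub>0 = K.profile"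
    using K.exists_normalized_origin .
  have model: "conformal_model I s t\<^sub>0 = cylinder"
    by (simp add: conformal_model_def t\<^sub>0)
  have slice: "slice I s t\<^sub>0 \<omega> h = level (2 * of_int h * \<omega>)" for h
    by (simp add: slice_def model)
  have form: "conformal_form I s t\<^sub>0 x X Y = (K.profile (fst x))\<^sup>2 * minkowski X Y" for x X Y
    by (simp add: conformal_form_def t\<^sub>0)
  have factor: "(K.profile \<tau>)\<^sup>2 = conformal_factor L H \<tau>" for \<tau>
    by (simp add: K.profile_def conformal_factor_def power_divide power_mult_distrib)
  have zero: "K.profile \<tau> = 0 \<longleftrightarrow> (\<exists>h::int. \<tau> = 2 * of_int h * \<omega>)" for \<tau>
    by (simp add: K.profile_zero_iff K.real_mem_iff)
  have "cyclic I s t\<^sub>0"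
    unfolding cyclic_def t\<^sub>0 using K.\<omega>_pos K.profile_periodic by (auto intro!: exI[of _ "2 * \<omega>"])
  moreover have "nondegenerate_on (tangent_space cylinder x) (conformal_form I s t\<^sub>0 x)"
    "lorentz_type_on (tangent_space cylinder x) (conformal_form I s t\<^sub>0 x)"
    if "x \<in> cylinder - (\<Union>h. slice I s t\<^sub>0 \<omega> h)" for x
  proof -
    have x: "x \<in> cylinder" "K.profile (fst x) \<noteq> 0"
      using that by (auto simp: zero slice)
    show "nondegenerate_on (tangent_space cylinder x) (conformal_form I s t\<^sub>0 x)"
      by (rule nondegenerate_conformal[OF x form])
    show "lorentz_type_on (tangent_space cylinder x) (conformal_form I s t\<^sub>0 x)"
      by (rule lorentz_conformal[OF x form])
  qed
  moreover have "conformal_form I s t\<^sub>0 x X Y = 0" if "x \<in> slice I s t\<^sub>0 \<omega> h" for x X Y h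
    using that zero[of "fst x"] by (auto simp: slice form)
  ultimately have exists: "\<exists>t\<^sub>0\<in>I.
       conformal_model I s t\<^sub>0 = UNIV \<times> sphere 0 1 \<and>
       cyclic I s t\<^sub>0 \<and>
       (\<forall>x\<in>conformal_model I s t\<^sub>0.
          \<forall>X\<in>tangent_space (conformal_model I s t\<^sub>0) x.
          \<forall>Y\<in>tangent_space (conformal_model I s t\<^sub>0) x.
            conformal_form I s t\<^sub>0 x X Y = conformal_factor L H (fst x) * minkowski X Y) \<and>
       (\<forall>h::int.
          hypersurface_in (conformal_model I s t\<^sub>0) (slice I s t\<^sub>0 \<omega> h) \<and>
          spacelike (slice I s t\<^sub>0 \<omega> h) \<and>
          totally_umbilical_in (conformal_model I s t\<^sub>0) (slice I s t\<^sub>0 \<omega> h) \<and>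
          (\<forall>x\<in>slice I s t\<^sub>0 \<omega> h.
             \<forall>X\<in>tangent_space (conformal_model I s t\<^sub>0) x.
             \<forall>Y\<in>tangent_space (conformal_model I s t\<^sub>0) x.
               conformal_form I s t\<^sub>0 x X Y = 0)) \<and>
       (\<forall>x\<in>conformal_model I s t\<^sub>0 - (\<Union>h. slice I s t\<^sub>0 \<omega> h).
          nondegenerate_on (tangent_space (conformal_model I s t\<^sub>0) x) (conformal_form I s t\<^sub>0 x) \<and>
          lorentz_type_on (tangent_space (conformal_model I s t\<^sub>0) x) (conformal_form I s t\<^sub>0 x))"
    by (intro bexI[of _ t\<^sub>0] conjI ballI allI)
      (simp_all only: model form factor slice hypersurface_level spacelike_level totally_umbilical_level t\<^sub>0(1))
  note c_eq = c_def[symmetric]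
  show ?thesis
    by (intro conjI \<open>0 < H\<close> K.\<Lambda>_le[OF c_eq] exists K.weak K.dominant_iff[OF c_eq] K.strong_iff[OF c_eq])
qed

end
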